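(* Let $k\in\mathbb{N}$ with $k>1$. There is a non-zero symbol $f\in L^\infty(\mathbb{C})$ such that $T_{f,(k)}=0$, and there is a non-zero operator $A\in\mathcal{C}_1(F^2_{(k)})$ such that $\widetilde A=0$. Moreover, if $\xi\in\mathbb{C}$ satisfies $L^0_{k-1}(|\xi|^2)=0$ and $f(z):=e^{i\sigma(z,\xi)+\frac{|\xi|^2}{2}}$, then $T_{f,(k)}=0$ and $T_{f,(1)}=W_\xi$ (on $F^2_{(1)}$).
   Context: Let $\mathrm{d}\mu(z)=\frac1\pi e^{-|z|^2}\,\mathrm{d}z$ on $\mathbb{C}\cong\mathbb{R}^2$. For $n\ge1$, $F_n^2$ is the closed subspace of $L^2(\mathbb{C},\mu)$ of smooth functions $f$ with $\partial^n f/\partial\overline z^n=0$; the true polyanalytic Fock spaces are $F^2_{(1)}:=F^2_1$ (the analytic Fock space) and $F^2_{(k)}:=F^2_k\ominus F^2_{k-1}$ for $k\ge2$, and $P_{(k)}$ is the orthogonal projection of $L^2(\mathbb{C},\mu)$ onto $F^2_{(k)}$. For $f\in L^\infty(\mathbb{C})$ the Toeplitz operator on $F^2_{(k)}$ is $T_{f,(k)}g=P_{(k)}(fg)$. $\sigma(z,w)=2\operatorname{Im}(z\overline w)$. The Weyl operators $W_z f(w)=e^{w\overline z-|z|^2/2}f(w-z)$ are unitary and leave each $F^2_{(k)}$ invariant. $L^0_m(x)=\sum_{j=0}^m(-1)^j\binom{m}{m-j}\frac{x^j}{j!}$ are the Laguerre polynomials. The normalized reproducing kernels of $F^2_{(k)}$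 are $k_{z,(k)}(w)=L^0_{k-1}(|w-z|^2)e^{w\overline z-|z|^2/2}$, and the Berezin transform of $A\in\mathcal{L}(F^2_{(k)})$ (bounded operators) is $\widetilde A(z)=\langle Ak_{z,(k)},k_{z,(k)}\rangle$. $\mathcal{C}_1(F^2_{(k)})$ is the set of $A\in\mathcal{L}(F^2_{(k)})$ with $\|W_zAW_{-z}-A\|_{op}\to0$ as $|z|\to0$. *)

theory Defs
  imports "HOL-Analysis.Analysis"
begin

text \<open>
  Elements of \<open>L\<^sup>2(\<complex>,\<mu>)\<close> and \<open>L\<^sup>\<infinity>(\<complex>)\<close> are represented by functions, identified when they agree
  almost everywhere. Elements of the (true) polyanalytic Fock spaces are represented by their smooth
  representative, which is unique, so equality in these spaces is equality of functions.
\<close>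

definition fock_measure :: "complex measure" where
  "fock_measure = density lborel (\<lambda>z. ennreal (exp (- (cmod z)\<^sup>2) / pi))"

definition L2 :: "(complex \<Rightarrow> complex) set" where
  "L2 = {f \<in> borel_measurable fock_measure. integrable fock_measure (\<lambda>z. (cmod (f z))\<^sup>2)}"

definition ip :: "(complex \<Rightarrow> complex) \<Rightarrow> (complex \<Rightarrow> complex) \<Rightarrow> complex" where
  "ip f g = (LINT z|fock_measure. f z * cnj (g z))"

definition L2norm :: "(complex \<Rightarrow> complex) \<Rightarrow> real" where
  "L2norm f = sqrt (LINT z|fock_measure. (cmod (f z))\<^sup>2)"

definition Linfty :: "(complex \<Rightarrow> complex) set" where
  "Linfty = {f \<in> borel_measurable lborel. \<exists>C. AE z in lborel. cmod (f z) \<le> C}"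

text \<open>
  \<open>C_n n f\<close>: the function \<open>f\<close> is \<open>n\<close> times continuously differentiable in the real sense, on \<open>\<complex> \<cong> \<real>\<^sup>2\<close>.
\<close>

primrec C_n :: "nat \<Rightarrow> (complex \<Rightarrow> complex) \<Rightarrow> bool" where
  "C_n 0 f \<longleftrightarrow> continuous_on UNIV f"
| "C_n (Suc n) f \<longleftrightarrow> (\<forall>z. f differentiable (at z)) \<and>
     (\<forall>v. C_n n (\<lambda>z. frechet_derivative f (at z) v))"

definition smooth :: "(complex \<Rightarrow> complex) \<Rightarrow> bool" where
  "smooth f \<longleftrightarrow> (\<forall>n. C_n n f)"

text \<open>The Wirtinger derivative \<open>\<partial>/\<partial>z\<^sup>* = (\<partial>/\<partial>x + \<i> \<partial>/\<partial>y) / 2\<close>, where \<open>z\<^sup>*\<close> is the conjugate of \<open>z\<close>.\<close>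

definition dbar :: "(complex \<Rightarrow> complex) \<Rightarrow> complex \<Rightarrow> complex" where
  "dbar f z = (frechet_derivative f (at z) 1 + \<i> * frechet_derivative f (at z) \<i>) / 2"

definition poly_fock :: "nat \<Rightarrow> (complex \<Rightarrow> complex) set" where
  "poly_fock n = {f \<in> L2. smooth f \<and> (\<forall>z. (dbar ^^ n) f z = 0)}"

definition true_fock :: "nat \<Rightarrow> (complex \<Rightarrow> complex) set" where
  "true_fock k = (if k = 1 then poly_fock 1
     else {f \<in> poly_fock k. \<forall>g \<in> poly_fock (k - 1). ip f g = 0})"

definition orth_proj ::
    "(complex \<Rightarrow> complex) set \<Rightarrow> (complex \<Rightarrow> complex) \<Rightarrow> complex \<Rightarrow> complex" where
  "orth_proj S h = (THE p. p \<in> S \<and> (\<forall>g \<in> S. ip (\<lambda>z. h z - p z) g = 0))"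

definition toeplitz ::
    "(complex \<Rightarrow> complex) \<Rightarrow> nat \<Rightarrow> (complex \<Rightarrow> complex) \<Rightarrow> complex \<Rightarrow> complex" where
  "toeplitz f k g = orth_proj (true_fock k) (\<lambda>z. f z * g z)"

definition symp_form :: "complex \<Rightarrow> complex \<Rightarrow> real" where
  "symp_form z w = 2 * Im (z * cnj w)"

definition weyl :: "complex \<Rightarrow> (complex \<Rightarrow> complex) \<Rightarrow> complex \<Rightarrow> complex" where
  "weyl z f w = exp (w * cnj z - of_real ((cmod z)\<^sup>2 / 2)) * f (w - z)"

text \<open>The Laguerre polynomials \<open>L\<^sup>0\<^sub>m\<close>.\<close>

definition laguerre :: "nat \<Rightarrow> real \<Rightarrow> real" where
  "laguerre m x = (\<Sum>j = 0..m. (-1) ^ j * real (m choose (m - j)) * (x ^ j / fact j))"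

definition nkernel :: "nat \<Rightarrow> complex \<Rightarrow> complex \<Rightarrow> complex" where
  "nkernel k z w = of_real (laguerre (k - 1) ((cmod (w - z))\<^sup>2)) *
     exp (w * cnj z - of_real ((cmod z)\<^sup>2 / 2))"

text \<open>
  Operators on \<open>F\<^sup>2\<^sub>(\<^sub>k\<^sub>)\<close> are maps on functions of which only the values on \<open>true_fock k\<close> matter.
\<close>

definition bounded_ops :: "nat \<Rightarrow> ((complex \<Rightarrow> complex) \<Rightarrow> complex \<Rightarrow> complex) set" where
  "bounded_ops k = {A.
     (\<forall>f \<in> true_fock k. A f \<in> true_fock k) \<and>
     (\<forall>f \<in> true_fock k. \<forall>g \<in> true_fock k. A (\<lambda>z. f z + g z) = (\<lambda>z. A f z + A g z)) \<and>
     (\<forall>c. \<forall>f \<in> true_fock k. A (\<lambda>z. c * f z) = (\<lambda>z. c * A f z)) \<and>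
     (\<exists>C. \<forall>f \<in> true_fock k. L2norm (A f) \<le> C * L2norm f)}"

definition op_norm :: "nat \<Rightarrow> ((complex \<Rightarrow> complex) \<Rightarrow> complex \<Rightarrow> complex) \<Rightarrow> real" where
  "op_norm k A = (SUP f \<in> {f \<in> true_fock k. L2norm f \<le> 1}. L2norm (A f))"

definition C1_ops :: "nat \<Rightarrow> ((complex \<Rightarrow> complex) \<Rightarrow> complex \<Rightarrow> complex) set" where
  "C1_ops k = {A \<in> bounded_ops k.
     ((\<lambda>z. op_norm k (\<lambda>f w. weyl z (A (weyl (- z) f)) w - A f w)) \<longlongrightarrow> 0) (at 0)}"

definition berezin :: "nat \<Rightarrow> ((complex \<Rightarrow> complex) \<Rightarrow> complex \<Rightarrow> complex) \<Rightarrow> complex \<Rightarrow> complex" where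
  "berezin k A z = ip (A (nkernel k z)) (nkernel k z)"

end

theory Submission
  imports Defs "HOL-Probability.Distributions"
begin

text \<open>
  Let \<open>a = \<partial>/\<partial>z\<^sup>*\<close>, with formal adjoint \<open>a\<^sup>\<dagger> = z\<^sup>* - \<partial>/\<partial>z\<close> in \<open>L\<^sup>2(\<mu>)\<close> and \<open>[a, a\<^sup>\<dagger>] = 1\<close>. On
  polyanalytic functions both are square integrable again, \<open>a\<close> lowers and \<open>a\<^sup>\<dagger>\<close> raises the level of
  the true polyanalytic spaces, and \<open>a\<^sup>\<dagger> a = k - 1\<close> on the space of level \<open>k\<close>. Multiplication by
  \<open>exp (\<i> \<sigma>(z, \<xi>))\<close> factors as \<open>W\<^sub>\<xi> D\<close> with \<open>D = exp (\<xi>\<^sup>* a - \<xi> a\<^sup>\<dagger>)\<close>. The Weyl operator \<open>W\<^sub>\<xi>\<close> preserves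
  every level, whereas the diagonal matrix elements of \<open>D\<close> on level \<open>k\<close> are
  \<open>exp (-|\<xi>|\<^sup>2/2) L\<^sub>k\<^sub>-\<^sub>1(|\<xi>|\<^sup>2)\<close>, so that \<open>T\<^sub>f\<close> is \<open>L\<^sub>k\<^sub>-\<^sub>1(|\<xi>|\<^sup>2) W\<^sub>\<xi>\<close>. For a root of the Laguerre
  polynomial the Toeplitz operator vanishes and, as complex conjugation exchanges the roles of \<open>W\<^sub>\<xi>\<close>
  and \<open>D\<close>, so does the Berezin transform of \<open>W\<^sub>\<xi>\<close>.
\<close>

section \<open>Smooth functions and Wirtinger derivatives\<close>

text \<open>Membership in \<open>poly_fock n\<close> asks only that \<open>f\<close> itself be
  square integrable, so the mapping properties of \<open>dbar\<close> and \<open>adag\<close> are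
  the analytic core: an energy estimate with cutoffs bounds the derivatives uniformly in the radius.
  The exponential \<open>D\<close> is not expanded as an operator series, its exponent being
  unbounded; it is defined as an explicit weighted translation. Its antiholomorphic weight leads out
  of the polyanalytic functions, so \<open>D\<close> is not treated as an operator on a level, and
  only its inner products with polyanalytic functions are computed. They satisfy a differential
  equation along \<open>t * \<xi>\<close> that closes after finitely many steps, because powers of
  \<open>dbar\<close> annihilate both arguments. Only equal powers survive the orthogonality of the
  levels, and their norms, quotients of factorials, turn the sum into a Laguerre polynomial. The
  projection in the Toeplitz operator is then identified by testing the resulting multiple of a Weyl
  operator against the level.\<close>

lemma has_derivative_frechet:
  "f differentiable (at z) \<Longrightarrow> (f has_derivative frechet_derivative f (at z)) (at z)"
  by (simp add: frechet_derivative_works)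

lemma frechet_derivative_eqI:
  "(f has_derivative f') (at z) \<Longrightarrow> frechet_derivative f (at z) = f'"
  by (metis frechet_derivative_at)

lemma has_derivative_shift:
  fixes c :: "'a::real_normed_vector"
  assumes "(f has_derivative f') (at (z + c))"
  shows "((\<lambda>z. f (z + c)) has_derivative f') (at z)"
proof -
  have "((\<lambda>z. z + c) has_derivative (\<lambda>v. v)) (at z)"
    by (auto intro!: derivative_eq_intros)
  from has_derivative_compose[OF this assms] show ?thesis .
qed

section \<open>Closure properties of the classes of differentiable functions\<close>

lemma C_n_differentiable: "C_n (Suc n) f \<Longrightarrow> f differentiable (at z)"
  by simp

lemma C_n_SucD: "C_n (Suc n) f \<Longrightarrow> C_n n f"
proof (induction n arbitrary: f)
  case 0
  then show ?case
    by (auto intro!: differentiable_imp_continuous_within continuous_at_imp_continuous_on)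
next
  case (Suc n)
  have "f differentiable (at z)" for z
    using Suc.prems C_n_differentiable by blast
  moreover have "C_n n (\<lambda>z. frechet_derivative f (at z) v)" for v
  proof (rule Suc.IH)
    show "C_n (Suc n) (\<lambda>z. frechet_derivative f (at z) v)"
      using Suc.prems by (metis C_n.simps(2))
  qed
  ultimately show ?case by simp
qed

lemma C_n_const: "C_n n (\<lambda>_. c)"
proof (induction n arbitrary: c)
  case (Suc n)
  then show ?case by simp
qed simp

lemma C_n_add:
  assumes "C_n n f" "C_n n g"
  shows "C_n n (\<lambda>z. f z + g z)"
  using assms
proof (induction n arbitrary: f g)
  case 0
  then show ?case by (auto intro: continuous_intros)
next
  case (Suc n)
  have d: "f differentiable (at z)" "g differentiable (at z)" for z
    using Suc.prems by auto
  have "frechet_derivative (\<lambda>z. f z + g z) (at z) =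
      (\<lambda>v. frechet_derivative f (at z) v + frechet_derivative g (at z) v)" for z
    by (intro frechet_derivative_eqI has_derivative_add has_derivative_frechet d)
  then show ?case
    using Suc.prems Suc.IH d by (auto intro!: differentiable_add)
qed

lemma C_n_mult:
  assumes "C_n n f" "C_n n g"
  shows "C_n n (\<lambda>z. f z * g z)"
  using assms
proof (induction n arbitrary: f g)
  case 0
  then show ?case by (auto intro: continuous_intros)
next
  case (Suc n)
  have d: "f differentiable (at z)" "g differentiable (at z)" for z
    using Suc.prems by auto
  have "frechet_derivative (\<lambda>z. f z * g z) (at z) =
      (\<lambda>v. f z * frechet_derivative g (at z) v + frechet_derivative f (at z) v * g z)" for z
    by (intro frechet_derivative_eqI has_derivative_mult has_derivative_frechet d)
  \<comment> \<open>The undifferentiated factors carry one order of smoothness too many for the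
    induction hypothesis; \<open>C_n_SucD\<close> lowers them.\<close>
  moreover have "C_n n (\<lambda>z. f z * frechet_derivative g (at z) v + frechet_derivative f (at z) v * g z)"
    for v
    using Suc.prems C_n_SucD[OF Suc.prems(1)] C_n_SucD[OF Suc.prems(2)]
    by (intro C_n_add Suc.IH) auto
  ultimately show ?case
    using d by (auto intro!: differentiable_mult)
qed

lemma C_n_cnj:
  assumes "C_n n f"
  shows "C_n n (\<lambda>z. cnj (f z))"
  using assms
proof (induction n arbitrary: f)
  case 0
  then show ?case by (auto intro: continuous_intros)
next
  case (Suc n)
  have d: "((\<lambda>z. cnj (f z)) has_derivative (\<lambda>v. cnj (frechet_derivative f (at z) v))) (at z)" for z
    using Suc.prems by (intro derivative_intros has_derivative_frechet) auto
  then have "frechet_derivative (\<lambda>z. cnj (f z)) (at z) = (\<lambda>v. cnj (frechet_derivative f (at z) v))" for z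
    by (rule frechet_derivative_eqI)
  then show ?case
    using Suc.prems Suc.IH d by (auto simp: differentiable_def)
qed

lemma C_n_shift:
  assumes "C_n n f"
  shows "C_n n (\<lambda>z. f (z + c))"
  using assms
proof (induction n arbitrary: f)
  case 0
  then have "continuous_on UNIV (f \<circ> (\<lambda>z. z + c))"
    by (intro continuous_intros continuous_on_compose) (auto intro: continuous_on_subset)
  then show ?case by (simp add: o_def)
next
  case (Suc n)
  have d: "((\<lambda>z. f (z + c)) has_derivative frechet_derivative f (at (z + c))) (at z)" for z
  proof -
    have "(f has_derivative frechet_derivative f (at (z + c))) (at (z + c))"
      using Suc.prems by (intro has_derivative_frechet) auto
    then show ?thesis by (rule has_derivative_shift)
  qed
  have "frechet_derivative (\<lambda>z. f (z + c)) (at z) = frechet_derivative f (at (z + c))" for z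
    by (rule frechet_derivative_eqI) (rule d)
  then show ?case
    using Suc.prems Suc.IH[of "\<lambda>z. frechet_derivative f (at z) _"] d by (auto simp: differentiable_def)
qed

lemma smooth_const: "smooth (\<lambda>_. c)"
  by (simp add: smooth_def C_n_const)

lemma smooth_add: "smooth f \<Longrightarrow> smooth g \<Longrightarrow> smooth (\<lambda>z. f z + g z)"
  by (simp add: smooth_def C_n_add)

lemma smooth_mult: "smooth f \<Longrightarrow> smooth g \<Longrightarrow> smooth (\<lambda>z. f z * g z)"
  by (simp add: smooth_def C_n_mult)

lemma smooth_cmult: "smooth f \<Longrightarrow> smooth (\<lambda>z. c * f z)"
  by (simp add: smooth_mult smooth_const)

lemma smooth_diff: "smooth f \<Longrightarrow> smooth g \<Longrightarrow> smooth (\<lambda>z. f z - g z)"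
  using smooth_add[of f "\<lambda>z. (-1) * g z"] smooth_cmult[of g "-1"] by simp

lemma smooth_cnj: "smooth f \<Longrightarrow> smooth (\<lambda>z. cnj (f z))"
  by (simp add: smooth_def C_n_cnj)

lemma smooth_shift: "smooth f \<Longrightarrow> smooth (\<lambda>z. f (z + c))"
  by (simp add: smooth_def C_n_shift)

lemma smooth_ident: "smooth (\<lambda>z. z)"
  unfolding smooth_def
proof
  fix n show "C_n n (\<lambda>z. z)"
    by (cases n) (auto simp: C_n_const)
qed

lemma smooth_exp: "smooth (\<lambda>z. exp (c * z))"
  unfolding smooth_def
proof
  fix n show "C_n n (\<lambda>z. exp (c * z))"
  proof (induction n)
    case 0
    show ?case by (auto intro: continuous_intros)
  next
    case (Suc n)
    have d: "((\<lambda>z. exp (c * z)) has_derivative (\<lambda>v. (c * v) * exp (c * z))) (at z)" for z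
      by (auto intro!: derivative_eq_intros)
    show ?case
      using d C_n_mult[OF C_n_const Suc.IH] by (auto simp: differentiable_def frechet_derivative_eqI[OF d])
  qed
qed

lemma smooth_power: "smooth f \<Longrightarrow> smooth (\<lambda>z. f z ^ n)"
  by (induction n) (auto intro: smooth_const smooth_mult)

lemma smooth_sum: "(\<And>i. i \<in> I \<Longrightarrow> smooth (f i)) \<Longrightarrow> smooth (\<lambda>z. \<Sum>i\<in>I. f i z)"
  by (induction I rule: infinite_finite_induct) (auto intro: smooth_const smooth_add)

lemma smooth_differentiable: "smooth f \<Longrightarrow> f differentiable (at z)"
  unfolding smooth_def by (metis C_n_differentiable)

lemma smooth_has_derivative:
  "smooth f \<Longrightarrow> (f has_derivative frechet_derivative f (at z)) (at z)"
  by (simp add: has_derivative_frechet smooth_differentiable)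

lemma smooth_continuous_on: "smooth f \<Longrightarrow> continuous_on S f"
  unfolding smooth_def by (metis C_n.simps(1) continuous_on_subset subset_UNIV)

lemma smooth_frechet: "smooth f \<Longrightarrow> smooth (\<lambda>z. frechet_derivative f (at z) v)"
  unfolding smooth_def by (metis C_n.simps(2))

section \<open>Wirtinger calculus\<close>

definition dz :: "(complex \<Rightarrow> complex) \<Rightarrow> complex \<Rightarrow> complex" where
  "dz f z = (frechet_derivative f (at z) 1 - \<i> * frechet_derivative f (at z) \<i>) / 2"

lemma smooth_dbar: "smooth f \<Longrightarrow> smooth (dbar f)"
proof -
  assume f: "smooth f"
  have "smooth (\<lambda>z. (1/2) * (frechet_derivative f (at z) 1 + \<i> * frechet_derivative f (at z) \<i>))"
    by (intro smooth_cmult smooth_add smooth_frechet f)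
  then show ?thesis by (simp add: dbar_def[abs_def])
qed

lemma smooth_dz: "smooth f \<Longrightarrow> smooth (dz f)"
proof -
  assume f: "smooth f"
  have "smooth (\<lambda>z. (1/2) * (frechet_derivative f (at z) 1 - \<i> * frechet_derivative f (at z) \<i>))"
    by (intro smooth_cmult smooth_diff smooth_frechet f)
  then show ?thesis by (simp add: dz_def[abs_def])
qed

text \<open>A real-linear map of the plane is determined by its values at 1 and \<open>\<i>\<close>
  and has the form \<open>v * p + cnj v * q\<close>. The rules for products, sums, conjugates and
  translations are all read off from this form of the derivative.\<close>

lemma frechet_derivative_wirtinger:
  assumes "f differentiable (at z)"
  shows "frechet_derivative f (at z) v = v * dz f z + cnj v * dbar f z"
proof -
  interpret bounded_linear "frechet_derivative f (at z)"
    using has_derivative_bounded_linear has_derivative_frechet[OF assms] by blast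
  have "frechet_derivative f (at z) (Re v *\<^sub>R 1 + Im v *\<^sub>R \<i>) =
      Re v *\<^sub>R frechet_derivative f (at z) 1 + Im v *\<^sub>R frechet_derivative f (at z) \<i>"
    by (simp add: add scaleR)
  moreover have "Re v *\<^sub>R 1 + Im v *\<^sub>R \<i> = v"
    by (simp add: complex_eq_iff)
  moreover have "Re v *\<^sub>R A + Im v *\<^sub>R B = v * ((A - \<i> * B) / 2) + cnj v * ((A + \<i> * B) / 2)" for A B
    by (simp add: complex_eq_iff field_simps)
  ultimately show ?thesis by (simp add: dz_def dbar_def)
qed

lemma wirtinger_eqI:
  assumes "(f has_derivative (\<lambda>v. v * p + cnj v * q)) (at z)"
  shows "dz f z = p" "dbar f z = q"
  unfolding dz_def dbar_def frechet_derivative_eqI[OF assms] by (auto simp: field_simps)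

lemma has_derivative_wirtinger:
  assumes "f differentiable (at z)"
  shows "(f has_derivative (\<lambda>v. v * dz f z + cnj v * dbar f z)) (at z)"
proof -
  have "frechet_derivative f (at z) = (\<lambda>v. v * dz f z + cnj v * dbar f z)"
    by (rule ext) (rule frechet_derivative_wirtinger[OF assms])
  with has_derivative_frechet[OF assms] show ?thesis by simp
qed

lemma wirtinger_mult:
  assumes "f differentiable (at z)" "g differentiable (at z)"
  shows "dz (\<lambda>z. f z * g z) z = f z * dz g z + dz f z * g z"
        "dbar (\<lambda>z. f z * g z) z = f z * dbar g z + dbar f z * g z"
proof -
  have "((\<lambda>z. f z * g z) has_derivative (\<lambda>v. v * (f z * dz g z + dz f z * g z)
      + cnj v * (f z * dbar g z + dbar f z * g z))) (at z)"
    by (rule has_derivative_eq_rhs[OF has_derivative_mult[OF has_derivative_wirtinger[OF assms(1)]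
          has_derivative_wirtinger[OF assms(2)]]]) (simp add: algebra_simps)
  from wirtinger_eqI[OF this] show
    "dz (\<lambda>z. f z * g z) z = f z * dz g z + dz f z * g z"
    "dbar (\<lambda>z. f z * g z) z = f z * dbar g z + dbar f z * g z" .
qed

lemma wirtinger_add:
  assumes "f differentiable (at z)" "g differentiable (at z)"
  shows "dz (\<lambda>z. f z + g z) z = dz f z + dz g z"
        "dbar (\<lambda>z. f z + g z) z = dbar f z + dbar g z"
proof -
  have "((\<lambda>z. f z + g z) has_derivative (\<lambda>v. v * (dz f z + dz g z) + cnj v * (dbar f z + dbar g z))) (at z)"
    by (rule has_derivative_eq_rhs[OF has_derivative_add[OF has_derivative_wirtinger[OF assms(1)]
          has_derivative_wirtinger[OF assms(2)]]]) (simp add: algebra_simps)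
  from wirtinger_eqI[OF this] show "dz (\<lambda>z. f z + g z) z = dz f z + dz g z"
    "dbar (\<lambda>z. f z + g z) z = dbar f z + dbar g z" .
qed

lemma wirtinger_const: "dz (\<lambda>_. c) z = 0" "dbar (\<lambda>_. c) z = 0"
  by (simp_all add: dz_def dbar_def)

lemma wirtinger_cmult:
  assumes "f differentiable (at z)"
  shows "dz (\<lambda>z. c * f z) z = c * dz f z" "dbar (\<lambda>z. c * f z) z = c * dbar f z"
  using wirtinger_mult[OF differentiable_const assms, of c] by (simp_all add: wirtinger_const)

lemma wirtinger_diff:
  assumes "f differentiable (at z)" "g differentiable (at z)"
  shows "dz (\<lambda>z. f z - g z) z = dz f z - dz g z"
        "dbar (\<lambda>z. f z - g z) z = dbar f z - dbar g z"
  using wirtinger_add[OF assms(1) differentiable_mult[OF differentiable_const assms(2)], of "-1"]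
    wirtinger_cmult[OF assms(2), of "-1"] by simp_all

lemma wirtinger_cnj:
  assumes "f differentiable (at z)"
  shows "dz (\<lambda>z. cnj (f z)) z = cnj (dbar f z)" "dbar (\<lambda>z. cnj (f z)) z = cnj (dz f z)"
proof -
  have "((\<lambda>z. cnj (f z)) has_derivative (\<lambda>v. v * cnj (dbar f z) + cnj v * cnj (dz f z))) (at z)"
    by (rule has_derivative_eq_rhs[OF has_derivative_cnj[OF has_derivative_wirtinger[OF assms]]])
      (simp add: algebra_simps)
  from wirtinger_eqI[OF this] show "dz (\<lambda>z. cnj (f z)) z = cnj (dbar f z)"
    "dbar (\<lambda>z. cnj (f z)) z = cnj (dz f z)" .
qed

lemma wirtinger_shift:
  assumes "f differentiable (at (z + c))"
  shows "dz (\<lambda>z. f (z + c)) z = dz f (z + c)" "dbar (\<lambda>z. f (z + c)) z = dbar f (z + c)"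
proof -
  have "((\<lambda>z. f (z + c)) has_derivative (\<lambda>v. v * dz f (z + c) + cnj v * dbar f (z + c))) (at z)"
    by (rule has_derivative_shift) (rule has_derivative_wirtinger[OF assms])
  from wirtinger_eqI[OF this] show "dz (\<lambda>z. f (z + c)) z = dz f (z + c)"
    "dbar (\<lambda>z. f (z + c)) z = dbar f (z + c)" .
qed

lemma wirtinger_holo:
  assumes "(f has_field_derivative f') (at z)"
  shows "dz f z = f'" "dbar f z = 0"
proof -
  have "(f has_derivative (\<lambda>v. v * f' + cnj v * 0)) (at z)"
    using assms by (simp add: has_field_derivative_def mult.commute[of f'] mult_commute_abs)
  from wirtinger_eqI[OF this] show "dz f z = f'" "dbar f z = 0" .
qed

text \<open>
  The two orders of differentiation are compared after integrating along the segment in direction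
  \<open>u\<close>, where the parameter \<open>v\<close> can be differentiated under the integral sign.
\<close>

lemma frechet_derivative_commute:
  assumes "smooth f"
  shows "frechet_derivative (\<lambda>z. frechet_derivative f (at z) v) (at z) u =
         frechet_derivative (\<lambda>z. frechet_derivative f (at z) u) (at z) v"
proof -
  define D where "D v z = frechet_derivative f (at z) v" for v z
  have smD: "smooth (D v)" for v unfolding D_def by (rule smooth_frechet[OF assms])
  have line: "((\<lambda>t. h (p + of_real t * u)) has_vector_derivative frechet_derivative h (at (p + of_real t * u)) u) (at t within S)"
    if "smooth h" for h p u and t :: real and S
  proof -
    have "((\<lambda>t. p + of_real t * u) has_derivative (\<lambda>s. of_real s * u)) (at t within S)"
      by (auto intro!: derivative_eq_intros)
    from has_derivative_compose[OF this smooth_has_derivative[OF that]]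
    have "((\<lambda>t. h (p + of_real t * u)) has_derivative
      (\<lambda>s. frechet_derivative h (at (p + of_real t * u)) (of_real s * u))) (at t within S)" .
    moreover have "frechet_derivative h (at q) (of_real s * u) = s *\<^sub>R frechet_derivative h (at q) u" for q s
      using linear_scale[OF has_derivative_linear[OF smooth_has_derivative[OF that]], of q s u]
      by (simp add: scaleR_conv_of_real)
    ultimately show ?thesis by (simp add: has_vector_derivative_def)
  qed
  have cont: "continuous_on S (\<lambda>x. h (l x))" if "smooth h" "continuous_on S l" for h l and S :: "'x::topological_space set"
    using continuous_on_compose2[OF smooth_continuous_on[OF that(1), of UNIV] that(2)] by simp
  have ftc: "f (q + of_real s * u) - f q = integral {0..s} (\<lambda>x. D u (q + of_real x * u))" if "s \<ge> 0" for q s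
  proof -
    have "((\<lambda>x. D u (q + of_real x * u)) has_integral (f (q + of_real s * u) - f (q + of_real 0 * u))) {0..s}"
      unfolding D_def by (intro fundamental_theorem_of_calculus that line assms)
    then show ?thesis by (simp add: integral_unique)
  qed
  define E where "E = (\<lambda>z. frechet_derivative (D u) (at z) v)"
  have smE: "smooth E" unfolding E_def by (rule smooth_frechet[OF smD])
  \<comment> \<open>Both sides are the derivative at \<open>t = 0\<close> of the same function, the
    increment of \<open>f\<close> along \<open>s * u\<close> based at \<open>z + t * v\<close>: once
    through its integral form, once term by term.\<close>
  have key: "D v (z + of_real s * u) - D v z = integral {0..s} (\<lambda>x. E (z + of_real x * u))" if s: "s \<ge> 0" for s
  proof -
    have "((\<lambda>t. integral (cbox 0 s) (\<lambda>x. D u ((z + of_real x * u) + of_real t * v))) has_vector_derivative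
          integral (cbox 0 s) (\<lambda>x. E (z + of_real x * u + of_real 0 * v))) (at 0 within {-1..1})"
    proof (rule leibniz_rule_vector_derivative)
      show "((\<lambda>x. D u (z + complex_of_real t * u + complex_of_real x * v)) has_vector_derivative
            E (z + of_real t * u + of_real x * v)) (at x within {-1..1})" for x t
        unfolding E_def by (rule line[OF smD])
      show "continuous_on ({- 1..1} \<times> cbox 0 s)
         (\<lambda>(x, t). E (z + complex_of_real t * u + complex_of_real x * v))"
        unfolding case_prod_unfold by (intro cont[OF smE] continuous_intros)
      show "(\<lambda>t. D u (z + complex_of_real t * u + complex_of_real x * v)) integrable_on cbox 0 s" for x
        by (intro integrable_continuous cont[OF smD] continuous_intros)
    qed auto
    moreover have "integral (cbox 0 s) (\<lambda>x. D u ((z + of_real x * u) + of_real t * v))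
        = f ((z + of_real s * u) + of_real t * v) - f (z + of_real t * v)" for t :: real
      using ftc[OF s, of "z + of_real t * v"] by (simp add: algebra_simps)
    ultimately have A: "((\<lambda>t. f ((z + of_real s * u) + of_real t * v) - f (z + of_real t * v)) has_vector_derivative
        integral {0..s} (\<lambda>x. E (z + of_real x * u))) (at 0 within {-1..1})"
      by simp
    have B: "((\<lambda>t. f ((z + of_real s * u) + of_real t * v) - f (z + of_real t * v)) has_vector_derivative
        (D v (z + of_real s * u + of_real 0 * v) - D v (z + of_real 0 * v))) (at (0::real) within {-1..1})"
      unfolding D_def by (intro has_vector_derivative_diff line assms)
    have "at (0::real) within {-1..1} \<noteq> bot"
      by (simp add: trivial_limit_within islimpt_Icc)
    from vector_derivative_unique_within[OF this A B] show ?thesis by simp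
  qed
  \<comment> \<open>Differentiating \<open>key\<close> at \<open>s = 0\<close> gives the claim; the
    derivative is one-sided because \<open>key\<close> is stated for nonnegative
    \<open>s\<close>.\<close>
  have "((\<lambda>s. integral {0..s} (\<lambda>x. E (z + of_real x * u))) has_vector_derivative E (z + of_real 0 * u)) (at 0 within {0..1})"
    by (rule integral_has_vector_derivative) (auto intro!: cont[OF smE] continuous_intros)
  then have A: "((\<lambda>s. D v (z + of_real s * u) - D v z) has_vector_derivative E z) (at 0 within {0..1})"
    using has_vector_derivative_transform[of 0 "{0..1}" "\<lambda>s. D v (z + of_real s * u) - D v z"
        "\<lambda>s. integral {0..s} (\<lambda>x. E (z + of_real x * u))" "E z"] by (simp add: key)
  have B: "((\<lambda>s. D v (z + of_real s * u) - D v z) has_vector_derivative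
       (frechet_derivative (D v) (at (z + of_real 0 * u)) u - 0)) (at (0::real) within {0..1})"
    by (intro has_vector_derivative_diff line smD has_vector_derivative_const)
  have "at (0::real) within {0..1} \<noteq> bot"
    by (simp add: trivial_limit_within islimpt_Icc)
  from vector_derivative_unique_within[OF this A B] show ?thesis
    by (simp add: E_def D_def[abs_def])
qed

text \<open>Both sides are a quarter of the Laplacian; the mixed terms cancel by the symmetry of
  second derivatives.\<close>

lemma dz_dbar_commute:
  assumes "smooth f"
  shows "dz (dbar f) z = dbar (dz f) z"
proof -
  let ?D = "\<lambda>v z. frechet_derivative f (at z) v"
  have d: "(\<lambda>z. c * ?D v z) differentiable (at z)" for c v z
    by (intro smooth_differentiable smooth_cmult smooth_frechet assms)
  have *: "frechet_derivative (\<lambda>z. 1/2 * ?D 1 z + c * ?D \<i> z) (at z) w =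
      1/2 * frechet_derivative (?D 1) (at z) w + c * frechet_derivative (?D \<i>) (at z) w" for c w
    by (subst frechet_derivative_eqI[OF has_derivative_add[OF
          has_derivative_mult_right[OF smooth_has_derivative[OF smooth_frechet[OF assms]]]
          has_derivative_mult_right[OF smooth_has_derivative[OF smooth_frechet[OF assms]]]]]) simp
  have "dbar f = (\<lambda>z. 1/2 * ?D 1 z + \<i>/2 * ?D \<i> z)" "dz f = (\<lambda>z. 1/2 * ?D 1 z + (-\<i>/2) * ?D \<i> z)"
    by (auto simp: dbar_def dz_def field_simps)
  moreover have "frechet_derivative (?D \<i>) (at z) 1 = frechet_derivative (?D 1) (at z) \<i>"
    by (rule frechet_derivative_commute[OF assms])
  ultimately show ?thesis
    unfolding dbar_def[of "dz f"] dz_def[of "dbar f"] by (simp only: *) (simp add: field_simps)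
qed

section \<open>The Gaussian measure and integration by parts\<close>

definition gw :: "complex \<Rightarrow> real" where "gw z = exp (- (cmod z)\<^sup>2) / pi"

lemma gw_pos [simp]: "gw z > 0" and gw_nonneg [simp]: "gw z \<ge> 0"
  by (simp_all add: gw_def)

lemma continuous_gw: "continuous_on S gw"
  unfolding gw_def by (intro continuous_intros) auto

lemma measurable_gw [measurable]: "gw \<in> borel_measurable borel"
  by (intro borel_measurable_continuous_onI continuous_gw)

lemma fock_measure_eq: "fock_measure = density lborel (\<lambda>z. ennreal (gw z))"
  by (simp add: fock_measure_def gw_def)

lemma sets_fock_measure [simp, measurable_cong]: "sets fock_measure = sets borel"
  by (simp add: fock_measure_def)

lemma space_fock_measure [simp]: "space fock_measure = UNIV"
  by (simp add: fock_measure_def)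

lemma measurable_fock [simp]: "borel_measurable fock_measure = borel_measurable borel"
  by (rule measurable_cong_sets) simp_all

lemma integrable_fock_iff:
  fixes f :: "complex \<Rightarrow> 'b::{banach, second_countable_topology}"
  assumes "f \<in> borel_measurable borel"
  shows "integrable fock_measure f \<longleftrightarrow> integrable lborel (\<lambda>z. gw z *\<^sub>R f z)"
  unfolding fock_measure_eq using assms by (intro integrable_density) auto

lemma integral_fock_eq:
  fixes f :: "complex \<Rightarrow> 'b::{banach, second_countable_topology}"
  assumes "f \<in> borel_measurable borel"
  shows "integral\<^sup>L fock_measure f = (LINT z|lborel. gw z *\<^sub>R f z)"
  unfolding fock_measure_eq using assms by (intro integral_density) auto

lemma AE_fock_iff: "(AE z in fock_measure. P z) \<longleftrightarrow> (AE z in lborel. P z)"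
  unfolding fock_measure_eq by (subst AE_density) auto

lemma borel_measurable_continuous: "continuous_on UNIV f \<Longrightarrow> f \<in> borel_measurable borel"
  by (rule borel_measurable_continuous_onI)

lemma integrable_compact_support:
  fixes f :: "complex \<Rightarrow> 'b::{banach, second_countable_topology}"
  assumes "continuous_on UNIV f" "\<And>z. R < cmod z \<Longrightarrow> f z = 0"
  shows "integrable lborel f"
proof -
  have "integrable lborel (\<lambda>z. indicator (cball 0 R) z *\<^sub>R f z)"
    by (intro borel_integrable_compact continuous_on_subset[OF assms(1)]) auto
  moreover have "(\<lambda>z. indicator (cball 0 R) z *\<^sub>R f z) = f"
    using assms(2) by (auto simp: indicator_def fun_eq_iff)
  ultimately show ?thesis by simp
qed

lemma integrable_fock_compact_support:
  fixes f :: "complex \<Rightarrow> 'b::{banach, second_countable_topology}"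
  assumes "continuous_on UNIV f" "\<And>z. R < cmod z \<Longrightarrow> f z = 0"
  shows "integrable fock_measure f"
  using integrable_compact_support[of "\<lambda>z. gw z *\<^sub>R f z" R] assms
  by (subst integrable_fock_iff) (auto intro!: borel_measurable_continuous continuous_intros continuous_gw)

lemma
  fixes f :: "complex \<Rightarrow> 'b::{banach, second_countable_topology}"
  assumes [measurable]: "f \<in> borel_measurable borel"
  shows integrable_lborel_shift: "integrable lborel (\<lambda>z. f (z + c)) \<longleftrightarrow> integrable lborel f"
    and integral_lborel_shift: "(LINT z|lborel. f (z + c)) = (LINT z|lborel. f z)"
proof -
  have "(\<lambda>z. z + c) = (+) c" by (auto simp: add.commute)
  then have *: "lborel = distr lborel borel (\<lambda>z. z + c)"
    using lborel_distr_plus[of c] by simp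
  show "integrable lborel (\<lambda>z. f (z + c)) \<longleftrightarrow> integrable lborel f"
    by (subst (2) *) (simp add: integrable_distr_eq)
  show "(LINT z|lborel. f (z + c)) = (LINT z|lborel. f z)"
    by (subst (2) *) (simp add: integral_distr)
qed

text \<open>The exponent is halved so that this Gaussian dominates the density \<open>gw\<close>
  times any power of the modulus. Integrability reduces to the standard normal density in each real
  coordinate.\<close>

lemma integrable_exp_cmod: "integrable lborel (\<lambda>z::complex. exp (- (cmod z)\<^sup>2 / 2))"
proof -
  have r: "integrable lborel (\<lambda>x::real. exp (- x\<^sup>2 / 2))"
  proof -
    have "integrable lborel (\<lambda>x. sqrt (2 * pi) * (normal_density 0 1 x * (x - 0) ^ 0))"
      by (intro integrable_mult_right integrable_normal_moment) auto
    then show ?thesis by (simp add: normal_density_def)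
  qed
  have f: "(\<integral>\<^sup>+x. ennreal (exp (- x\<^sup>2 / 2)) \<partial>lborel) < \<infinity>"
    using r unfolding integrable_iff_bounded by auto
  have "(\<integral>\<^sup>+z. ennreal (exp (- (cmod z)\<^sup>2 / 2)) \<partial>lborel) =
      (\<integral>\<^sup>+z. (\<Prod>b\<in>(Basis::complex set). ennreal (exp (- (z \<bullet> b)\<^sup>2 / 2))) \<partial>lborel)"
  proof (intro nn_integral_cong)
    fix z :: complex
    have "exp (- (cmod z)\<^sup>2 / 2) = exp (- (Re z)\<^sup>2 / 2) * exp (- (Im z)\<^sup>2 / 2)"
      unfolding exp_add[symmetric] cmod_power2 by (simp add: field_simps)
    then show "ennreal (exp (- (cmod z)\<^sup>2 / 2)) = (\<Prod>b\<in>Basis. ennreal (exp (- (z \<bullet> b)\<^sup>2 / 2)))"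
      by (simp add: Basis_complex_def inner_complex_def ennreal_mult)
  qed
  also have "\<dots> = (\<Prod>b\<in>(Basis::complex set). \<integral>\<^sup>+x. ennreal (exp (- x\<^sup>2 / 2)) \<partial>lborel)"
    by (rule nn_integral_lborel_prod) auto
  also have "\<dots> < \<infinity>"
    using f by (auto simp: Basis_complex_def ennreal_mult_less_top)
  finally show ?thesis
    unfolding integrable_iff_bounded by (auto simp: ennreal_mult_less_top)
qed

lemma integrable_fock_cmod_power: "integrable fock_measure (\<lambda>z. cmod z ^ (2 * m))"
proof -
  have A: "integrable lborel (\<lambda>z::complex. (fact m * 2 ^ m / pi) * exp (- (cmod z)\<^sup>2 / 2))"
    by (intro integrable_mult_right integrable_exp_cmod)
  have B: "gw z * cmod z ^ (2 * m) \<le> (fact m * 2 ^ m / pi) * exp (- (cmod z)\<^sup>2 / 2)" for z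
  proof -
    \<comment> \<open>In this variable the density is \<open>exp (- 2 * t) / pi\<close>: one factor
      \<open>exp (- t)\<close> pays for \<open>t ^ m\<close>, the other stays integrable.\<close>
    define t where "t = (cmod z)\<^sup>2 / 2"
    have t: "t \<ge> 0" by (simp add: t_def)
    have "t ^ m / fact m \<le> exp t"
      using sum_le_suminf[OF summable_exp[of t], of "{m}"] t
      by (simp add: exp_def divide_inverse mult.commute)
    then have "(t ^ m / fact m) * exp (- 2 * t) \<le> exp t * exp (- 2 * t)"
      by (intro mult_right_mono) auto
    also have "\<dots> = exp (- t)" by (simp flip: exp_add)
    finally have "t ^ m * exp (- 2 * t) \<le> fact m * exp (- t)"
      by (simp add: field_simps)
    moreover have "cmod z ^ (2 * m) = 2 ^ m * t ^ m"
      by (simp add: t_def power_mult power_divide)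
    ultimately show ?thesis
      by (simp add: gw_def t_def field_simps)
  qed
  have "integrable lborel (\<lambda>z. gw z * cmod z ^ (2 * m))"
  proof (rule Bochner_Integration.integrable_bound[OF A])
    show "AE z in lborel. norm (gw z * cmod z ^ (2 * m)) \<le> norm ((fact m * 2 ^ m / pi) * exp (- (cmod z)\<^sup>2 / 2))"
    proof (intro AE_I2)
      fix z show "norm (gw z * cmod z ^ (2 * m)) \<le> norm ((fact m * 2 ^ m / pi) * exp (- (cmod z)\<^sup>2 / 2))"
        using B[of z] by simp
    qed
  qed measurable
  then show ?thesis
    by (subst integrable_fock_iff) auto
qed

text \<open>Difference quotients have integral zero by translation invariance, and dominated
  convergence passes to the derivative. Only \<open>C_n 1\<close> is required, since the cutoffs
  used later are no smoother.\<close>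

lemma integral_frechet_derivative_zero:
  fixes F :: "complex \<Rightarrow> complex"
  assumes F: "C_n 1 F" and supp: "\<And>z. R < cmod z \<Longrightarrow> F z = 0"
  shows "(LINT z|lborel. frechet_derivative F (at z) v) = 0"
proof -
  let ?D = "\<lambda>z. frechet_derivative F (at z) v"
  have dF: "(F has_derivative frechet_derivative F (at z)) (at z)" for z
    using F by (intro has_derivative_frechet) auto
  have cF: "continuous_on UNIV F" using F C_n_SucD[of 0 F] by simp
  have cD: "continuous_on UNIV ?D" using F by simp
  have D0: "?D z = 0" if "R < cmod z" for z
  proof -
    have "open {z. R < cmod z}" by (intro open_Collect_less continuous_intros)
    then have "((\<lambda>_. 0) has_derivative frechet_derivative F (at z)) (at z)"
      using has_derivative_transform_within_open[OF dF[of z], of "{z. R < cmod z}" "\<lambda>_. 0"] that supp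
      by auto
    then show ?thesis
      using has_derivative_unique[OF has_derivative_const] by (metis)
  qed
  obtain B where B: "\<And>z. norm (?D z) \<le> B"
  proof -
    have "compact (?D ` cball 0 R)"
      by (intro compact_continuous_image continuous_on_subset[OF cD]) auto
    then obtain B where "\<And>z. z \<in> cball 0 R \<Longrightarrow> norm (?D z) \<le> B"
      by (meson bounded_iff compact_imp_bounded image_eqI)
    then have "norm (?D z) \<le> max B 0" for z
      using D0[of z] by (cases "R < cmod z") (force simp: le_max_iff_disj)+
    then show ?thesis using that by blast
  qed
  \<comment> \<open>Steps of length at most one keep all difference quotients supported in a common
    ball.\<close>
  define h where "h n = inverse (real (Suc n))" for n
  have h: "0 < h n" "h n \<le> 1" "h n \<noteq> 0" for n by (auto simp: h_def field_simps)
  have hlim: "filterlim h (at 0) sequentially"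
    unfolding h_def using LIMSEQ_inverse_real_of_nat
    by (intro filterlim_atI) (auto intro!: eventuallyI)
  define s where "s n z = (F (z + of_real (h n) * v) - F z) /\<^sub>R h n" for n z
  have line: "((\<lambda>t. F (z + of_real t * v)) has_vector_derivative ?D (z + of_real t * v)) (at t within S)"
    for z t S
  proof -
    have "((\<lambda>t. z + of_real t * v) has_derivative (\<lambda>s. of_real s * v)) (at t within S)"
      by (auto intro!: derivative_eq_intros)
    from has_derivative_compose[OF this dF]
    have "((\<lambda>t. F (z + of_real t * v)) has_derivative
      (\<lambda>s. frechet_derivative F (at (z + of_real t * v)) (of_real s * v))) (at t within S)" .
    moreover have "frechet_derivative F (at q) (of_real s * v) = s *\<^sub>R ?D q" for q s
      using linear_scale[OF has_derivative_linear[OF dF], of q s v]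
      by (simp add: scaleR_conv_of_real)
    ultimately show ?thesis by (simp add: has_vector_derivative_def)
  qed
  have cs: "continuous_on UNIV (s n)" for n
    unfolding s_def
    by (intro continuous_intros continuous_on_compose2[OF cF]) auto
  have "(\<lambda>n. LINT z|lborel. s n z) \<longlonglongrightarrow> (LINT z|lborel. ?D z)"
  proof (rule integral_dominated_convergence)
    show "?D \<in> borel_measurable lborel" using cD by (simp add: borel_measurable_continuous)
    show "s n \<in> borel_measurable lborel" for n using cs by (simp add: borel_measurable_continuous)
    show "integrable lborel (\<lambda>z. indicator (cball 0 (R + cmod v)) z *\<^sub>R B)"
      by (intro borel_integrable_compact) auto
    show "AE z in lborel. (\<lambda>n. s n z) \<longlonglongrightarrow> ?D z"
    proof (intro AE_I2)
      fix z
      have "((\<lambda>y. (F (z + of_real y * v) - F (z + of_real 0 * v)) /\<^sub>R (y - 0)) \<longlongrightarrow> ?D (z + of_real 0 * v)) (at 0)"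
      proof (rule LIM_zero_cancel, rule tendsto_norm_zero_cancel)
        let ?A = "\<lambda>y. F (z + of_real y * v) - F (z + of_real 0 * v)" and ?L = "?D (z + of_real 0 * v)"
        have "(\<lambda>y. norm (F (z + of_real y * v) - F (z + of_real 0 * v) - (y - 0) *\<^sub>R ?L) / norm (y - 0)) \<midarrow>0\<rightarrow> 0"
          using line[of z 0 UNIV] unfolding has_vector_derivative_def has_derivative_iff_norm by blast
        moreover have "norm (?A y /\<^sub>R (y - 0) - ?L) =
            norm (F (z + of_real y * v) - F (z + of_real 0 * v) - (y - 0) *\<^sub>R ?L) / norm (y - 0)"
          if "y \<noteq> 0" for y
        proof -
          have "?A y /\<^sub>R (y - 0) - ?L = (?A y - (y - 0) *\<^sub>R ?L) /\<^sub>R (y - 0)"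
            using that by (simp add: scaleR_diff_right)
          then show ?thesis by (simp only: norm_scaleR) (simp add: divide_inverse)
        qed
        ultimately show "(\<lambda>y. norm (?A y /\<^sub>R (y - 0) - ?L)) \<midarrow>0\<rightarrow> 0"
          by (subst tendsto_cong[OF eventually_at_filter[THEN iffD2, OF eventuallyI]]) auto
      qed
      then have "((\<lambda>y. (F (z + of_real y * v) - F z) /\<^sub>R y) \<longlongrightarrow> ?D z) (at 0)" by simp
      from filterlim_compose[OF this hlim] show "(\<lambda>n. s n z) \<longlonglongrightarrow> ?D z" by (simp add: s_def)
    qed
    show "AE z in lborel. norm (s n z) \<le> indicator (cball 0 (R + cmod v)) z *\<^sub>R B" for n
    proof (intro AE_I2)
      fix z
      \<comment> \<open>Within the enlarged ball the mean value inequality along the segment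
        applies; beyond it both \<open>z\<close> and its translate lie outside the support.\<close>
      show "norm (s n z) \<le> indicator (cball 0 (R + cmod v)) z *\<^sub>R B"
      proof (cases "cmod z \<le> R + cmod v")
        case True
        have "norm (F (z + of_real (h n) * v) - F (z + of_real 0 * v)) \<le> B * norm (h n - 0)"
        proof (rule differentiable_bound[where S = UNIV and f' = "\<lambda>t s. s *\<^sub>R ?D (z + of_real t * v)"])
          show "((\<lambda>t. F (z + of_real t * v)) has_derivative (\<lambda>s. s *\<^sub>R ?D (z + of_real t * v))) (at t within UNIV)" for t
            using line[of z t UNIV] by (simp add: has_vector_derivative_def)
          show "onorm (\<lambda>s. s *\<^sub>R ?D (z + of_real t * v)) \<le> B" for t
            using B[of "z + of_real t * v"] by (intro onorm_le) (metis abs_ge_zero mult.commute mult_right_mono norm_scaleR real_norm_def)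
        qed auto
        then have *: "norm (F (z + of_real (h n) * v) - F z) \<le> B * h n"
          using h(1)[of n] by simp
        have "norm (s n z) = inverse (h n) * norm (F (z + of_real (h n) * v) - F z)"
          using h(1)[of n] unfolding s_def norm_scaleR by simp
        also have "\<dots> \<le> inverse (h n) * (B * h n)"
          using h(1)[of n] by (intro mult_left_mono *) auto
        also have "\<dots> = B" using h(1)[of n] by simp
        finally have "norm (s n z) \<le> B" .
        then show ?thesis using True by (simp add: indicator_def)
      next
        case False
        have "cmod (of_real (h n) * v) \<le> cmod v"
          using h[of n] by (simp add: norm_mult mult_left_le_one_le)
        moreover have "cmod z \<le> cmod (z + of_real (h n) * v) + cmod (of_real (h n) * v)"
          by (metis add_diff_cancel_right' norm_triangle_ineq4)
        ultimately have "R < cmod (z + of_real (h n) * v)" "R < cmod z"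
          using False norm_ge_zero[of v] by linarith+
        then show ?thesis using supp False by (simp add: s_def)
      qed
    qed
  qed
  moreover have "(LINT z|lborel. s n z) = 0" for n
  proof -
    have i: "integrable lborel F" by (rule integrable_compact_support[OF cF supp])
    have [measurable]: "F \<in> borel_measurable borel" by (rule borel_measurable_continuous[OF cF])
    show ?thesis
      unfolding s_def using i
      by (simp add: integrable_lborel_shift integral_lborel_shift)
  qed
  ultimately show ?thesis
    by (simp add: LIMSEQ_const_iff)
qed

section \<open>The creation operator and cutoffs\<close>

definition adag :: "(complex \<Rightarrow> complex) \<Rightarrow> complex \<Rightarrow> complex" where
  "adag f z = cnj z * f z - dz f z"

lemma smooth_adag: "smooth f \<Longrightarrow> smooth (adag f)"
  unfolding adag_def[abs_def] by (intro smooth_diff smooth_mult smooth_cnj smooth_ident smooth_dz)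

lemma wirtinger_cnj_ident: "dz cnj z = 0" "dbar cnj z = 1"
proof -
  have "(cnj has_derivative (\<lambda>v. v * 0 + cnj v * 1)) (at z)"
    by (auto intro!: derivative_eq_intros)
  from wirtinger_eqI[OF this] show "dz cnj z = 0" "dbar cnj z = 1" .
qed

lemma smooth_cnj_ident: "smooth cnj"
  using smooth_cnj[OF smooth_ident] by simp

text \<open>This is the commutation relation: \<open>dbar\<close> of the factor \<open>cnj z\<close>
  is one, and \<open>dbar\<close> passes through \<open>dz\<close>.\<close>

lemma dbar_adag:
  assumes "smooth f"
  shows "dbar (adag f) z = adag (dbar f) z + f z"
proof -
  have "dbar (adag f) z = dbar (\<lambda>z. cnj z * f z) z - dbar (dz f) z"
    unfolding adag_def[abs_def]
    by (intro wirtinger_diff smooth_differentiable smooth_mult smooth_cnj_ident smooth_dz assms)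
  also have "dbar (\<lambda>z. cnj z * f z) z = cnj z * dbar f z + dbar cnj z * f z"
    by (intro wirtinger_mult smooth_differentiable smooth_cnj_ident assms)
  finally show ?thesis
    by (simp add: adag_def[abs_def] dz_dbar_commute[OF assms] wirtinger_cnj_ident)
qed

section \<open>Integration by parts against the Gaussian weight\<close>

lemma C_n_1_wirtinger:
  assumes "C_n 1 f"
  shows "f differentiable (at z)" "continuous_on S (dbar f)" "continuous_on S (dz f)" "continuous_on S f"
proof -
  have "C_n 0 f" using assms C_n_SucD[of 0 f] by simp
  then show "f differentiable (at z)" "continuous_on S (dbar f)" "continuous_on S (dz f)" "continuous_on S f"
    using assms unfolding dbar_def[abs_def] dz_def[abs_def]
    by (auto intro!: continuous_intros intro: continuous_on_subset)
qed

lemma C_n_1I: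
  assumes d: "\<And>z. (f has_derivative (\<lambda>v. v * p z + cnj v * q z)) (at z)"
    and "continuous_on UNIV p" "continuous_on UNIV q"
  shows "C_n 1 f"
proof -
  have "f differentiable (at z)" for z using d unfolding differentiable_def by blast
  then show ?thesis
    using assms by (auto simp: frechet_derivative_eqI[OF d] intro!: continuous_intros)
qed

lemma smooth_C_n: "smooth f \<Longrightarrow> C_n n f"
  by (simp add: smooth_def)

lemma wirtinger_gw:
  "C_n 1 (\<lambda>z. of_real (gw z))" "dbar (\<lambda>z. of_real (gw z)) z = - z * of_real (gw z)"
proof -
  have eq: "(\<lambda>z. of_real (gw z)) = (\<lambda>z. exp (- (z * cnj z)) / of_real pi)"
    unfolding gw_def complex_norm_square[symmetric] by (auto simp flip: exp_of_real)
  have d: "((\<lambda>z. of_real (gw z)) has_derivative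
      (\<lambda>v. v * (- cnj z * of_real (gw z)) + cnj v * (- z * of_real (gw z)))) (at z)" for z
  proof -
    have "((\<lambda>z. - (z * cnj z)) has_derivative (\<lambda>v. - (v * cnj z + cnj v * z))) (at z)"
      by (auto intro!: derivative_eq_intros simp: algebra_simps)
    from has_derivative_compose[OF this DERIV_exp[unfolded has_field_derivative_def]]
    have "((\<lambda>z. exp (- (z * cnj z)) * inverse (of_real pi)) has_derivative
        (\<lambda>v. exp (- (z * cnj z)) * (- (v * cnj z + cnj v * z)) * inverse (of_real pi))) (at z)"
      by (rule has_derivative_mult_left)
    then show ?thesis
      unfolding fun_cong[OF eq] unfolding eq by (simp add: divide_inverse algebra_simps)
  qed
  show "C_n 1 (\<lambda>z. of_real (gw z))"
    by (rule C_n_1I[OF d]) (auto intro!: continuous_intros continuous_gw)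
  show "dbar (\<lambda>z. of_real (gw z)) z = - z * of_real (gw z)"
    by (rule wirtinger_eqI(2)[OF d])
qed

lemma dbar_compact_support:
  assumes "f differentiable (at z)" "\<And>z. R < cmod z \<Longrightarrow> f z = 0" "R < cmod z"
  shows "frechet_derivative f (at z) v = 0" "dbar f z = 0"
proof -
  have "open {z. R < cmod z}" by (intro open_Collect_less continuous_intros)
  then have "((\<lambda>_. 0) has_derivative frechet_derivative f (at z)) (at z)"
    using has_derivative_transform_within_open[OF has_derivative_frechet[OF assms(1)], of "{z. R < cmod z}" "\<lambda>_. 0"] assms
    by auto
  then have "frechet_derivative f (at z) = (\<lambda>_. 0)"
    using has_derivative_unique[OF has_derivative_const] by metis
  then show "frechet_derivative f (at z) v = 0" "dbar f z = 0"
    by (simp_all add: dbar_def)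
qed

lemma integral_dbar_zero:
  assumes F: "C_n 1 F" and supp: "\<And>z. R < cmod z \<Longrightarrow> F z = 0"
  shows "(LINT z|lborel. dbar F z) = 0"
proof -
  have i: "integrable lborel (\<lambda>z. frechet_derivative F (at z) v)" for v
    using dbar_compact_support(1)[OF C_n_1_wirtinger(1)[OF F] supp] F
    by (intro integrable_compact_support[of _ R]) auto
  show ?thesis
    unfolding dbar_def using i by (simp add: integral_frechet_derivative_zero[OF F supp])
qed

text \<open>The integral of \<open>dbar\<close> of \<open>\<rho> * u * cnj v * gw\<close> vanishes.
  Since \<open>dbar gw = - z * gw\<close>, the derivative of \<open>cnj v * gw\<close> is
  \<open>- cnj (adag v) * gw\<close>, which explains the shape of \<open>adag\<close>. The term with
  \<open>dbar \<rho>\<close> is the error caused by the cutoff.\<close>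

lemma weighted_adjoint:
  assumes \<rho>: "C_n 1 \<rho>" and supp: "\<And>z. R < cmod z \<Longrightarrow> \<rho> z = 0" and u: "C_n 1 u" and v: "C_n 1 v"
  shows "(LINT z|fock_measure. \<rho> z * dbar u z * cnj (v z)) + (LINT z|fock_measure. dbar \<rho> z * u z * cnj (v z))
       = (LINT z|fock_measure. \<rho> z * u z * cnj (adag v z))"
proof -
  let ?g = "\<lambda>z. complex_of_real (gw z)"
  have diff: "\<rho> differentiable (at z)" "u differentiable (at z)" "v differentiable (at z)" "?g differentiable (at z)" for z
    using \<rho> u v wirtinger_gw(1) by (auto intro: C_n_1_wirtinger)
  have diff': "(\<lambda>z. cnj (v z)) differentiable (at z)" for z
    using C_n_cnj[OF v] by (auto intro: C_n_1_wirtinger)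
  note cont = C_n_1_wirtinger(2-4)[OF \<rho>] C_n_1_wirtinger(2-4)[OF u] C_n_1_wirtinger(2-4)[OF v]
  have supp': "dbar \<rho> z = 0" if "R < cmod z" for z
    using dbar_compact_support(2)[OF diff(1) supp that] .
  define F where "F z = (\<rho> z * u z) * (cnj (v z) * ?g z)" for z
  have CF: "C_n 1 F" unfolding F_def by (intro C_n_mult C_n_cnj \<rho> u v wirtinger_gw)
  have dF: "dbar F z = ?g z * (\<rho> z * dbar u z * cnj (v z) + dbar \<rho> z * u z * cnj (v z)
        - \<rho> z * u z * cnj (adag v z))" for z
    unfolding F_def
    by (simp add: wirtinger_mult wirtinger_cnj wirtinger_gw(2) diff diff' differentiable_mult adag_def algebra_simps)
  have c1: "continuous_on UNIV (\<lambda>z. \<rho> z * dbar u z * cnj (v z))"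
    and c2: "continuous_on UNIV (\<lambda>z. dbar \<rho> z * u z * cnj (v z))"
    and c3: "continuous_on UNIV (\<lambda>z. \<rho> z * u z * cnj (adag v z))"
    unfolding adag_def by (intro continuous_intros cont)+
  have i1: "integrable fock_measure (\<lambda>z. \<rho> z * dbar u z * cnj (v z))"
    and i2: "integrable fock_measure (\<lambda>z. dbar \<rho> z * u z * cnj (v z))"
    and i3: "integrable fock_measure (\<lambda>z. \<rho> z * u z * cnj (adag v z))"
    using supp supp' by (auto intro!: integrable_fock_compact_support[of _ R] c1 c2 c3)
  have "0 = (LINT z|lborel. dbar F z)"
    using integral_dbar_zero[OF CF, of R] supp by (simp add: F_def)
  also have "\<dots> = (LINT z|fock_measure. \<rho> z * dbar u z * cnj (v z) + dbar \<rho> z * u z * cnj (v z)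
        - \<rho> z * u z * cnj (adag v z))"
    by (subst integral_fock_eq) (auto intro!: borel_measurable_continuous continuous_intros c1 c2 c3
        simp: dF[abs_def] scaleR_conv_of_real)
  also have "\<dots> = (LINT z|fock_measure. \<rho> z * dbar u z * cnj (v z)) + (LINT z|fock_measure. dbar \<rho> z * u z * cnj (v z))
       - (LINT z|fock_measure. \<rho> z * u z * cnj (adag v z))"
    using i1 i2 i3 by simp
  finally show ?thesis by simp
qed

text \<open>The square of the positive part is only continuously differentiable, which suffices here.\<close>

definition chi :: "real \<Rightarrow> complex \<Rightarrow> real" where
  "chi R z = (max 0 (1 - (cmod z)\<^sup>2 / R\<^sup>2))\<^sup>2"

lemma has_derivative_pos_part_square:
  "((\<lambda>t. (max 0 t)\<^sup>2) has_real_derivative 2 * max 0 t) (at t)"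
proof -
  consider "t > 0" | "t < 0" | "t = 0" by linarith
  then show ?thesis
  proof cases
    case 1
    have "((\<lambda>t. t\<^sup>2) has_real_derivative 2 * max 0 t) (at t)"
      using 1 by (auto intro!: derivative_eq_intros)
    then show ?thesis
      by (rule has_field_derivative_transform_within_open[of _ _ _ "{0<..}"]) (use 1 in auto)
  next
    case 2
    have "((\<lambda>t. 0) has_real_derivative 2 * max 0 t) (at t)"
      using 2 by (auto intro!: derivative_eq_intros)
    then show ?thesis
      by (rule has_field_derivative_transform_within_open[of _ _ _ "{..<0}"]) (use 2 in auto)
  next
    case 3
    have "((\<lambda>h. (max 0 h)\<^sup>2 / h) \<longlongrightarrow> 0) (at (0::real))"
    proof (rule Lim_null_comparison)
      show "\<forall>\<^sub>F h in at 0. norm ((max 0 h)\<^sup>2 / h) \<le> \<bar>h\<bar>"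
        by (intro always_eventually) (auto simp: max_def power2_eq_square)
    qed (use tendsto_rabs_zero[OF tendsto_ident_at] in auto)
    then show ?thesis using 3 by (simp add: DERIV_def)
  qed
qed

lemma chi_bounds: "0 \<le> chi R z" "chi R z \<le> 1"
  by (auto simp: chi_def intro!: power_le_one)

lemma chi_zero: "R < cmod z \<Longrightarrow> R > 0 \<Longrightarrow> chi R z = 0"
proof -
  assume "R < cmod z" "R > 0"
  then have "R\<^sup>2 \<le> (cmod z)\<^sup>2" by (intro power_mono) auto
  then have "1 - (cmod z)\<^sup>2 / R\<^sup>2 \<le> 0" using \<open>R > 0\<close> by (simp add: field_simps)
  then show ?thesis by (simp add: chi_def)
qed

lemma
  assumes "R > 0"
  shows C_n_chi: "C_n 1 (\<lambda>z. of_real (chi R z))"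
    and dbar_chi: "dbar (\<lambda>z. of_real (chi R z)) z = - of_real (2 * max 0 (1 - (cmod z)\<^sup>2 / R\<^sup>2) / R\<^sup>2) * z"
proof -
  let ?m = "\<lambda>z. 2 * max 0 (1 - (cmod z)\<^sup>2 / R\<^sup>2)"
  have d: "((\<lambda>z. complex_of_real (chi R z)) has_derivative
      (\<lambda>v. v * (- of_real (?m z / R\<^sup>2) * cnj z) + cnj v * (- of_real (?m z / R\<^sup>2) * z))) (at z)" for z
  proof -
    have "((\<lambda>z. 1 - (cmod z)\<^sup>2 / R\<^sup>2) has_derivative (\<lambda>v. - (2 * (z \<bullet> v)) / R\<^sup>2)) (at z)"
      unfolding power2_norm_eq_inner
      by (rule derivative_eq_intros refl)+ (use assms in \<open>auto simp: inner_commute field_simps\<close>)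
    from has_derivative_compose[OF this has_derivative_pos_part_square[unfolded has_field_derivative_def]]
    have "(chi R has_derivative (\<lambda>v. ?m z * (- (2 * (z \<bullet> v)) / R\<^sup>2))) (at z)"
      by (simp add: chi_def[abs_def])
    from has_derivative_of_real[OF this, where 'a = complex]
    have "((\<lambda>z. complex_of_real (chi R z)) has_derivative (\<lambda>v. of_real (?m z * (- (2 * (z \<bullet> v)) / R\<^sup>2)))) (at z)" .
    moreover have "complex_of_real (?m z * (- (2 * (z \<bullet> v)) / R\<^sup>2)) =
       v * (- of_real (?m z / R\<^sup>2) * cnj z) + cnj v * (- of_real (?m z / R\<^sup>2) * z)" for v
    proof -
      have "complex_of_real (2 * (z \<bullet> v)) = v * cnj z + cnj v * z"
        by (auto simp: complex_eq_iff inner_complex_def)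
      then have "complex_of_real (- (2 * (z \<bullet> v)) / R\<^sup>2) = - (v * cnj z + cnj v * z) / of_real (R\<^sup>2)"
        by (simp only: of_real_divide of_real_minus)
      then have "complex_of_real (?m z * (- (2 * (z \<bullet> v)) / R\<^sup>2)) =
          of_real (?m z) * (- (v * cnj z + cnj v * z) / of_real (R\<^sup>2))"
        by (simp only: of_real_mult)
      also have "\<dots> = v * (- (of_real (?m z) / of_real (R\<^sup>2)) * cnj z) + cnj v * (- (of_real (?m z) / of_real (R\<^sup>2)) * z)"
        using assms by (simp only: divide_inverse) algebra
      finally show ?thesis by (simp only: of_real_divide)
    qed
    ultimately show ?thesis by (simp only:)
  qed
  show "C_n 1 (\<lambda>z. of_real (chi R z))"
    by (rule C_n_1I[OF d]) (use assms in \<open>auto intro!: continuous_intros\<close>)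
  show "dbar (\<lambda>z. of_real (chi R z)) z = - of_real (?m z / R\<^sup>2) * z"
    by (rule wirtinger_eqI(2)[OF d])
qed

text \<open>On the support \<open>cmod z\<close> is at most \<open>R\<close>, which consumes one of
  the two powers of \<open>R\<close> in the denominator. The remaining decay removes the cutoff in
  the adjoint relation; in the energy estimates the bound is used in the form that it is at most
  one.\<close>

lemma dbar_chi_bound:
  assumes "R \<ge> 2"
  shows "cmod (dbar (\<lambda>z. of_real (chi R z)) z) \<le> 2 / R"
proof -
  define m where "m = max 0 (1 - (cmod z)\<^sup>2 / R\<^sup>2)"
  have m: "0 \<le> m" "m \<le> 1" by (auto simp: m_def)
  have "m * cmod z \<le> R"
  proof (cases "cmod z \<le> R")
    case True
    then show ?thesis using m mult_mono[of m 1 "cmod z" R] by simp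
  next
    case False
    then have "chi R z = 0" using assms by (intro chi_zero) auto
    then show ?thesis using assms by (simp add: chi_def m_def)
  qed
  then have "2 * m / R\<^sup>2 * cmod z \<le> 2 / R"
    using assms by (simp add: field_simps power2_eq_square)
  moreover have "cmod (- of_real (2 * m / R\<^sup>2) * z) = 2 * m / R\<^sup>2 * cmod z"
    using m by (simp add: norm_mult norm_divide norm_power)
  ultimately show ?thesis
    using dbar_chi[of R z] assms unfolding m_def by simp
qed

lemma
  assumes "R > 0"
  shows C_n_chi_power: "C_n 1 (\<lambda>z. of_real (chi R z) ^ m)"
    and dbar_chi_power: "dbar (\<lambda>z. of_real (chi R z) ^ m) z =
      of_nat m * of_real (chi R z) ^ (m - 1) * dbar (\<lambda>z. of_real (chi R z)) z"
proof -
  show C: "C_n 1 (\<lambda>z. of_real (chi R z) ^ m)" for m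
    by (induction m) (simp_all only: power_0 power_Suc C_n_const C_n_mult[OF C_n_chi[OF assms]])
  show "dbar (\<lambda>z. of_real (chi R z) ^ m) z =
      of_nat m * of_real (chi R z) ^ (m - 1) * dbar (\<lambda>z. of_real (chi R z)) z"
  proof (induction m)
    case 0
    show ?case by (simp add: wirtinger_const)
  next
    case (Suc m)
    show ?case
      unfolding power_Suc
      by (subst wirtinger_mult(2)[OF C_n_1_wirtinger(1)[OF C_n_chi[OF assms]] C_n_1_wirtinger(1)[OF C]], subst Suc)
        (cases m; simp add: algebra_simps)
  qed
qed

lemma continuous_chi: "R > 0 \<Longrightarrow> continuous_on S (chi R)"
  unfolding chi_def[abs_def] by (intro continuous_intros) auto

text \<open>Expanding \<open>(s * a - b)\<^sup>2 / s \<ge> 0\<close> bounds the product. The free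
  weight \<open>s\<close> is kept so that one of the two norms can be given a small factor and
  absorbed elsewhere.\<close>

lemma integral_norm_le_AMGM:
  fixes g :: "complex \<Rightarrow> complex"
  assumes g: "g \<in> borel_measurable borel"
    and a: "integrable fock_measure (\<lambda>z. (a z)\<^sup>2)" and b: "integrable fock_measure (\<lambda>z. (b z)\<^sup>2)"
    and le: "\<And>z. cmod (g z) \<le> K * (a z * b z)" and K: "K \<ge> 0" and s: "s > 0"
  shows "integrable fock_measure g"
    and "cmod (LINT z|fock_measure. g z) \<le>
      K / 2 * (s * (LINT z|fock_measure. (a z)\<^sup>2) + (LINT z|fock_measure. (b z)\<^sup>2) / s)"
proof -
  let ?h = "\<lambda>z. K / 2 * (s * (a z)\<^sup>2 + (b z)\<^sup>2 / s)"
  have i: "integrable fock_measure ?h" using a b by simp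
  have le': "cmod (g z) \<le> ?h z" for z
  proof -
    have "0 \<le> (s * a z - b z)\<^sup>2 / s" using s by simp
    also have "\<dots> = s * (a z)\<^sup>2 + (b z)\<^sup>2 / s - 2 * (a z * b z)"
      using s by (simp add: power2_eq_square field_simps)
    finally have "a z * b z \<le> (s * (a z)\<^sup>2 + (b z)\<^sup>2 / s) / 2" by simp
    from mult_left_mono[OF this K] le[of z] show ?thesis by simp
  qed
  show ig: "integrable fock_measure g"
  proof (rule Bochner_Integration.integrable_bound[OF i])
    show "AE z in fock_measure. norm (g z) \<le> norm (?h z)"
      using le' by (intro AE_I2) (metis abs_ge_self order_trans real_norm_def)
  qed (use g in simp)
  have "cmod (LINT z|fock_measure. g z) \<le> (LINT z|fock_measure. cmod (g z))"
    by (rule integral_norm_bound)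
  also have "\<dots> \<le> (LINT z|fock_measure. ?h z)"
    using ig i le' by (intro integral_mono) auto
  also have "\<dots> = K / 2 * (s * (LINT z|fock_measure. (a z)\<^sup>2) + (LINT z|fock_measure. (b z)\<^sup>2) / s)"
    using a b by simp
  finally show "cmod (LINT z|fock_measure. g z) \<le>
      K / 2 * (s * (LINT z|fock_measure. (a z)\<^sup>2) + (LINT z|fock_measure. (b z)\<^sup>2) / s)" .
qed

section \<open>The annihilation and creation operators preserve square integrability\<close>

lemma L2_iff: "f \<in> L2 \<longleftrightarrow> f \<in> borel_measurable borel \<and> integrable fock_measure (\<lambda>z. (cmod (f z))\<^sup>2)"
  by (simp add: L2_def)

lemma L2_measurable: "f \<in> L2 \<Longrightarrow> f \<in> borel_measurable borel"
  and L2_integrable: "f \<in> L2 \<Longrightarrow> integrable fock_measure (\<lambda>z. (cmod (f z))\<^sup>2)"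
  by (simp_all add: L2_iff)

definition cut_norm2 :: "real \<Rightarrow> nat \<Rightarrow> (complex \<Rightarrow> complex) \<Rightarrow> real" where
  "cut_norm2 R j f = (LINT z|fock_measure. (chi R z ^ j * cmod (f z))\<^sup>2)"

text \<open>A positive power of the cutoff has compact support. The power zero is constantly one,
  hence the alternative that \<open>f\<close> is square integrable.\<close>

lemma integrable_cut:
  assumes "continuous_on UNIV f" "R > 0" "j > 0 \<or> f \<in> L2"
  shows "integrable fock_measure (\<lambda>z. (chi R z ^ j * cmod (f z))\<^sup>2)"
proof (cases "j > 0")
  case True
  then show ?thesis
    using assms chi_zero[OF _ assms(2)]
    by (intro integrable_fock_compact_support[of _ R]) (auto intro!: continuous_intros continuous_chi simp: power_0_left)
next
  case False
  then show ?thesis using assms L2_integrable by auto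
qed

lemma cut_norm2_nonneg: "cut_norm2 R j f \<ge> 0"
  by (simp add: cut_norm2_def)

lemma cut_norm2_Suc_le:
  assumes "continuous_on UNIV f" "R > 0" "j > 0 \<or> f \<in> L2"
  shows "cut_norm2 R (Suc j) f \<le> cut_norm2 R j f"
  unfolding cut_norm2_def
proof (rule integral_mono)
  show "integrable fock_measure (\<lambda>z. (chi R z ^ Suc j * cmod (f z))\<^sup>2)"
    "integrable fock_measure (\<lambda>z. (chi R z ^ j * cmod (f z))\<^sup>2)"
    using assms by (auto intro!: integrable_cut simp del: power_Suc)
  show "(chi R z ^ Suc j * cmod (f z))\<^sup>2 \<le> (chi R z ^ j * cmod (f z))\<^sup>2" for z
    using chi_bounds[of R z]
    by (intro power_mono mult_right_mono) (auto intro!: mult_left_le_one_le)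
qed

lemma dbar_chi_power_bound:
  assumes "R \<ge> 2"
  shows "cmod (dbar (\<lambda>z. of_real (chi R z) ^ Suc m) z) \<le> real (Suc m) * chi R z ^ m"
proof -
  let ?d = "dbar (\<lambda>z. of_real (chi R z)) z"
  have R0: "R > 0" using assms by simp
  have "2 / R \<le> 1" using assms by simp
  with dbar_chi_bound[OF assms, of z] have d: "cmod ?d \<le> 1" by linarith
  have "cmod (dbar (\<lambda>z. of_real (chi R z) ^ Suc m) z) = real (Suc m) * chi R z ^ m * cmod ?d"
    unfolding dbar_chi_power[OF R0] norm_mult norm_power norm_of_nat
    by (simp add: chi_bounds del: of_nat_Suc)
  also have "\<dots> \<le> real (Suc m) * chi R z ^ m * 1"
    using d by (intro mult_left_mono) (auto simp: chi_bounds)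
  finally show ?thesis by simp
qed

text \<open>
  The powers of the cutoff are matched to the order of the derivative: the cutoff that is lost when
  it is differentiated is exactly the difference between the weights of \<open>u\<close> and of its derivatives.
\<close>

lemma
  assumes u: "smooth u" and R: "R \<ge> 2" and L: "j > 0 \<or> u \<in> L2" and s: "s > 0"
  shows caccioppoli_dbar: "cut_norm2 R (Suc j) (dbar u) \<le>
      (s * cut_norm2 R j u + cut_norm2 R (j + 2) (adag (dbar u)) / s) / 2
      + real (Suc j) * (s * cut_norm2 R j u + cut_norm2 R (Suc j) (dbar u) / s)"
    and caccioppoli_adag: "cut_norm2 R (Suc j) (adag u) \<le>
      2 * (cut_norm2 R (Suc j) (dbar u) + real (Suc j) * (cut_norm2 R j u + cut_norm2 R (Suc j) (dbar u))
        + cut_norm2 R j u + 2 * (real (Suc j))\<^sup>2 * cut_norm2 R j u)"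
proof -
  \<comment> \<open>The exponent \<open>2 * j + 2\<close> is the square of the weight
    \<open>Suc j\<close>, it splits as \<open>j + (j + 2)\<close> over \<open>u\<close> and
    \<open>adag (dbar u)\<close>, and after one differentiation it leaves
    \<open>j + Suc j\<close>.\<close>
  let ?c = "chi R" and ?m = "Suc (Suc (2 * j))"
  let ?X = "cut_norm2 R j u" and ?X' = "cut_norm2 R (Suc j) (dbar u)"
    and ?Y = "cut_norm2 R (Suc j) (adag u)" and ?Y' = "cut_norm2 R (j + 2) (adag (dbar u))"
  let ?rho = "\<lambda>z. complex_of_real (?c z) ^ ?m"
  have R0: "R > 0" using R by simp
  have sm: "smooth (dbar u)" "smooth (adag u)" "smooth (adag (dbar u))"
    by (intro smooth_dbar smooth_adag u)+
  note cont = smooth_continuous_on[OF u] smooth_continuous_on[OF sm(1)] smooth_continuous_on[OF sm(2)]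
    smooth_continuous_on[OF sm(3)] continuous_chi[OF R0]
  have iX: "integrable fock_measure (\<lambda>z. (?c z ^ j * cmod (u z))\<^sup>2)"
    and iX': "integrable fock_measure (\<lambda>z. (?c z ^ Suc j * cmod (dbar u z))\<^sup>2)"
    and iY: "integrable fock_measure (\<lambda>z. (?c z ^ Suc j * cmod (adag u z))\<^sup>2)"
    and iY': "integrable fock_measure (\<lambda>z. (?c z ^ (j + 2) * cmod (adag (dbar u) z))\<^sup>2)"
    using L R0 by (auto intro!: integrable_cut cont simp del: power_Suc)
  have supp: "?rho z = 0" if "R < cmod z" for z using chi_zero[OF that R0] by simp
  have Crho: "C_n 1 ?rho" by (rule C_n_chi_power[OF R0])
  have cc: "0 \<le> ?c z" for z by (rule chi_bounds)
  have drho: "cmod (dbar ?rho z) \<le> 2 * real (Suc j) * (?c z ^ j * ?c z ^ Suc j)" for z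
  proof -
    have "?c z ^ Suc (2 * j) = ?c z ^ j * ?c z ^ Suc j" by (simp add: mult_2 power_add)
    moreover have "real ?m = 2 * real (Suc j)" by simp
    ultimately show ?thesis
      using dbar_chi_power_bound[OF R, of "Suc (2 * j)" z] by (simp only: mult.assoc)
  qed
  have cdrho: "continuous_on UNIV (dbar ?rho)" by (rule C_n_1_wirtinger(2)[OF Crho])
  have sq: "(LINT z|fock_measure. ?rho z * f z * cnj (f z)) = of_real (cut_norm2 R (Suc j) f)" for f
  proof -
    have "?rho z * f z * cnj (f z) = of_real ((?c z ^ Suc j * cmod (f z))\<^sup>2)" for z
    proof -
      have "of_real ((?c z ^ Suc j * cmod (f z))\<^sup>2) = complex_of_real (?c z) ^ (Suc j * 2) * (f z * cnj (f z))"
        unfolding power_mult_distrib of_real_mult power_mult of_real_power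
        using complex_norm_square[of "f z"] by (simp del: power_Suc)
      moreover have "Suc j * 2 = ?m" by simp
      ultimately show ?thesis by (simp only: mult.assoc)
    qed
    then show ?thesis
      unfolding cut_norm2_def by (simp add: integral_complex_of_real del: of_real_power power_Suc)
  qed
  have K: "0 \<le> 2 * real (Suc j)" and t2: "0 < 2 * real (Suc j)" and K2: "2 * real (Suc j) / 2 = real (Suc j)" by simp_all
  have b1: "cmod (LINT z|fock_measure. ?rho z * u z * cnj (adag (dbar u) z)) \<le> (t * ?X + ?Y' / t) / 2"
    (is "cmod ?I1 \<le> _") if t: "t > 0" for t
  proof -
    have "cmod (?rho z * u z * cnj (adag (dbar u) z)) \<le> 1 * ((?c z ^ j * cmod (u z)) * (?c z ^ (j + 2) * cmod (adag (dbar u) z)))" for z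
    proof -
      have "?c z ^ ?m = ?c z ^ j * ?c z ^ (j + 2)" by (simp add: mult_2 power_add)
      then show ?thesis
        using cc[of z] by (simp only: norm_mult norm_power norm_of_real abs_of_nonneg complex_mod_cnj) simp
    qed
    moreover have "(\<lambda>z. ?rho z * u z * cnj (adag (dbar u) z)) \<in> borel_measurable borel"
      by (intro borel_measurable_continuous continuous_intros cont)
    ultimately show ?thesis
      using integral_norm_le_AMGM(2)[OF _ iX iY' _ zero_le_one t, folded cut_norm2_def]
      by (simp only: divide_inverse mult_1_left mult.commute)
  qed
  have b2: "cmod (LINT z|fock_measure. dbar ?rho z * u z * cnj (dbar u z)) \<le> real (Suc j) * (t * ?X + ?X' / t)"
    (is "cmod ?I2 \<le> _") if t: "t > 0" for t
  proof -
    have bd: "cmod (dbar ?rho z * u z * cnj (dbar u z)) \<le> (2 * real (Suc j)) * ((?c z ^ j * cmod (u z)) * (?c z ^ Suc j * cmod (dbar u z)))" for z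
      using mult_right_mono[OF drho[of z], of "cmod (u z) * cmod (dbar u z)"]
      by (simp add: norm_mult mult_ac del: of_nat_Suc power_Suc)
    have ms: "(\<lambda>z. dbar ?rho z * u z * cnj (dbar u z)) \<in> borel_measurable borel"
      by (intro borel_measurable_continuous continuous_intros cont cdrho)
    show ?thesis
      using integral_norm_le_AMGM(2)[OF ms iX iX' bd K t, folded cut_norm2_def]
      by (simp only: K2)
  qed
  have b3: "cmod (LINT z|fock_measure. dbar ?rho z * adag u z * cnj (u z)) \<le> real (Suc j) * (t * ?X + ?Y / t)"
    (is "cmod ?I3 \<le> _") if t: "t > 0" for t
  proof -
    have bd: "cmod (dbar ?rho z * adag u z * cnj (u z)) \<le> (2 * real (Suc j)) * ((?c z ^ j * cmod (u z)) * (?c z ^ Suc j * cmod (adag u z)))" for z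
      using mult_right_mono[OF drho[of z], of "cmod (u z) * cmod (adag u z)"]
      by (simp add: norm_mult mult_ac del: of_nat_Suc power_Suc)
    have ms: "(\<lambda>z. dbar ?rho z * adag u z * cnj (u z)) \<in> borel_measurable borel"
      by (intro borel_measurable_continuous continuous_intros cont cdrho)
    show ?thesis
      using integral_norm_le_AMGM(2)[OF ms iX iY bd K t, folded cut_norm2_def]
      by (simp only: K2)
  qed
  \<comment> \<open>Testing the adjoint relation with \<open>v = dbar u\<close> expresses the
    weighted norm of \<open>dbar u\<close> through the pairing of \<open>u\<close> with
    \<open>adag (dbar u)\<close> and a cutoff error.\<close>
  have adj1: "of_real ?X' + ?I2 = ?I1"
    using weighted_adjoint[OF Crho supp smooth_C_n[OF u] smooth_C_n[OF sm(1)]]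
    by (simp only: sq)
  then have "of_real ?X' = ?I1 - ?I2" by (simp add: algebra_simps)
  then have "cmod (of_real ?X') \<le> cmod ?I1 + cmod ?I2" by (simp only: norm_triangle_ineq4)
  moreover have "cmod (of_real ?X') = ?X'" by (simp add: cut_norm2_nonneg)
  ultimately show "?X' \<le> (s * ?X + ?Y' / s) / 2 + real (Suc j) * (s * ?X + ?X' / s)"
    using b1[OF s] b2[OF s] by linarith
  \<comment> \<open>The same relation for the pair \<open>adag u\<close>, \<open>u\<close>.
    Commuting \<open>dbar\<close> past \<open>adag\<close> reproduces the conjugate of
    \<open>?I1\<close> and adds the weighted norm of \<open>u\<close>.\<close>
  have "(LINT z|fock_measure. ?rho z * dbar (adag u) z * cnj (u z)) + ?I3 = of_real ?Y"
    using weighted_adjoint[OF Crho supp smooth_C_n[OF sm(2)] smooth_C_n[OF u]]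
    by (simp only: sq)
  moreover have "(LINT z|fock_measure. ?rho z * dbar (adag u) z * cnj (u z)) =
      cnj ?I1 + of_real (cut_norm2 R (Suc j) u)"
  proof -
    have i1: "integrable fock_measure (\<lambda>z. ?rho z * adag (dbar u) z * cnj (u z))"
      and i2: "integrable fock_measure (\<lambda>z. ?rho z * u z * cnj (u z))"
      using supp by (auto intro!: integrable_fock_compact_support[of _ R] continuous_intros cont)
    have "?rho z * dbar (adag u) z * cnj (u z) = ?rho z * adag (dbar u) z * cnj (u z) + ?rho z * u z * cnj (u z)" for z
      by (simp add: dbar_adag[OF u] algebra_simps)
    then have "(LINT z|fock_measure. ?rho z * dbar (adag u) z * cnj (u z)) =
        (LINT z|fock_measure. ?rho z * adag (dbar u) z * cnj (u z)) + (LINT z|fock_measure. ?rho z * u z * cnj (u z))"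
      using i1 i2 by (simp only: Bochner_Integration.integral_add)
    moreover have "(LINT z|fock_measure. ?rho z * adag (dbar u) z * cnj (u z)) = cnj ?I1"
      unfolding Bochner_Integration.integral_cnj[symmetric] by (intro Bochner_Integration.integral_cong) (auto simp: mult_ac)
    ultimately show ?thesis by (simp only: sq)
  qed
  ultimately have "of_real ?Y = cnj (of_real ?X' + ?I2) + of_real (cut_norm2 R (Suc j) u) + ?I3"
    using adj1 by (simp add: algebra_simps)
  then have y1: "cmod (of_real ?Y) \<le> cmod (cnj (of_real ?X' + ?I2)) + cmod (complex_of_real (cut_norm2 R (Suc j) u)) + cmod ?I3"
    by (simp only:) (rule order_trans[OF norm_triangle_ineq add_right_mono[OF norm_triangle_ineq]])
  have y2: "cmod (cnj (of_real ?X' + ?I2)) \<le> ?X' + cmod ?I2"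
    using norm_triangle_ineq[of "of_real ?X'" ?I2] unfolding complex_mod_cnj by (simp add: cut_norm2_nonneg)
  have y3: "cmod (complex_of_real (cut_norm2 R (Suc j) u)) \<le> ?X"
    using cut_norm2_Suc_le[OF cont(1) R0 L] by (simp add: cut_norm2_nonneg)
  have y4: "cmod (of_real ?Y) = ?Y" by (simp add: cut_norm2_nonneg)
  \<comment> \<open>The weight \<open>2 * Suc j\<close> is chosen so that \<open>?Y\<close> appears
    on the right with factor one half and can be absorbed.\<close>
  have "real (Suc j) * ((2 * real (Suc j)) * ?X + ?Y / (2 * real (Suc j))) = 2 * (real (Suc j))\<^sup>2 * ?X + ?Y / 2"
    by (simp add: field_simps power2_eq_square del: of_nat_Suc)
  with b3[OF t2] have y5: "cmod ?I3 \<le> 2 * (real (Suc j))\<^sup>2 * ?X + ?Y / 2" by (simp only:)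
  have "?Y \<le> (?X' + real (Suc j) * (?X + ?X')) + ?X + (2 * (real (Suc j))\<^sup>2 * ?X + ?Y / 2)"
    by (rule order_trans[OF y1[unfolded y4] add_mono[OF add_mono[OF order_trans[OF y2 add_left_mono[OF
              b2[OF zero_less_one, unfolded mult_1_left div_by_1]]] y3] y5]])
  moreover have "y \<le> 2 * (p + q + r)" if "y \<le> p + q + (r + y / 2)" for y p q r :: real
    using that by simp
  ultimately show "?Y \<le> 2 * (?X' + real (Suc j) * (?X + ?X') + ?X + 2 * (real (Suc j))\<^sup>2 * ?X)"
    by blast
qed

lemma smooth_dbar_funpow: "smooth f \<Longrightarrow> smooth ((dbar ^^ j) f)"
  by (induction j) (auto intro: smooth_dbar)

lemma dbar_zero: "dbar (\<lambda>_. 0) = (\<lambda>_. 0)"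
  by (auto simp: wirtinger_const)

lemma dbar_funpow_zero: "(dbar ^^ j) (\<lambda>_. 0) = (\<lambda>_. 0)"
  by (induction j) (simp_all add: dbar_zero)

lemma poly_fockD:
  assumes "f \<in> poly_fock n"
  shows "f \<in> L2" "smooth f" "(dbar ^^ n) f = (\<lambda>_. 0)"
  using assms by (auto simp: poly_fock_def)

text \<open>
  Downward induction from \<open>a\<^sup>n f = 0\<close>. It is essential that \<open>C\<close> does not depend on \<open>R\<close>, as
  \<open>a f\<close> is not yet known to be square integrable.
\<close>

lemma poly_fock_dbar_bound:
  assumes f: "f \<in> poly_fock n"
  shows "j < n \<Longrightarrow> \<exists>C\<ge>0. \<forall>R\<ge>2. cut_norm2 R (Suc j) ((dbar ^^ Suc j) f) \<le> C * cut_norm2 R j ((dbar ^^ j) f)"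
proof (induction "n - Suc j" arbitrary: j)
  case 0
  \<comment> \<open>Here \<open>Suc j\<close> derivatives annihilate \<open>f\<close>, so the
    left-hand side is zero.\<close>
  then have "n = Suc j" by simp
  then have "cut_norm2 R (Suc j) ((dbar ^^ Suc j) f) = 0" for R
    using poly_fockD(3)[OF f] by (simp add: cut_norm2_def)
  then show ?case by (intro exI[of _ 0]) auto
next
  case (Suc m)
  then have "Suc j < n" "m = n - Suc (Suc j)" by auto
  from Suc(1)[OF this(2,1)] obtain D where D: "D \<ge> 0"
    "\<And>R. R \<ge> 2 \<Longrightarrow> cut_norm2 R (j + 2) ((dbar ^^ Suc (Suc j)) f) \<le> D * cut_norm2 R (Suc j) ((dbar ^^ Suc j) f)"
    by auto
  define u where "u = (dbar ^^ j) f"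
  have u: "smooth u" "j > 0 \<or> u \<in> L2"
    using poly_fockD[OF f] by (cases "j = 0"; auto simp: u_def smooth_dbar_funpow)+
  have du: "(dbar ^^ Suc j) f = dbar u" "(dbar ^^ Suc (Suc j)) f = dbar (dbar u)"
    by (simp_all add: u_def)
  define J where "J = real (Suc j)"
  define J2 where "J2 = real (Suc (Suc j))"
  have J: "J > 0" "J2 > 0" by (simp_all add: J_def J2_def)
  \<comment> \<open>\<open>E\<close> is the constant in the bound of \<open>adag (dbar u)\<close> by
    \<open>dbar u\<close>: the estimate for \<open>adag\<close> one order higher, with the second
    derivative bounded through \<open>D\<close>.\<close>
  define E where "E = 2 * (D + J2 * (1 + D) + 1 + 2 * J2\<^sup>2)"
  have E: "E > 0" unfolding E_def using D(1) J by (intro mult_pos_pos add_nonneg_pos add_nonneg_nonneg) (auto intro!: add_pos_nonneg)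
  \<comment> \<open>With this weight the terms in \<open>dbar u\<close> on the right add up to half
    of its norm and are absorbed.\<close>
  define s where "s = 2 * (E / 2 + J)"
  have s: "s > 0" using E J by (simp add: s_def)
  have "cut_norm2 R (Suc j) (dbar u) \<le> (2 * (s / 2 + J * s)) * cut_norm2 R j u" if R: "R \<ge> 2" for R
  proof -
    define X where "X = cut_norm2 R j u"
    define X' where "X' = cut_norm2 R (Suc j) (dbar u)"
    define X'' where "X'' = cut_norm2 R (Suc (Suc j)) (dbar (dbar u))"
    define Y where "Y = cut_norm2 R (Suc (Suc j)) (adag (dbar u))"
    have X: "X \<ge> 0" "X' \<ge> 0" by (simp_all add: X_def X'_def cut_norm2_nonneg)
    have X'': "X'' \<le> D * X'" using D(2)[OF R] by (simp only: X''_def X'_def du add_2_eq_Suc')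
    have "Y \<le> 2 * (X'' + J2 * (X' + X'') + X' + 2 * J2\<^sup>2 * X')"
      using caccioppoli_adag[OF smooth_dbar[OF u(1)] R, of "Suc j" 1]
      unfolding Y_def X''_def X'_def J2_def by simp
    also have "\<dots> \<le> 2 * (D * X' + J2 * (X' + D * X') + X' + 2 * J2\<^sup>2 * X')"
      using X'' J by (intro mult_left_mono add_mono order_refl) auto
    also have "\<dots> = E * X'" by (simp add: E_def algebra_simps)
    finally have Y: "Y \<le> E * X'" .
    have "X' \<le> (s * X + Y / s) / 2 + J * (s * X + X' / s)"
      using caccioppoli_dbar[OF u(1) R u(2) s] unfolding X_def X'_def Y_def J_def by simp
    also have "\<dots> \<le> (s * X + E * X' / s) / 2 + J * (s * X + X' / s)"
      using Y s by (intro add_mono divide_right_mono order_refl) auto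
    also have "\<dots> = (s / 2 + J * s) * X + (E / 2 + J) * X' / s"
      by (simp add: algebra_simps add_divide_distrib)
    also have "(E / 2 + J) * X' / s = X' / 2"
      using s by (simp add: s_def field_simps)
    finally have "X' \<le> 2 * ((s / 2 + J * s) * X)" by linarith
    then show ?thesis by (simp only: X_def X'_def mult.assoc)
  qed
  moreover have "2 * (s / 2 + J * s) \<ge> 0" using s J by simp
  ultimately show ?case unfolding du u_def[symmetric] by blast
qed

lemma chi_LIMSEQ: "(\<lambda>n. chi (real n + 2) z) \<longlonglongrightarrow> 1"
proof -
  have "(\<lambda>n. inverse (real n + 2)) \<longlonglongrightarrow> 0"
    using LIMSEQ_ignore_initial_segment[OF lim_inverse_n, of 2] by (simp add: add.commute)
  then have "(\<lambda>n. (max 0 (1 - (cmod z)\<^sup>2 * (inverse (real n + 2))\<^sup>2))\<^sup>2) \<longlonglongrightarrow> (max 0 (1 - (cmod z)\<^sup>2 * 0\<^sup>2))\<^sup>2"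
    by (intro tendsto_intros)
  then show ?thesis by (simp add: chi_def divide_inverse power_inverse)
qed

text \<open>Fatou's lemma along the radii \<open>n + 2\<close>: the cutoffs tend to one pointwise
  while the bound is uniform in the radius.\<close>

lemma integrable_cut_limit:
  assumes f: "continuous_on UNIV f" and B: "\<And>R. R \<ge> 2 \<Longrightarrow> cut_norm2 R (Suc j) f \<le> B"
  shows "f \<in> L2"
proof -
  have [measurable]: "f \<in> borel_measurable borel" by (rule borel_measurable_continuous[OF f])
  define g where "g n z = (chi (real n + 2) z ^ Suc j * cmod (f z))\<^sup>2" for n z
  have ig: "integrable fock_measure (g n)" for n
    unfolding g_def by (rule integrable_cut[OF f]) auto
  have "(\<integral>\<^sup>+z. ennreal ((cmod (f z))\<^sup>2) \<partial>fock_measure) = (\<integral>\<^sup>+z. liminf (\<lambda>n. ennreal (g n z)) \<partial>fock_measure)"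
  proof (intro nn_integral_cong)
    fix z
    have "(\<lambda>n. g n z) \<longlonglongrightarrow> (1 ^ Suc j * cmod (f z))\<^sup>2"
      unfolding g_def by (intro tendsto_intros chi_LIMSEQ)
    then have "(\<lambda>n. ennreal (g n z)) \<longlonglongrightarrow> ennreal ((cmod (f z))\<^sup>2)"
      by (intro tendsto_ennrealI) simp
    then show "ennreal ((cmod (f z))\<^sup>2) = liminf (\<lambda>n. ennreal (g n z))"
      by (intro lim_imp_Liminf[symmetric]) auto
  qed
  also have "\<dots> \<le> liminf (\<lambda>n. \<integral>\<^sup>+z. ennreal (g n z) \<partial>fock_measure)"
    using ig by (intro nn_integral_liminf) (auto dest: borel_measurable_integrable)
  also have "\<dots> \<le> ennreal B"
  proof -
    have "(\<integral>\<^sup>+z. ennreal (g n z) \<partial>fock_measure) \<le> ennreal B" for n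
      using B[of "real n + 2"] ig
      by (subst nn_integral_eq_integral) (auto simp: g_def[abs_def] cut_norm2_def simp del: power_Suc intro!: ennreal_leI)
    then have "liminf (\<lambda>n. \<integral>\<^sup>+z. ennreal (g n z) \<partial>fock_measure) \<le> liminf (\<lambda>n::nat. ennreal B)"
      by (intro Liminf_mono always_eventually allI)
    also have "\<dots> = ennreal B" by (intro Liminf_const) simp
    finally show ?thesis .
  qed
  finally have "(\<integral>\<^sup>+z. ennreal ((cmod (f z))\<^sup>2) \<partial>fock_measure) < \<infinity>"
    using ennreal_less_top[of B] by (simp add: le_less_trans)
  then show ?thesis
    unfolding L2_iff by (auto simp: integrable_iff_bounded)
qed

text \<open>The truncated \<open>n - 1\<close> is right at \<open>n = 0\<close> as well, where the
  space contains only zero.\<close>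

lemma
  assumes f: "f \<in> poly_fock n"
  shows poly_fock_dbar: "dbar f \<in> poly_fock (n - 1)"
    and poly_fock_adag_L2: "adag f \<in> L2"
proof -
  have sm: "smooth f" "smooth (dbar f)" "smooth (adag f)"
    by (intro smooth_dbar smooth_adag poly_fockD(2)[OF f])+
  note cont = smooth_continuous_on[OF sm(1)] smooth_continuous_on[OF sm(2)] smooth_continuous_on[OF sm(3)]
  have L: "f \<in> L2" by (rule poly_fockD[OF f])
  obtain C where C: "C \<ge> 0" "\<And>R. R \<ge> 2 \<Longrightarrow> cut_norm2 R 1 (dbar f) \<le> C * cut_norm2 R 0 f"
  proof (cases "n = 0")
    case True
    then have "f = (\<lambda>_. 0)" using poly_fockD(3)[OF f] by simp
    then show ?thesis using that[of 0] by (simp add: cut_norm2_def dbar_zero)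
  next
    case False
    then show ?thesis using poly_fock_dbar_bound[OF f, of 0] that by auto
  qed
  \<comment> \<open>With exponent zero the cutoff disappears from the right-hand sides, so the
    bounds no longer depend on \<open>R\<close>.\<close>
  define N where "N = (LINT z|fock_measure. (cmod (f z))\<^sup>2)"
  have N: "cut_norm2 R 0 f = N" for R by (simp add: cut_norm2_def N_def)
  have "dbar f \<in> L2"
    by (rule integrable_cut_limit[of _ 0 "C * N"]) (use cont C N in auto)
  moreover have "(dbar ^^ (n - 1)) (dbar f) z = 0" for z
  proof (cases n)
    case 0
    then show ?thesis using poly_fockD(3)[OF f] by (simp add: dbar_zero)
  next
    case (Suc m)
    then show ?thesis using poly_fockD(3)[OF f] by (simp add: funpow_swap1 del: funpow.simps) (simp add: funpow_swap1)
  qed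
  ultimately show "dbar f \<in> poly_fock (n - 1)"
    using sm by (simp add: poly_fock_def)
  have "cut_norm2 R 1 (adag f) \<le> 2 * (C * N + (N + C * N) + N + 2 * N)" if "R \<ge> 2" for R
    using caccioppoli_adag[OF sm(1) that, of 0 1] L C(2)[OF that] by (simp add: N)
  then show "adag f \<in> L2"
    by (intro integrable_cut_limit[of _ 0] cont) auto
qed

lemma dbar_funpow_add:
  assumes "smooth f" "smooth g"
  shows "(dbar ^^ j) (\<lambda>z. f z + g z) = (\<lambda>z. (dbar ^^ j) f z + (dbar ^^ j) g z)"
proof (induction j)
  case (Suc j)
  then show ?case
    by (auto simp: wirtinger_add smooth_differentiable smooth_dbar_funpow assms)
qed simp

lemma dbar_funpow_cmult:
  assumes "smooth f"
  shows "(dbar ^^ j) (\<lambda>z. c * f z) = (\<lambda>z. c * (dbar ^^ j) f z)"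
proof (induction j)
  case (Suc j)
  then show ?case
    by (auto simp: wirtinger_cmult smooth_differentiable smooth_dbar_funpow assms)
qed simp

text \<open>Iterated commutation relation; at \<open>j = 0\<close> the factor
  \<open>of_nat j\<close> removes the term with the truncated exponent.\<close>

lemma dbar_funpow_adag:
  assumes "smooth f"
  shows "(dbar ^^ j) (adag f) = (\<lambda>z. adag ((dbar ^^ j) f) z + of_nat j * (dbar ^^ (j - 1)) f z)"
proof (induction j)
  case (Suc j)
  have sm: "smooth ((dbar ^^ i) f)" for i by (rule smooth_dbar_funpow[OF assms])
  have "(dbar ^^ Suc j) (adag f) z = dbar (adag ((dbar ^^ j) f)) z + of_nat j * dbar ((dbar ^^ (j - 1)) f) z" for z
    unfolding funpow.simps o_apply Suc
    by (simp add: wirtinger_add wirtinger_cmult smooth_differentiable smooth_adag smooth_cmult sm)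
  moreover have "of_nat j * dbar ((dbar ^^ (j - 1)) f) z = of_nat j * (dbar ^^ j) f z" for z
    by (cases j) simp_all
  ultimately show ?case
    by (auto simp: dbar_adag[OF sm] algebra_simps)
qed simp

lemma poly_fock_adag:
  assumes f: "f \<in> poly_fock n"
  shows "adag f \<in> poly_fock (Suc n)"
proof -
  note sm = poly_fockD(2)[OF f]
  have z: "dz (\<lambda>_. 0) = (\<lambda>_. 0)" by (auto simp: wirtinger_const)
  have "(dbar ^^ Suc n) (adag f) = (\<lambda>_. 0)"
    unfolding dbar_funpow_adag[OF sm] using poly_fockD(3)[OF f]
    by (simp add: dbar_zero adag_def z)
  then show ?thesis
    using poly_fock_adag_L2[OF f] smooth_adag[OF sm] unfolding poly_fock_def by auto
qed

section \<open>The ladder of true polyanalytic Fock spaces\<close>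

lemma L2_add: assumes "f \<in> L2" "g \<in> L2" shows "(\<lambda>z. f z + g z) \<in> L2"
proof -
  note [measurable] = L2_measurable[OF assms(1)] L2_measurable[OF assms(2)]
  have "integrable fock_measure (\<lambda>z. 2 * (cmod (f z))\<^sup>2 + 2 * (cmod (g z))\<^sup>2)"
    using assms by (simp add: L2_integrable)
  then have "integrable fock_measure (\<lambda>z. (cmod (f z + g z))\<^sup>2)"
  proof (rule Bochner_Integration.integrable_bound)
    have "(cmod (f z + g z))\<^sup>2 \<le> 2 * (cmod (f z))\<^sup>2 + 2 * (cmod (g z))\<^sup>2" for z
    proof -
      have "(cmod (f z + g z))\<^sup>2 \<le> (cmod (f z) + cmod (g z))\<^sup>2"
        by (intro power_mono norm_triangle_ineq) auto
      also have "\<dots> \<le> 2 * (cmod (f z))\<^sup>2 + 2 * (cmod (g z))\<^sup>2"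
        using zero_le_power2[of "cmod (f z) - cmod (g z)"] by (simp add: power2_eq_square algebra_simps)
      finally show ?thesis .
    qed
    then show "AE z in fock_measure. norm ((cmod (f z + g z))\<^sup>2) \<le> norm (2 * (cmod (f z))\<^sup>2 + 2 * (cmod (g z))\<^sup>2)"
      by (intro AE_I2) (simp add: abs_of_nonneg)
  qed measurable
  then show ?thesis by (simp add: L2_iff)
qed

lemma L2_cmult: "f \<in> L2 \<Longrightarrow> (\<lambda>z. c * f z) \<in> L2"
  by (auto simp: L2_iff norm_mult power_mult_distrib intro!: borel_measurable_times)

lemma L2_diff: "f \<in> L2 \<Longrightarrow> g \<in> L2 \<Longrightarrow> (\<lambda>z. f z - g z) \<in> L2"
  using L2_add[of f "\<lambda>z. (-1) * g z"] L2_cmult[of g "-1"] by simp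

lemma measurable_cnj [measurable]: "cnj \<in> borel_measurable borel"
  by (intro borel_measurable_continuous_onI continuous_intros)

lemma ip_integrable:
  assumes "f \<in> L2" "g \<in> L2"
  shows "integrable fock_measure (\<lambda>z. f z * cnj (g z))"
proof -
  note [measurable] = L2_measurable[OF assms(1)] L2_measurable[OF assms(2)]
  have m: "(\<lambda>z. f z * cnj (g z)) \<in> borel_measurable borel" by measurable
  have le: "cmod (f z * cnj (g z)) \<le> 1 * (cmod (f z) * cmod (g z))" for z by (simp add: norm_mult)
  show ?thesis
    by (rule integral_norm_le_AMGM(1)[OF m L2_integrable[OF assms(1)] L2_integrable[OF assms(2)] le zero_le_one zero_less_one])
qed

lemma ip_add_left: "f \<in> L2 \<Longrightarrow> g \<in> L2 \<Longrightarrow> h \<in> L2 \<Longrightarrow> ip (\<lambda>z. f z + g z) h = ip f h + ip g h"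
  by (simp add: ip_def ip_integrable distrib_right)

lemma ip_cmult_left: "ip (\<lambda>z. c * f z) g = c * ip f g"
  by (simp add: ip_def mult.assoc)

lemma ip_diff_left: "f \<in> L2 \<Longrightarrow> g \<in> L2 \<Longrightarrow> h \<in> L2 \<Longrightarrow> ip (\<lambda>z. f z - g z) h = ip f h - ip g h"
  by (simp add: ip_def ip_integrable left_diff_distrib)

lemma ip_cnj: "ip f g = cnj (ip g f)"
  unfolding ip_def Bochner_Integration.integral_cnj[symmetric] by (simp add: mult.commute)

lemma ip_cmult_right: "ip f (\<lambda>z. c * g z) = cnj c * ip f g"
  by (subst (1 2) ip_cnj) (simp add: ip_cmult_left)

lemma ip_add_right: "f \<in> L2 \<Longrightarrow> g \<in> L2 \<Longrightarrow> h \<in> L2 \<Longrightarrow> ip h (\<lambda>z. f z + g z) = ip h f + ip h g"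
  by (subst (1 2 3) ip_cnj) (simp add: ip_add_left)

lemma ip_zero: "ip (\<lambda>_. 0) g = 0" "ip g (\<lambda>_. 0) = 0"
  by (simp_all add: ip_def)

text \<open>Vanishing almost everywhere becomes vanishing everywhere because a nonempty open set is
  not negligible. This is where working with continuous representatives pays off.\<close>

lemma ip_self_eq_0:
  assumes f: "f \<in> L2" and c: "continuous_on UNIV f" and 0: "ip f f = 0"
  shows "f = (\<lambda>_. 0)"
proof -
  have "ip f f = of_real (LINT z|fock_measure. (cmod (f z))\<^sup>2)"
    unfolding ip_def integral_complex_of_real[symmetric] complex_norm_square[symmetric] of_real_power ..
  with 0 have "(LINT z|fock_measure. (cmod (f z))\<^sup>2) = 0" by simp
  then have "AE z in fock_measure. (cmod (f z))\<^sup>2 = 0"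
    using L2_integrable[OF f] by (subst (asm) integral_nonneg_eq_0_iff_AE) auto
  then have ae: "AE z in lborel. f z = 0" by (simp add: AE_fock_iff)
  have "f z = 0" for z
  proof (rule ccontr)
    assume "f z \<noteq> 0"
    have "open (f -` (- {0}))"
      using c by (intro open_vimage) (auto simp: open_Compl)
    moreover have "f -` (- {0}) \<noteq> {}" using \<open>f z \<noteq> 0\<close> by auto
    moreover have "f -` (- {0}) \<in> null_sets lborel"
      using ae \<open>open (f -` (- {0}))\<close> by (subst (asm) AE_iff_null) (auto simp: vimage_def Compl_eq)
    ultimately show False
      using open_not_negligible by (metis null_sets_completionI negligible_iff_null_sets)
  qed
  then show ?thesis by auto
qed

text \<open>Removes the cutoff from \<open>weighted_adjoint\<close>: the main terms converge by
  dominated convergence, and the error term vanishes because \<open>dbar\<close> of the cutoff tends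
  to zero.\<close>

lemma ip_adjoint:
  assumes u: "smooth u" "u \<in> L2" "dbar u \<in> L2" and v: "smooth v" "v \<in> L2" "adag v \<in> L2"
  shows "ip (dbar u) v = ip u (adag v)"
proof -
  define c where "c n z = complex_of_real (chi (real n + 2) z)" for n z
  have R: "real n + 2 > 0" "real n + 2 \<ge> 2" for n by auto
  have sm: "smooth (dbar u)" "smooth (adag v)" by (intro smooth_dbar smooth_adag u v)+
  have cC: "C_n 1 (c n)" for n unfolding c_def by (intro C_n_chi R)
  have cm[measurable]: "c n \<in> borel_measurable borel" "dbar (c n) \<in> borel_measurable borel" for n
    using C_n_1_wirtinger[OF cC] by (auto intro: borel_measurable_continuous)
  have c1: "cmod (c n z) \<le> 1" for n z using chi_bounds[of "real n + 2" z] by (simp add: c_def)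
  have c2: "(\<lambda>n. c n z) \<longlonglongrightarrow> 1" for z
    unfolding c_def using tendsto_of_real[OF chi_LIMSEQ[of z], where 'a = complex] by simp
  have d1: "cmod (dbar (c n) z) \<le> 2 / (real n + 2)" for n z
    unfolding c_def[abs_def] using dbar_chi_bound[OF R(2)] .
  have d1': "cmod (dbar (c n) z) \<le> 1" for n z
    using d1[of n z] by (rule order_trans) simp
  have d2: "(\<lambda>n. dbar (c n) z) \<longlonglongrightarrow> 0" for z
  proof (rule Lim_null_comparison)
    show "(\<lambda>n. 2 / (real n + 2)) \<longlonglongrightarrow> 0"
      using LIMSEQ_ignore_initial_segment[OF tendsto_mult_left[OF lim_inverse_n, of 2], of 2]
      by (simp add: add.commute divide_inverse)
  qed (use d1 in auto)
  note [measurable] = L2_measurable[OF u(2)] L2_measurable[OF u(3)] L2_measurable[OF v(2)] L2_measurable[OF v(3)]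
  have lim: "(\<lambda>n. LINT z|fock_measure. b n z * F z) \<longlonglongrightarrow> (LINT z|fock_measure. l * F z)"
    if F: "integrable fock_measure F" and b: "\<And>n. b n \<in> borel_measurable borel" "\<And>n z. cmod (b n z) \<le> 1" "\<And>z. (\<lambda>n. b n z) \<longlonglongrightarrow> l"
    for b F l
  proof (rule integral_dominated_convergence[where w = "\<lambda>z. cmod (F z)"])
    have [measurable]: "F \<in> borel_measurable borel" using borel_measurable_integrable[OF F] by simp
    note [measurable] = b(1)
    show "(\<lambda>z. l * F z) \<in> borel_measurable fock_measure" "\<And>n. (\<lambda>z. b n z * F z) \<in> borel_measurable fock_measure"
      by simp_all
    show "AE z in fock_measure. (\<lambda>n. b n z * F z) \<longlonglongrightarrow> l * F z"
      by (intro AE_I2 tendsto_intros b)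
    show "AE z in fock_measure. norm (b n z * F z) \<le> cmod (F z)" for n
      using b(2)[of n] by (intro AE_I2) (simp add: norm_mult mult_left_le_one_le)
  qed (use F in auto)
  have A: "(\<lambda>n. LINT z|fock_measure. c n z * (dbar u z * cnj (v z))) \<longlonglongrightarrow> (LINT z|fock_measure. 1 * (dbar u z * cnj (v z)))"
    by (rule lim[OF ip_integrable[OF u(3) v(2)] cm(1) c1 c2])
  have B: "(\<lambda>n. LINT z|fock_measure. dbar (c n) z * (u z * cnj (v z))) \<longlonglongrightarrow> (LINT z|fock_measure. 0 * (u z * cnj (v z)))"
    by (rule lim[OF ip_integrable[OF u(2) v(2)] cm(2) d1' d2])
  have C: "(\<lambda>n. LINT z|fock_measure. c n z * (u z * cnj (adag v z))) \<longlonglongrightarrow> (LINT z|fock_measure. 1 * (u z * cnj (adag v z)))"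
    by (rule lim[OF ip_integrable[OF u(2) v(3)] cm(1) c1 c2])
  have eq: "(LINT z|fock_measure. c n z * (dbar u z * cnj (v z))) + (LINT z|fock_measure. dbar (c n) z * (u z * cnj (v z)))
      = (LINT z|fock_measure. c n z * (u z * cnj (adag v z)))" for n
    using weighted_adjoint[OF cC _ smooth_C_n[OF u(1)] smooth_C_n[OF v(1)], of "real n + 2" n] chi_zero[OF _ R(1)]
    by (simp add: mult.assoc c_def)
  have "(LINT z|fock_measure. 1 * (dbar u z * cnj (v z))) + (LINT z|fock_measure. 0 * (u z * cnj (v z)))
      = (LINT z|fock_measure. 1 * (u z * cnj (adag v z)))"
    by (rule LIMSEQ_unique[OF tendsto_add[OF A B] C[folded eq]])
  then show ?thesis by (simp add: ip_def)
qed

section \<open>Linear structure and nesting of the polyanalytic spaces\<close>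

lemma poly_fock_add: "f \<in> poly_fock n \<Longrightarrow> g \<in> poly_fock n \<Longrightarrow> (\<lambda>z. f z + g z) \<in> poly_fock n"
  by (simp add: poly_fock_def L2_add smooth_add dbar_funpow_add)

lemma poly_fock_cmult: "f \<in> poly_fock n \<Longrightarrow> (\<lambda>z. c * f z) \<in> poly_fock n"
  by (simp add: poly_fock_def L2_cmult smooth_cmult dbar_funpow_cmult)

lemma poly_fock_diff: "f \<in> poly_fock n \<Longrightarrow> g \<in> poly_fock n \<Longrightarrow> (\<lambda>z. f z - g z) \<in> poly_fock n"
  using poly_fock_add[of f n "\<lambda>z. (-1) * g z"] poly_fock_cmult[of g n "-1"] by simp

lemma poly_fock_0: "poly_fock 0 = {\<lambda>_. 0}"
  by (auto simp: poly_fock_def L2_iff smooth_const)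

lemma zero_in_poly_fock: "(\<lambda>_. 0) \<in> poly_fock n"
  by (simp add: poly_fock_def L2_iff smooth_const dbar_funpow_zero)

lemma poly_fock_mono:
  assumes "m \<le> n" shows "poly_fock m \<subseteq> poly_fock n"
proof
  fix f assume f: "f \<in> poly_fock m"
  have "(dbar ^^ n) f = (dbar ^^ (n - m)) ((dbar ^^ m) f)"
    using assms by (metis comp_apply funpow_add le_add_diff_inverse2)
  then show "f \<in> poly_fock n"
    using poly_fockD[OF f] by (simp add: poly_fock_def dbar_funpow_zero)
qed

text \<open>The separate clause for level one merges with the general one because
  \<open>poly_fock 0\<close> contains only zero.\<close>

lemma true_fock_iff:
  "f \<in> true_fock (Suc m) \<longleftrightarrow> f \<in> poly_fock (Suc m) \<and> (\<forall>g\<in>poly_fock m. ip f g = 0)"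
  by (auto simp: true_fock_def poly_fock_0 ip_zero)

lemma true_fock_poly_fock: "f \<in> true_fock (Suc m) \<Longrightarrow> f \<in> poly_fock (Suc m)"
  by (simp add: true_fock_iff)

lemma true_fock_add: "f \<in> true_fock (Suc m) \<Longrightarrow> g \<in> true_fock (Suc m) \<Longrightarrow> (\<lambda>z. f z + g z) \<in> true_fock (Suc m)"
  unfolding true_fock_iff by (auto intro: poly_fock_add simp: ip_add_left[OF poly_fockD(1) poly_fockD(1) poly_fockD(1)])

lemma true_fock_cmult: "f \<in> true_fock (Suc m) \<Longrightarrow> (\<lambda>z. c * f z) \<in> true_fock (Suc m)"
  unfolding true_fock_iff by (auto intro: poly_fock_cmult simp: ip_cmult_left)

lemma zero_in_true_fock: "(\<lambda>_. 0) \<in> true_fock (Suc m)"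
  unfolding true_fock_iff by (auto intro: zero_in_poly_fock simp: ip_zero)

lemma true_fock_orthogonal: "f \<in> true_fock (Suc m) \<Longrightarrow> g \<in> poly_fock n \<Longrightarrow> n \<le> m \<Longrightarrow> ip f g = 0"
  using poly_fock_mono[of n m] by (auto simp: true_fock_iff)

lemma ip_adjoint_poly_fock:
  assumes "u \<in> poly_fock m" "v \<in> poly_fock n"
  shows "ip (dbar u) v = ip u (adag v)"
  using poly_fockD[OF assms(1)] poly_fockD[OF assms(2)] poly_fockD[OF poly_fock_dbar[OF assms(1)]]
    poly_fockD[OF poly_fock_adag[OF assms(2)]]
  by (intro ip_adjoint)

text \<open>Moving \<open>dbar\<close> to the test function turns it into \<open>adag\<close>, which
  raises its order by only one, still within the range of orthogonality of \<open>f\<close>.\<close>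

lemma true_fock_dbar:
  assumes f: "f \<in> true_fock (Suc (Suc m))"
  shows "dbar f \<in> true_fock (Suc m)"
  unfolding true_fock_iff
proof safe
  show "dbar f \<in> poly_fock (Suc m)" using poly_fock_dbar[OF true_fock_poly_fock[OF f]] by simp
  fix g assume g: "g \<in> poly_fock m"
  then show "ip (dbar f) g = 0"
    using ip_adjoint_poly_fock[OF true_fock_poly_fock[OF f] g] poly_fock_adag[OF g] true_fock_orthogonal[OF f] by simp
qed

lemma true_fock_adag:
  assumes f: "f \<in> true_fock (Suc m)"
  shows "adag f \<in> true_fock (Suc (Suc m))"
  unfolding true_fock_iff
proof safe
  show "adag f \<in> poly_fock (Suc (Suc m))" by (rule poly_fock_adag[OF true_fock_poly_fock[OF f]])
  fix g assume g: "g \<in> poly_fock (Suc m)"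
  have "ip g (adag f) = ip (dbar g) f" using ip_adjoint_poly_fock[OF g true_fock_poly_fock[OF f]] by simp
  also have "\<dots> = cnj (ip f (dbar g))" by (rule ip_cnj)
  also have "\<dots> = 0" using true_fock_orthogonal[OF f, of "dbar g" m] poly_fock_dbar[OF g] by simp
  finally show "ip (adag f) g = 0" by (subst ip_cnj) simp
qed

lemma adag_cmult: "smooth f \<Longrightarrow> adag (\<lambda>z. c * f z) = (\<lambda>z. c * adag f z)"
  by (auto simp: adag_def wirtinger_cmult smooth_differentiable algebra_simps)

text \<open>The defect \<open>u\<close> of the eigenvalue equation stays on the level of
  \<open>f\<close>. By the commutation relation and the induction hypothesis for
  \<open>dbar f\<close> it is also analytic, hence orthogonal to itself.\<close>

lemma adag_dbar_true_fock: "f \<in> true_fock (Suc m) \<Longrightarrow> adag (dbar f) = (\<lambda>z. of_nat m * f z)"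
proof (induction m arbitrary: f)
  case 0
  then have "dbar f = (\<lambda>_. 0)" by (auto simp: true_fock_iff poly_fock_def)
  then show ?case by (auto simp: adag_def wirtinger_const)
next
  case (Suc m)
  note f = Suc.prems
  note df = true_fock_dbar[OF f]
  have sm: "smooth f" "smooth (dbar f)"
    using poly_fockD(2) true_fock_poly_fock[OF f] true_fock_poly_fock[OF df] by blast+
  define u where "u z = adag (dbar f) z - of_nat (Suc m) * f z" for z
  have "adag (dbar f) \<in> true_fock (Suc (Suc m))" by (rule true_fock_adag[OF df])
  with true_fock_cmult[OF f, of "- of_nat (Suc m)"]
  have "(\<lambda>z. adag (dbar f) z + (- of_nat (Suc m)) * f z) \<in> true_fock (Suc (Suc m))" by (rule true_fock_add[rotated])
  then have u: "u \<in> true_fock (Suc (Suc m))" by (simp add: u_def[abs_def] del: of_nat_Suc)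
  have "dbar u z = dbar (adag (dbar f)) z - of_nat (Suc m) * dbar f z" for z
    unfolding u_def[abs_def] using sm
    by (simp add: wirtinger_diff wirtinger_cmult smooth_differentiable smooth_adag smooth_cmult)
  then have "dbar u z = 0" for z
    using fun_cong[OF Suc.IH[OF df], of z] by (simp add: dbar_adag[OF sm(2)] distrib_right)
  then have "u \<in> poly_fock 1"
    using poly_fockD[OF true_fock_poly_fock[OF u]] by (auto simp: poly_fock_def)
  then have "ip u u = 0" by (intro true_fock_orthogonal[OF u]) auto
  then have "u = (\<lambda>_. 0)"
    using poly_fockD[OF true_fock_poly_fock[OF u]] smooth_continuous_on by (intro ip_self_eq_0) auto
  then show ?case by (auto simp: u_def fun_eq_iff)
qed

lemma true_fock_dbar_funpow:
  "f \<in> true_fock (Suc m) \<Longrightarrow> l \<le> m \<Longrightarrow> (dbar ^^ l) f \<in> true_fock (Suc (m - l))"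
proof (induction l)
  case (Suc l)
  then have "(dbar ^^ l) f \<in> true_fock (Suc (Suc (m - Suc l)))" by (simp add: Suc_diff_Suc)
  then show ?case using true_fock_dbar by simp
qed simp

text \<open>Each step moves one \<open>dbar\<close> across and meets the eigenvalue
  \<open>m - l\<close> of \<open>adag (dbar _)\<close>; the product is a falling factorial.\<close>

lemma ip_dbar_funpow:
  assumes "f \<in> true_fock (Suc m)" "g \<in> true_fock (Suc m)" "l \<le> m"
  shows "ip ((dbar ^^ l) f) ((dbar ^^ l) g) = of_real (fact m / fact (m - l)) * ip f g"
  using assms(3)
proof (induction l)
  case (Suc l)
  let ?f = "(dbar ^^ l) f" and ?g = "(dbar ^^ l) g"
  have f: "?f \<in> true_fock (Suc (m - l))" and g: "?g \<in> true_fock (Suc (m - l))"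
    using assms Suc.prems by (auto intro!: true_fock_dbar_funpow)
  have "ip (dbar ?f) (dbar ?g) = ip ?f (adag (dbar ?g))"
    using poly_fock_dbar true_fock_poly_fock f g by (intro ip_adjoint_poly_fock) blast+
  also have "\<dots> = of_nat (m - l) * ip ?f ?g"
    by (simp add: adag_dbar_true_fock[OF g] ip_cmult_right)
  also have "\<dots> = of_nat (m - l) * of_real (fact m / fact (m - l)) * ip f g"
    using Suc by simp
  also have "of_nat (m - l) * complex_of_real (fact m / fact (m - l)) = of_real (fact m / fact (m - Suc l))"
  proof -
    have "m - l = Suc (m - Suc l)" using Suc.prems by simp
    then have "fact (m - l) = real (m - l) * fact (m - Suc l)" by (metis fact_Suc of_nat_fact of_nat_mult)
    moreover have "real (m - l) \<noteq> 0" using Suc.prems by simp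
    ultimately have "real (m - l) * (fact m / fact (m - l)) = fact m / fact (m - Suc l)" by simp
    then show ?thesis by (metis of_real_mult of_real_of_nat_eq)
  qed
  finally show ?case by simp
qed simp

text \<open>Different powers land on different levels, and the higher level is orthogonal to the
  polyanalytic space containing the lower one.\<close>

lemma ip_dbar_funpow_neq:
  assumes f: "f \<in> true_fock (Suc m)" and g: "g \<in> true_fock (Suc m)" and "l \<le> m" "l' \<le> m" "l \<noteq> l'"
  shows "ip ((dbar ^^ l) f) ((dbar ^^ l') g) = 0"
proof (cases "l < l'")
  case True
  then show ?thesis
    using true_fock_orthogonal[OF true_fock_dbar_funpow[OF f], of l "(dbar ^^ l') g" "Suc (m - l')"]
      true_fock_poly_fock[OF true_fock_dbar_funpow[OF g, of l']] assms by simp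
next
  case False
  then have "ip ((dbar ^^ l') g) ((dbar ^^ l) f) = 0"
    using true_fock_orthogonal[OF true_fock_dbar_funpow[OF g], of l' "(dbar ^^ l) f" "Suc (m - l)"]
      true_fock_poly_fock[OF true_fock_dbar_funpow[OF f, of l]] assms by simp
  then show ?thesis by (subst ip_cnj) simp
qed

section \<open>Translations generated by the ladder operators\<close>

text \<open>The condition \<open>gauss\<close> says that the squared modulus of the weight is the
  density ratio of the translated Gaussian, so translation invariance of Lebesgue measure gives an
  isometry. It serves the Weyl operators and \<open>dshift\<close> alike.\<close>

lemma
  fixes E :: "complex \<Rightarrow> complex"
  assumes E: "continuous_on UNIV E" and gauss: "\<And>w. (cmod (E w))\<^sup>2 * gw w = gw (w + c)"
  shows ip_weighted_shift: "f \<in> borel_measurable borel \<Longrightarrow> g \<in> borel_measurable borel \<Longrightarrow>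
      ip (\<lambda>w. E w * f (w + c)) (\<lambda>w. E w * g (w + c)) = ip f g"
    and L2_weighted_shift: "f \<in> L2 \<Longrightarrow> (\<lambda>w. E w * f (w + c)) \<in> L2"
    and norm_weighted_shift: "f \<in> L2 \<Longrightarrow>
      (LINT w|fock_measure. (cmod (E w * f (w + c)))\<^sup>2) = (LINT w|fock_measure. (cmod (f w))\<^sup>2)"
proof -
  have [measurable]: "E \<in> borel_measurable borel" by (rule borel_measurable_continuous[OF E])
  {
    assume [measurable]: "f \<in> borel_measurable borel" "g \<in> borel_measurable borel"
    have "gw w *\<^sub>R ((E w * f (w + c)) * cnj (E w * g (w + c))) = gw (w + c) *\<^sub>R (f (w + c) * cnj (g (w + c)))" for w
    proof -
      have "of_real (gw (w + c)) = E w * cnj (E w) * of_real (gw w)"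
        by (simp only: gauss[symmetric] of_real_mult complex_norm_square)
      then show ?thesis by (simp add: scaleR_conv_of_real mult_ac)
    qed
    then show "ip (\<lambda>w. E w * f (w + c)) (\<lambda>w. E w * g (w + c)) = ip f g"
      unfolding ip_def by (subst (1 2) integral_fock_eq)
        (simp_all add: integral_lborel_shift[of "\<lambda>w. gw w *\<^sub>R (f w * cnj (g w))" c])
  }
  have eq: "gw w *\<^sub>R (cmod (E w * f (w + c)))\<^sup>2 = gw (w + c) *\<^sub>R (cmod (f (w + c)))\<^sup>2" for w f
    by (simp add: gauss[symmetric] norm_mult power_mult_distrib mult_ac)
  assume f: "f \<in> L2"
  note [measurable] = L2_measurable[OF f]
  show "(\<lambda>w. E w * f (w + c)) \<in> L2"
    using f eq[of _ f] unfolding L2_iff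
    by (simp add: integrable_fock_iff integrable_lborel_shift[of "\<lambda>w. gw w *\<^sub>R (cmod (f w))\<^sup>2" c, simplified])
  show "(LINT w|fock_measure. (cmod (E w * f (w + c)))\<^sup>2) = (LINT w|fock_measure. (cmod (f w))\<^sup>2)"
    using eq[of _ f] by (subst (1 2) integral_fock_eq)
      (simp_all add: integral_lborel_shift[of "\<lambda>w. gw w *\<^sub>R (cmod (f w))\<^sup>2" c, simplified])
qed

text \<open>
  \<open>dshift \<xi> t\<close> is \<open>exp (t (\<xi>\<^sup>* a - \<xi> a\<^sup>\<dagger>))\<close> in closed form, and \<open>dgen \<xi>\<close> below is its generator.
\<close>

definition dfac :: "complex \<Rightarrow> real \<Rightarrow> complex \<Rightarrow> complex" where
  "dfac \<xi> t w = exp (- (of_real t * \<xi> * cnj w) - of_real (t\<^sup>2 * (cmod \<xi>)\<^sup>2 / 2))"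

definition dshift :: "complex \<Rightarrow> real \<Rightarrow> (complex \<Rightarrow> complex) \<Rightarrow> complex \<Rightarrow> complex" where
  "dshift \<xi> t g w = dfac \<xi> t w * g (w + of_real t * \<xi>)"

lemma dfac_gauss: "(cmod (dfac \<xi> t w))\<^sup>2 * gw w = gw (w + of_real t * \<xi>)"
proof -
  have "(cmod (dfac \<xi> t w))\<^sup>2 = exp (2 * Re (- (of_real t * \<xi> * cnj w) - of_real (t\<^sup>2 * (cmod \<xi>)\<^sup>2 / 2)))"
    unfolding dfac_def by (simp only: norm_exp_eq_Re exp_double)
  then have "(cmod (dfac \<xi> t w))\<^sup>2 * gw w =
     exp (2 * Re (- (of_real t * \<xi> * cnj w) - of_real (t\<^sup>2 * (cmod \<xi>)\<^sup>2 / 2)) - (cmod w)\<^sup>2) / pi"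
    by (simp only: gw_def exp_add[symmetric] times_divide_eq_right diff_conv_add_uminus)
  also have "2 * Re (- (of_real t * \<xi> * cnj w) - of_real (t\<^sup>2 * (cmod \<xi>)\<^sup>2 / 2)) - (cmod w)\<^sup>2 = - (cmod (w + of_real t * \<xi>))\<^sup>2"
  proof -
    have "Re (- (of_real t * \<xi> * cnj w) - of_real (t\<^sup>2 * (cmod \<xi>)\<^sup>2 / 2)) =
        - t * (Re \<xi> * Re w + Im \<xi> * Im w) - t\<^sup>2 * (cmod \<xi>)\<^sup>2 / 2"
      by (simp add: distrib_left mult.assoc)
    moreover have "Re (w + of_real t * \<xi>) = Re w + t * Re \<xi>" "Im (w + of_real t * \<xi>) = Im w + t * Im \<xi>"
      by simp_all
    ultimately show ?thesis
      unfolding cmod_power2 by (simp add: power2_eq_square algebra_simps)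
  qed
  finally show ?thesis by (simp add: gw_def)
qed

lemma smooth_dfac: "smooth (dfac \<xi> t)"
proof -
  have "dfac \<xi> t = (\<lambda>w. exp (- of_real (t\<^sup>2 * (cmod \<xi>)\<^sup>2 / 2)) * cnj (exp ((- of_real t * cnj \<xi>) * w)))"
    unfolding dfac_def exp_cnj exp_add[symmetric] by (intro ext arg_cong[where f = exp]) simp
  then show ?thesis by (simp only:) (intro smooth_cmult smooth_cnj smooth_exp)
qed

lemma dz_dfac: "dz (dfac \<xi> t) w = 0"
proof -
  have eq: "dfac \<xi> t = (\<lambda>w. cnj (exp ((- of_real t * cnj \<xi>) * w - of_real (t\<^sup>2 * (cmod \<xi>)\<^sup>2 / 2))))"
    unfolding dfac_def exp_cnj by (intro ext arg_cong[where f = exp]) simp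
  have "((\<lambda>w. exp ((- of_real t * cnj \<xi>) * w - of_real (t\<^sup>2 * (cmod \<xi>)\<^sup>2 / 2))) has_field_derivative
     exp ((- of_real t * cnj \<xi>) * w - of_real (t\<^sup>2 * (cmod \<xi>)\<^sup>2 / 2)) * (- of_real t * cnj \<xi>)) (at w)"
    by (auto intro!: derivative_eq_intros)
  note h = wirtinger_holo(2)[OF this] this
  have "(\<lambda>w. exp ((- of_real t * cnj \<xi>) * w - of_real (t\<^sup>2 * (cmod \<xi>)\<^sup>2 / 2))) differentiable (at w)"
    using h(2) by (auto simp: differentiable_def has_field_derivative_def)
  from wirtinger_cnj(1)[OF this] show ?thesis unfolding eq by (simp only: h(1) complex_cnj_zero)
qed

lemma smooth_dshift: "smooth g \<Longrightarrow> smooth (dshift \<xi> t g)"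
  unfolding dshift_def[abs_def] by (intro smooth_mult smooth_dfac smooth_shift)

lemma L2_dshift: "g \<in> L2 \<Longrightarrow> dshift \<xi> t g \<in> L2"
  and norm_dshift: "g \<in> L2 \<Longrightarrow>
    (LINT w|fock_measure. (cmod (dshift \<xi> t g w))\<^sup>2) = (LINT w|fock_measure. (cmod (g w))\<^sup>2)"
  unfolding dshift_def[abs_def]
  by (rule L2_weighted_shift norm_weighted_shift, auto intro: smooth_continuous_on smooth_dfac dfac_gauss)+

lemma dshift_0: "dshift \<xi> 0 g = g"
  by (auto simp: dshift_def dfac_def)

lemma dshift_add: "dshift \<xi> t (\<lambda>z. f z + g z) = (\<lambda>z. dshift \<xi> t f z + dshift \<xi> t g z)"
  and dshift_cmult: "dshift \<xi> t (\<lambda>z. c * f z) = (\<lambda>z. c * dshift \<xi> t f z)"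
  by (auto simp: dshift_def algebra_simps)

text \<open>The antiholomorphic weight passes through \<open>dz\<close>; what remains is the
  difference between \<open>cnj w\<close> and its value at the translated point.\<close>

lemma adag_dshift:
  assumes "smooth g"
  shows "adag (dshift \<xi> t g) = (\<lambda>w. dshift \<xi> t (adag g) w - of_real t * cnj \<xi> * dshift \<xi> t g w)"
proof
  fix w
  have "dz (dshift \<xi> t g) w = dfac \<xi> t w * dz g (w + of_real t * \<xi>)"
    unfolding dshift_def[abs_def]
    by (subst wirtinger_mult(1)) (auto intro: smooth_differentiable smooth_dfac smooth_shift assms
        simp: dz_dfac wirtinger_shift smooth_differentiable assms)
  then show "adag (dshift \<xi> t g) w = dshift \<xi> t (adag g) w - of_real t * cnj \<xi> * dshift \<xi> t g w"
    by (simp add: adag_def dshift_def algebra_simps)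
qed

definition dgen :: "complex \<Rightarrow> (complex \<Rightarrow> complex) \<Rightarrow> complex \<Rightarrow> complex" where
  "dgen \<xi> g = (\<lambda>z. cnj \<xi> * dbar g z + (- \<xi>) * adag g z)"

lemma dgen_poly_fock: "g \<in> poly_fock n \<Longrightarrow> dgen \<xi> g \<in> poly_fock (Suc n)"
proof -
  assume g: "g \<in> poly_fock n"
  have "dbar g \<in> poly_fock (Suc n)" using poly_fock_dbar[OF g] poly_fock_mono[of "n - 1" "Suc n"] by (simp add: subset_iff)
  then show ?thesis unfolding dgen_def by (intro poly_fock_add poly_fock_cmult poly_fock_adag g)
qed

text \<open>Differentiating the weight produces \<open>- \<xi>\<close> times the conjugate of the
  translated point, exactly what completes the term in \<open>dz g\<close> to
  \<open>- \<xi> * adag g\<close> there.\<close>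

lemma has_vector_derivative_dshift:
  assumes g: "smooth g"
  shows "((\<lambda>t. dshift \<xi> t g w) has_vector_derivative dshift \<xi> t (dgen \<xi> g) w) (at t within S)"
proof -
  let ?q = "w + of_real t * \<xi>"
  have "((\<lambda>t. w + of_real t * \<xi>) has_derivative (\<lambda>s. of_real s * \<xi>)) (at t within S)"
    by (auto intro!: derivative_eq_intros)
  from has_derivative_compose[OF this has_derivative_wirtinger[OF smooth_differentiable[OF g]]]
  have 1: "((\<lambda>t. g (w + of_real t * \<xi>)) has_vector_derivative (\<xi> * dz g ?q + cnj \<xi> * dbar g ?q)) (at t within S)"
    unfolding has_vector_derivative_def by (rule has_derivative_eq_rhs) (auto simp: scaleR_conv_of_real algebra_simps)
  have "((\<lambda>t. - (of_real t * \<xi> * cnj w) - of_real (t\<^sup>2 * (cmod \<xi>)\<^sup>2 / 2)) has_vector_derivative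
      (- \<xi> * cnj w - of_real (t * (cmod \<xi>)\<^sup>2))) (at t within S)"
    unfolding has_vector_derivative_def
    by (auto intro!: derivative_eq_intros simp: scaleR_conv_of_real algebra_simps)
  from field_vector_diff_chain_within[OF this DERIV_subset[OF DERIV_exp subset_UNIV]]
  have 2: "((\<lambda>t. dfac \<xi> t w) has_vector_derivative (- \<xi> * cnj w - of_real (t * (cmod \<xi>)\<^sup>2)) * dfac \<xi> t w) (at t within S)"
    by (simp add: o_def dfac_def)
  have "complex_of_real (t * (cmod \<xi>)\<^sup>2) = of_real t * (\<xi> * cnj \<xi>)"
    by (simp only: of_real_mult complex_norm_square)
  then have "dfac \<xi> t w * (\<xi> * dz g ?q + cnj \<xi> * dbar g ?q) + ((- \<xi> * cnj w - of_real (t * (cmod \<xi>)\<^sup>2)) * dfac \<xi> t w) * g ?q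
      = dshift \<xi> t (dgen \<xi> g) w"
    by (simp only:) (simp add: dshift_def dgen_def adag_def algebra_simps)
  with has_vector_derivative_mult[OF 2 1] show ?thesis
    unfolding dshift_def by (simp only:)
qed

lemma continuous_dshift:
  assumes "continuous_on UNIV g"
  shows "continuous_on UNIV (\<lambda>p. dshift \<xi> (fst p) g (snd p))"
  unfolding dshift_def dfac_def
  by (intro continuous_intros continuous_on_compose2[OF assms]) auto

lemma sigma_finite_fock: "sigma_finite_measure fock_measure"
proof -
  have "integrable fock_measure (\<lambda>z. 1 :: real)" using integrable_fock_cmod_power[of 0] by simp
  then have "finite_measure fock_measure"
    by (intro finite_measureI) (auto simp: integrable_iff_bounded)
  then show ?thesis by (rule finite_measure.axioms(1))
qed

text \<open>The derivative in the parameter is taken through the inner product in integrated form: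
  the fundamental theorem at each point, then Fubini. The isometry of \<open>dshift\<close> makes
  the bound \<open>K\<close> uniform in the parameter.\<close>

lemma ip_dshift_diff:
  fixes \<xi> :: complex and a b :: real
  assumes g: "g \<in> poly_fock n" and h: "h \<in> L2" and ab: "a \<le> b"
  defines "K \<equiv> ((LINT z|fock_measure. (cmod (dgen \<xi> g z))\<^sup>2) + (LINT z|fock_measure. (cmod (h z))\<^sup>2)) / 2"
  shows "ip (dshift \<xi> b g) h - ip (dshift \<xi> a g) h = (LINT s|lborel. indicator {a..b} s *\<^sub>R ip (dshift \<xi> s (dgen \<xi> g)) h)"
    and "cmod (ip (dshift \<xi> b g) h - ip (dshift \<xi> a g) h) \<le> K * (b - a)"
proof -
  interpret fock: sigma_finite_measure fock_measure by (rule sigma_finite_fock)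
  interpret P: pair_sigma_finite "lborel :: real measure" fock_measure ..
  define u where "u = dgen \<xi> g"
  have u: "u \<in> L2" "smooth u" "continuous_on UNIV u"
    using poly_fockD[OF dgen_poly_fock[OF g]] smooth_continuous_on unfolding u_def by auto
  have gL: "g \<in> L2" "smooth g" using poly_fockD[OF g] by auto
  note [measurable] = L2_measurable[OF h]
  have sets: "sets ((lborel :: real measure) \<Otimes>\<^sub>M fock_measure) = sets (borel :: (real \<times> complex) measure)"
    unfolding borel_prod[symmetric] by (intro sets_pair_measure_cong) auto
  have "(\<lambda>p. dshift \<xi> (fst p) u (snd p)) \<in> borel_measurable borel"
    by (intro borel_measurable_continuous_onI continuous_dshift u)
  then have [measurable]: "(\<lambda>p. dshift \<xi> (fst p) u (snd p)) \<in> borel_measurable (lborel \<Otimes>\<^sub>M fock_measure)"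
    by (simp add: measurable_cong_sets[OF sets refl])
  define F where "F s w = indicator {a..b} s *\<^sub>R (dshift \<xi> s u w * cnj (h w))" for s w
  have Fm: "(\<lambda>p. F (fst p) (snd p)) \<in> borel_measurable (lborel \<Otimes>\<^sub>M fock_measure)"
    unfolding F_def by measurable
  have Fint: "integrable fock_measure (\<lambda>w. F s w)" for s
    unfolding F_def by (intro integrable_scaleR_right ip_integrable L2_dshift u h)
  have nb: "(LINT w|fock_measure. cmod (F s w)) \<le> indicator {a..b} s * K" for s
  proof -
    have m: "(\<lambda>w. complex_of_real (cmod (dshift \<xi> s u w * cnj (h w)))) \<in> borel_measurable borel"
      using borel_measurable_integrable[OF ip_integrable[OF L2_dshift[OF u(1), of \<xi> s] h]] by simp
    have le: "cmod (complex_of_real (cmod (dshift \<xi> s u w * cnj (h w)))) \<le> 1 * (cmod (dshift \<xi> s u w) * cmod (h w))" for w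
      by (simp add: norm_mult)
    have "cmod (LINT w|fock_measure. complex_of_real (cmod (dshift \<xi> s u w * cnj (h w)))) \<le> K"
      using integral_norm_le_AMGM(2)[OF m L2_integrable[OF L2_dshift[OF u(1)]] L2_integrable[OF h] le zero_le_one zero_less_one]
      by (simp add: K_def norm_dshift[OF u(1)] u_def[symmetric])
    then have "(LINT w|fock_measure. cmod (dshift \<xi> s u w * cnj (h w))) \<le> K"
      unfolding integral_complex_of_real norm_of_real by simp
    then show ?thesis by (simp add: F_def indicator_def)
  qed
  have bK: "integrable lborel (\<lambda>s. indicator {a..b} s * K)"
    using ab by (intro integrable_mult_left integrable_real_indicator) (auto simp: emeasure_lborel_Icc)
  have "integrable lborel (\<lambda>s. LINT w|fock_measure. cmod (F s w))"
  proof (rule Bochner_Integration.integrable_bound[OF bK])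
    show "(\<lambda>s. LINT w|fock_measure. cmod (F s w)) \<in> borel_measurable lborel"
      using Fm by (intro fock.borel_measurable_lebesgue_integral) (simp add: case_prod_unfold)
    show "AE s in lborel. norm (LINT w|fock_measure. cmod (F s w)) \<le> norm (indicator {a..b} s * K)"
    proof (intro AE_I2)
      fix s
      have "0 \<le> (LINT w|fock_measure. cmod (F s w))" by (intro integral_nonneg_AE AE_I2) simp
      with nb[of s] show "norm (LINT w|fock_measure. cmod (F s w)) \<le> norm (indicator {a..b} s * K)"
        by simp
    qed
  qed
  then have FF: "integrable (lborel \<Otimes>\<^sub>M fock_measure) (\<lambda>(s, w). F s w)"
    using Fm Fint by (intro P.Fubini_integrable) (auto simp: case_prod_unfold)
  have inner: "dshift \<xi> b g w - dshift \<xi> a g w = (LINT s|lborel. indicator {a..b} s *\<^sub>R dshift \<xi> s u w)" for w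
    unfolding u_def
  proof (rule integral_FTC_atLeastAtMost[symmetric, OF ab])
    show "continuous_on {a..b} (\<lambda>s. dshift \<xi> s (dgen \<xi> g) w)"
      by (intro continuous_on_compose2[OF continuous_dshift[OF u(3)[unfolded u_def]], of _ "\<lambda>s. (s, w)", simplified] continuous_intros)
    show "((\<lambda>t. dshift \<xi> t g w) has_vector_derivative dshift \<xi> x (dgen \<xi> g) w) (at x within {a..b})" for x
      by (rule has_vector_derivative_dshift[OF gL(2)])
  qed
  have "ip (dshift \<xi> b g) h - ip (dshift \<xi> a g) h = (LINT w|fock_measure. (dshift \<xi> b g w - dshift \<xi> a g w) * cnj (h w))"
    unfolding ip_def using ip_integrable[OF L2_dshift[OF gL(1)] h] by (simp add: left_diff_distrib)
  also have "\<dots> = (LINT w|fock_measure. LINT s|lborel. F s w)"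
    unfolding inner F_def by (simp add: integral_mult_left_zero[symmetric] del: integral_mult_left_zero)
  also have "\<dots> = (LINT s|lborel. LINT w|fock_measure. F s w)"
    by (rule P.Fubini_integral[OF FF])
  also have "\<dots> = (LINT s|lborel. indicator {a..b} s *\<^sub>R ip (dshift \<xi> s u) h)"
    unfolding F_def ip_def by simp
  finally show eq: "ip (dshift \<xi> b g) h - ip (dshift \<xi> a g) h = (LINT s|lborel. indicator {a..b} s *\<^sub>R ip (dshift \<xi> s (dgen \<xi> g)) h)"
    by (simp add: u_def)
  have Fi: "integrable lborel (\<lambda>s. LINT w|fock_measure. F s w)"
    using P.integrable_fst[OF FF] by simp
  have "cmod (LINT s|lborel. LINT w|fock_measure. F s w) \<le> (LINT s|lborel. cmod (LINT w|fock_measure. F s w))"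
    by (rule integral_norm_bound)
  also have "\<dots> \<le> (LINT s|lborel. indicator {a..b} s * K)"
    using Fi bK by (intro integral_mono integrable_norm order_trans[OF integral_norm_bound nb])
  also have "\<dots> = K * (b - a)" using ab by simp
  finally show "cmod (ip (dshift \<xi> b g) h - ip (dshift \<xi> a g) h) \<le> K * (b - a)"
    unfolding eq u_def[symmetric] by (simp add: F_def ip_def)
qed

section \<open>Matrix elements of the translations on a fixed level\<close>

lemma continuous_ip_dshift:
  assumes g: "g \<in> poly_fock n" and h: "h \<in> L2"
  shows "continuous_on S (\<lambda>t. ip (dshift \<xi> t g) h)"
proof -
  define K where "K = ((LINT z|fock_measure. (cmod (dgen \<xi> g z))\<^sup>2) + (LINT z|fock_measure. (cmod (h z))\<^sup>2)) / 2"
  have le: "cmod (ip (dshift \<xi> b g) h - ip (dshift \<xi> a g) h) \<le> K * (b - a)" if "a \<le> b" for a b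
    unfolding K_def by (rule ip_dshift_diff(2)[OF g h that])
  have "K-lipschitz_on S (\<lambda>t. ip (dshift \<xi> t g) h)"
  proof (rule lipschitz_onI)
    show "0 \<le> K" by (simp add: K_def)
    fix a b
    show "dist (ip (dshift \<xi> a g) h) (ip (dshift \<xi> b g) h) \<le> K * dist a b"
      using le[of a b] le[of b a]
      by (cases "a \<le> b") (auto simp: dist_norm norm_minus_commute)
  qed
  then show ?thesis by (rule lipschitz_on_continuous_on)
qed

text \<open>The integral formula can be differentiated because its integrand is continuous:
  \<open>dgen \<xi> g\<close> is again polyanalytic, of one order more.\<close>

lemma has_vector_derivative_ip_dshift:
  assumes g: "g \<in> poly_fock n" and h: "h \<in> L2" and t: "t \<in> {0..1}"
  shows "((\<lambda>t. ip (dshift \<xi> t g) h) has_vector_derivative ip (dshift \<xi> t (dgen \<xi> g)) h) (at t within {0..1})"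
proof -
  define q where "q s = ip (dshift \<xi> s (dgen \<xi> g)) h" for s
  have cq: "continuous_on S q" for S
    unfolding q_def[abs_def] by (rule continuous_ip_dshift[OF dgen_poly_fock[OF g] h])
  have eq: "ip (dshift \<xi> s g) h = ip (dshift \<xi> 0 g) h + integral {0..s} q" if "s \<in> {0..1}" for s
  proof -
    have "set_integrable lborel {0..s} q" by (rule borel_integrable_atLeastAtMost'[OF cq])
    from set_borel_integral_eq_integral(2)[OF this]
    have "integral {0..s} q = (LINT x|lborel. indicator {0..s} x *\<^sub>R q x)"
      by (simp add: set_lebesgue_integral_def)
    then show ?thesis
      using ip_dshift_diff(1)[OF g h, of 0 s \<xi>] that unfolding q_def by (simp add: algebra_simps)
  qed
  have "((\<lambda>s. ip (dshift \<xi> 0 g) h + integral {0..s} q) has_vector_derivative q t) (at t within {0..1})"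
    using integral_has_vector_derivative[OF cq t] by (auto intro!: derivative_eq_intros)
  then show ?thesis
    unfolding q_def[symmetric] by (rule has_vector_derivative_transform[OF t eq, rotated])
qed

text \<open>The creation term is pulled through the translation and moved to \<open>h\<close> as
  \<open>dbar\<close>. The price is the last summand, which the exponential factor in the expansion
  below cancels.\<close>

lemma ip_dshift_dgen:
  assumes g: "g \<in> poly_fock p" and h: "h \<in> poly_fock q"
  shows "ip (dshift \<xi> t (dgen \<xi> g)) h = cnj \<xi> * ip (dshift \<xi> t (dbar g)) h - \<xi> * ip (dshift \<xi> t g) (dbar h)
    - of_real t * (\<xi> * cnj \<xi>) * ip (dshift \<xi> t g) h"
proof -
  note gs = poly_fockD[OF g] and hs = poly_fockD[OF h]
  note dg = poly_fockD(1)[OF poly_fock_dbar[OF g]] and ag = poly_fockD(1)[OF poly_fock_adag[OF g]]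
    and dh = poly_fockD(1)[OF poly_fock_dbar[OF h]]
  note L = L2_dshift[of _ \<xi> t]
  let ?D = "dshift \<xi> t g"
  have D: "smooth ?D" "?D \<in> L2" by (auto intro: smooth_dshift L2_dshift gs)
  have ad: "adag ?D \<in> L2"
    unfolding adag_dshift[OF gs(2)] by (intro L2_diff L2_cmult L ag gs)
  have "ip (dshift \<xi> t (adag g)) h = ip (\<lambda>z. adag ?D z + of_real t * cnj \<xi> * ?D z) h"
    by (simp add: adag_dshift[OF gs(2)])
  also have "\<dots> = ip (adag ?D) h + of_real t * cnj \<xi> * ip ?D h"
    by (subst ip_add_left) (auto intro: ad L2_cmult D hs simp: ip_cmult_left)
  also have "ip (adag ?D) h = ip ?D (dbar h)"
    using ip_adjoint[OF hs(2) hs(1) dh D(1) D(2) ad] by (metis ip_cnj)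
  finally have 1: "ip (dshift \<xi> t (adag g)) h = ip ?D (dbar h) + of_real t * cnj \<xi> * ip ?D h" .
  have "ip (dshift \<xi> t (dgen \<xi> g)) h = cnj \<xi> * ip (dshift \<xi> t (dbar g)) h + (- \<xi>) * ip (dshift \<xi> t (adag g)) h"
    unfolding dgen_def dshift_add dshift_cmult
    by (subst ip_add_left[OF L2_cmult[OF L[OF dg]] L2_cmult[OF L[OF ag]] hs(1)]) (simp only: ip_cmult_left)
  then show ?thesis unfolding 1 by (simp add: algebra_simps)
qed

text \<open>
  Differentiating in \<open>t\<close> lowers the order of \<open>g\<close> or of \<open>h\<close> by one, since the creation operator in
  the generator can be moved to \<open>h\<close> as an annihilation operator.
\<close>

lemma ip_dshift_expansion:
  assumes "g \<in> poly_fock p" "h \<in> poly_fock q" "t \<in> {0..1}"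
  shows "exp (of_real (t\<^sup>2 * (cmod \<xi>)\<^sup>2 / 2)) * ip (dshift \<xi> t g) h =
    (\<Sum>l<p. \<Sum>m<q. (of_real t * cnj \<xi>) ^ l / fact l * ((of_real t * - \<xi>) ^ m / fact m) * ip ((dbar ^^ l) g) ((dbar ^^ m) h))"
  using assms
proof (induction "p + q" arbitrary: p q g h t rule: less_induct)
  case less
  note g = less.prems(1) and h = less.prems(2)
  consider "p = 0" | "q = 0" | p' q' where "p = Suc p'" "q = Suc q'" by (meson not0_implies_Suc)
  then show ?case
  proof cases
    case 1
    then have "g = (\<lambda>_. 0)" using g poly_fock_0 by auto
    then show ?thesis using 1 by (simp add: dshift_def ip_def)
  next
    case 2
    then have "h = (\<lambda>_. 0)" using h poly_fock_0 by auto
    then show ?thesis using 2 by (simp add: ip_def)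
  next
    case 3
    have dg: "dbar g \<in> poly_fock p'" and dh: "dbar h \<in> poly_fock q'"
      using poly_fock_dbar[OF g] poly_fock_dbar[OF h] 3 by auto
    \<comment> \<open>The exponential is an integrating factor: it leaves
      \<open>cnj \<xi> * V (dbar g) h - \<xi> * V g (dbar h)\<close> as the derivative of
      \<open>V g h\<close>, and both terms fall under the induction hypothesis.\<close>
    define V where "V g h t = exp (of_real (t\<^sup>2 * (cmod \<xi>)\<^sup>2 / 2)) * ip (dshift \<xi> t g) h" for g h t
    define A where "A c l t = (complex_of_real t * c) ^ l / fact l" for c l t
    define S where "S p q g h t = (\<Sum>l<p. \<Sum>m<q. A (cnj \<xi>) l t * A (- \<xi>) m t * ip ((dbar ^^ l) g) ((dbar ^^ m) h))" for p q g h t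
    have IH1: "V (dbar g) h t = S p' q (dbar g) h t" if "t \<in> {0..1}" for t
      unfolding V_def S_def A_def using less.hyps[OF _ dg h that] 3 by simp
    have IH2: "V g (dbar h) t = S p q' g (dbar h) t" if "t \<in> {0..1}" for t
      unfolding V_def S_def A_def using less.hyps[OF _ g dh that] 3 by simp
    have dA0: "(A c 0 has_vector_derivative 0) (at t within {0..1})" for c t
      by (simp add: A_def[abs_def])
    have dA: "(A c (Suc l) has_vector_derivative c * A c l t) (at t within {0..1})" for c l t
    proof -
      have d1: "((\<lambda>t. of_real t * c) has_vector_derivative c) (at t within {0..1})"
        unfolding has_vector_derivative_def by (auto intro!: derivative_eq_intros simp: scaleR_conv_of_real)
      have d3: "of_nat (Suc l) * (of_real t * c) ^ l / fact (Suc l) = A c l t"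
        by (simp add: A_def del: of_nat_Suc)
      have "((\<lambda>z. z ^ Suc l / fact (Suc l)) has_field_derivative (of_nat (Suc l) * (of_real t * c) ^ l / fact (Suc l)))
          (at (of_real t * c) within (\<lambda>t. of_real t * c) ` {0..1})"
        by (rule DERIV_cdivide, rule DERIV_cong[OF DERIV_power[OF DERIV_ident]]) simp
      from field_vector_diff_chain_within[OF d1 this[unfolded d3]] show ?thesis
        unfolding o_def A_def .
    qed
    \<comment> \<open>The derivative of \<open>A c l\<close>, with the constant case
      \<open>l = 0\<close> separated so that no truncated predecessor occurs.\<close>
    define A' where "A' c l t = (case l of 0 \<Rightarrow> 0 | Suc l \<Rightarrow> c * A c l t)" for c l t
    have dA': "(A c l has_vector_derivative A' c l t) (at t within {0..1})" for c l t
      using dA0 dA by (cases l) (auto simp: A'_def)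
    have dS: "(S p q g h has_vector_derivative (cnj \<xi> * S p' q (dbar g) h t - \<xi> * S p q' g (dbar h) t)) (at t within {0..1})" for t
    proof -
      let ?c = "\<lambda>l m. ip ((dbar ^^ l) g) ((dbar ^^ m) h)"
      have "(S p q g h has_vector_derivative (\<Sum>l<p. \<Sum>m<q.
          (A (cnj \<xi>) l t * A' (- \<xi>) m t + A' (cnj \<xi>) l t * A (- \<xi>) m t) * ?c l m)) (at t within {0..1})"
        unfolding S_def[abs_def]
        by (intro has_vector_derivative_sum has_vector_derivative_mult_left has_vector_derivative_mult dA')
      moreover have "(\<Sum>l<p. \<Sum>m<q. A' (cnj \<xi>) l t * A (- \<xi>) m t * ?c l m) = cnj \<xi> * S p' q (dbar g) h t"
        unfolding 3(1) sum.lessThan_Suc_shift S_def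
        by (simp add: A'_def funpow_swap1 sum_distrib_left mult.assoc)
      moreover have "(\<Sum>l<p. \<Sum>m<q. A (cnj \<xi>) l t * A' (- \<xi>) m t * ?c l m) = - \<xi> * S p q' g (dbar h) t"
        unfolding 3(2) sum.lessThan_Suc_shift S_def
        by (simp add: A'_def funpow_swap1 sum_distrib_left mult_ac)
      ultimately show ?thesis
        by (simp add: distrib_right sum.distrib)
    qed
    have dV: "(V g h has_vector_derivative (cnj \<xi> * V (dbar g) h t - \<xi> * V g (dbar h) t)) (at t within {0..1})"
      if t: "t \<in> {0..1}" for t
    proof -
      have "((\<lambda>t. of_real (t\<^sup>2 * (cmod \<xi>)\<^sup>2 / 2)) has_vector_derivative (of_real (t * (cmod \<xi>)\<^sup>2))) (at t within {0..1})"
        unfolding has_vector_derivative_def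
        by (auto intro!: derivative_eq_intros simp: scaleR_conv_of_real algebra_simps)
      from field_vector_diff_chain_within[OF this DERIV_subset[OF DERIV_exp subset_UNIV]]
      have e: "((\<lambda>t. exp (of_real (t\<^sup>2 * (cmod \<xi>)\<^sup>2 / 2))) has_vector_derivative
          complex_of_real (t * (cmod \<xi>)\<^sup>2) * exp (of_real (t\<^sup>2 * (cmod \<xi>)\<^sup>2 / 2))) (at t within {0..1})"
        by (simp add: o_def)
      have c: "complex_of_real (t * (cmod \<xi>)\<^sup>2) = of_real t * (\<xi> * cnj \<xi>)"
        by (simp only: of_real_mult complex_norm_square)
      have "e * (cnj \<xi> * a - \<xi> * b - of_real t * (\<xi> * cnj \<xi>) * d) + (complex_of_real (t * (cmod \<xi>)\<^sup>2) * e) * d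
          = cnj \<xi> * (e * a) - \<xi> * (e * b)" for e a b d
        unfolding c by (simp add: algebra_simps)
      with has_vector_derivative_mult[OF e has_vector_derivative_ip_dshift[OF g poly_fockD(1)[OF h] t, of \<xi>]]
      show ?thesis
        unfolding ip_dshift_dgen[OF g h] V_def by (simp only:)
    qed
    have 0: "V g h 0 = S p q g h 0"
    proof -
      have A0: "A c l 0 = (if l = 0 then 1 else 0)" for c l by (simp add: A_def power_0_left)
      have "S p q g h 0 = ip g h"
        unfolding S_def 3 sum.lessThan_Suc_shift by (simp add: A0)
      then show ?thesis by (simp add: V_def dshift_0)
    qed
    \<comment> \<open>Both sides now have the same derivative on the interval and the same value at
      zero.\<close>
    have "((\<lambda>t. V g h t - S p q g h t) has_vector_derivative 0) (at t within {0..1})" if "t \<in> {0..1}" for t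
      using has_vector_derivative_diff[OF dV[OF that] dS] by (simp add: IH1[OF that] IH2[OF that])
    then obtain c where c: "\<And>t. t \<in> {0..1} \<Longrightarrow> V g h t - S p q g h t = c"
      using has_vector_derivative_zero_constant[of "{0..1}" "\<lambda>t. V g h t - S p q g h t"] by auto
    have "V g h t = S p q g h t"
      using c[of 0] c[OF less.prems(3)] 0 by simp
    then show ?thesis by (simp add: V_def S_def A_def)
  qed
qed

text \<open>At \<open>t = 1\<close> orthogonality of the levels leaves the terms with
  \<open>l = m\<close>. Their norm ratio \<open>fact n / fact (n - l)\<close> together with the two
  factors \<open>1 / fact l\<close> is a binomial coefficient over \<open>fact l\<close>.\<close>

lemma ip_dshift_true_fock:
  assumes g: "g \<in> true_fock (Suc n)" and h: "h \<in> true_fock (Suc n)"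
  shows "exp (of_real ((cmod \<xi>)\<^sup>2 / 2)) * ip (dshift \<xi> 1 g) h = of_real (laguerre n ((cmod \<xi>)\<^sup>2)) * ip g h"
proof -
  let ?c = "\<lambda>l m. cnj \<xi> ^ l / fact l * ((- \<xi>) ^ m / fact m)"
  have "exp (of_real ((cmod \<xi>)\<^sup>2 / 2)) * ip (dshift \<xi> 1 g) h =
      (\<Sum>l<Suc n. \<Sum>m<Suc n. ?c l m * ip ((dbar ^^ l) g) ((dbar ^^ m) h))"
    using ip_dshift_expansion[OF true_fock_poly_fock[OF g] true_fock_poly_fock[OF h], of 1 \<xi>] by simp
  also have "\<dots> = (\<Sum>l<Suc n. of_real ((-1) ^ l * real (n choose (n - l)) * (((cmod \<xi>)\<^sup>2) ^ l / fact l)) * ip g h)"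
  proof (intro sum.cong refl)
    fix l assume "l \<in> {..<Suc n}"
    then have l: "l \<le> n" by simp
    have "(\<Sum>m<Suc n. ?c l m * ip ((dbar ^^ l) g) ((dbar ^^ m) h)) =
        (\<Sum>m<Suc n. if m = l then ?c l l * (of_real (fact n / fact (n - l)) * ip g h) else 0)"
      using ip_dbar_funpow_neq[OF g h l] ip_dbar_funpow[OF g h l] by (intro sum.cong) auto
    also have "\<dots> = ?c l l * (of_real (fact n / fact (n - l)) * ip g h)"
      using l by (subst sum.delta) auto
    also have "?c l l = of_real ((-1) ^ l * ((cmod \<xi>)\<^sup>2) ^ l / (fact l * fact l))"
    proof -
      have "complex_of_real (((cmod \<xi>)\<^sup>2) ^ l) = (\<xi> * cnj \<xi>) ^ l"
        by (simp only: of_real_power[of _ l] complex_norm_square)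
      then show ?thesis
        by (simp add: power_minus[of \<xi>] power_mult_distrib mult_ac)
    qed
    also have "complex_of_real ((-1) ^ l * ((cmod \<xi>)\<^sup>2) ^ l / (fact l * fact l)) * (of_real (fact n / fact (n - l)) * ip g h)
       = of_real ((-1) ^ l * real (n choose (n - l)) * (((cmod \<xi>)\<^sup>2) ^ l / fact l)) * ip g h"
    proof -
      have "real (n choose (n - l)) = fact n / (fact l * fact (n - l))"
        using l by (simp add: binomial_fact binomial_symmetric[OF l, symmetric])
      then have "(-1) ^ l * ((cmod \<xi>)\<^sup>2) ^ l / (fact l * fact l) * (fact n / fact (n - l)) =
          (-1) ^ l * real (n choose (n - l)) * (((cmod \<xi>)\<^sup>2) ^ l / fact l)"
        by (simp add: mult_ac)
      then show ?thesis
        unfolding mult.assoc[symmetric] of_real_mult[symmetric] by (simp only:)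
    qed
    finally show "(\<Sum>m<Suc n. ?c l m * ip ((dbar ^^ l) g) ((dbar ^^ m) h)) =
        of_real ((-1) ^ l * real (n choose (n - l)) * (((cmod \<xi>)\<^sup>2) ^ l / fact l)) * ip g h" .
  qed
  also have "\<dots> = of_real (laguerre n ((cmod \<xi>)\<^sup>2)) * ip g h"
    unfolding laguerre_def sum_distrib_right[symmetric] of_real_sum atLeast0AtMost lessThan_Suc_atMost ..
  finally show ?thesis .
qed

section \<open>Weyl operators and Toeplitz operators\<close>

definition wfac :: "complex \<Rightarrow> complex \<Rightarrow> complex" where
  "wfac z w = exp (w * cnj z - of_real ((cmod z)\<^sup>2 / 2))"

lemma weyl_wfac: "weyl z f = (\<lambda>w. wfac z w * f (w + - z))"
  by (auto simp: weyl_def wfac_def)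

lemma wfac_gauss: "(cmod (wfac z w))\<^sup>2 * gw w = gw (w + - z)"
proof -
  have "(cmod (wfac z w))\<^sup>2 = exp (2 * Re (w * cnj z - of_real ((cmod z)\<^sup>2 / 2)))"
    unfolding wfac_def by (simp only: norm_exp_eq_Re exp_double)
  then have "(cmod (wfac z w))\<^sup>2 * gw w = exp (2 * Re (w * cnj z - of_real ((cmod z)\<^sup>2 / 2)) - (cmod w)\<^sup>2) / pi"
    by (simp only: gw_def exp_add[symmetric] times_divide_eq_right diff_conv_add_uminus)
  also have "2 * Re (w * cnj z - of_real ((cmod z)\<^sup>2 / 2)) - (cmod w)\<^sup>2 = - (cmod (w + - z))\<^sup>2"
  proof -
    have "Re (w * cnj z - of_real ((cmod z)\<^sup>2 / 2)) = Re w * Re z + Im w * Im z - (cmod z)\<^sup>2 / 2"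
      by simp
    moreover have "Re (w + - z) = Re w - Re z" "Im (w + - z) = Im w - Im z" by simp_all
    ultimately show ?thesis unfolding cmod_power2 by (simp add: power2_eq_square algebra_simps)
  qed
  finally show ?thesis by (simp add: gw_def)
qed

lemma wfac_eq: "wfac z = (\<lambda>w. exp (- of_real ((cmod z)\<^sup>2 / 2)) * exp (cnj z * w))"
  unfolding wfac_def exp_add[symmetric] by (intro ext arg_cong[where f = exp]) simp

lemma smooth_wfac: "smooth (wfac z)"
  unfolding wfac_eq by (intro smooth_cmult smooth_exp)

lemma smooth_weyl: "smooth f \<Longrightarrow> smooth (weyl z f)"
  unfolding weyl_wfac by (intro smooth_mult smooth_wfac smooth_shift)

text \<open>The weight is holomorphic and hence invisible to \<open>dbar\<close>; this is why Weyl
  operators keep the order of polyanalyticity.\<close>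

lemma dbar_weyl:
  assumes "smooth f"
  shows "dbar (weyl z f) = weyl z (dbar f)"
proof
  fix w
  have "((\<lambda>w. exp (- of_real ((cmod z)\<^sup>2 / 2)) * exp (cnj z * w)) has_field_derivative
      exp (- of_real ((cmod z)\<^sup>2 / 2)) * (exp (cnj z * w) * cnj z)) (at w)"
    by (auto intro!: derivative_eq_intros)
  from wirtinger_holo(2)[OF this] have 0: "dbar (wfac z) w = 0" unfolding wfac_eq .
  have "dbar (\<lambda>w. wfac z w * f (w + - z)) w = wfac z w * dbar (\<lambda>w. f (w + - z)) w + dbar (wfac z) w * f (w + - z)"
    by (intro wirtinger_mult smooth_differentiable smooth_wfac smooth_shift assms)
  then show "dbar (weyl z f) w = weyl z (dbar f) w"
    by (simp only: weyl_wfac wirtinger_shift(2)[OF smooth_differentiable[OF assms]] 0 mult_zero_left add_0_right)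
qed

lemma dbar_funpow_weyl: "smooth f \<Longrightarrow> (dbar ^^ n) (weyl z f) = weyl z ((dbar ^^ n) f)"
  by (induction n) (simp_all add: dbar_weyl smooth_dbar_funpow)

lemma L2_weyl: "f \<in> L2 \<Longrightarrow> weyl z f \<in> L2"
  unfolding weyl_wfac by (rule L2_weighted_shift[OF smooth_continuous_on[OF smooth_wfac] wfac_gauss])

lemma norm_weyl: "f \<in> L2 \<Longrightarrow>
    (LINT w|fock_measure. (cmod (weyl z f w))\<^sup>2) = (LINT w|fock_measure. (cmod (f w))\<^sup>2)"
  unfolding weyl_wfac by (rule norm_weighted_shift[OF smooth_continuous_on[OF smooth_wfac] wfac_gauss])

lemma ip_weyl: "f \<in> borel_measurable borel \<Longrightarrow> g \<in> borel_measurable borel \<Longrightarrow> ip (weyl z f) (weyl z g) = ip f g"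
  unfolding weyl_wfac by (rule ip_weighted_shift[OF smooth_continuous_on[OF smooth_wfac] wfac_gauss])

lemma weyl_poly_fock: "f \<in> poly_fock n \<Longrightarrow> weyl z f \<in> poly_fock n"
proof -
  assume f: "f \<in> poly_fock n"
  have "(dbar ^^ n) (weyl z f) = (\<lambda>_. 0)"
    unfolding dbar_funpow_weyl[OF poly_fockD(2)[OF f]] poly_fockD(3)[OF f] by (simp add: weyl_wfac)
  then show ?thesis
    using L2_weyl[OF poly_fockD(1)[OF f]] smooth_weyl[OF poly_fockD(2)[OF f]] by (simp add: poly_fock_def)
qed

text \<open>The exponent of the factor is purely imaginary, so the two operators commute up to a
  phase. It yields the covariance of the Berezin transform as well as the continuity of conjugation
  at zero.\<close>

lemma weyl_commute: "weyl z (weyl \<xi> f) w = exp (\<xi> * cnj z - z * cnj \<xi>) * weyl \<xi> (weyl z f) w"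
proof -
  have eq: "w * cnj z - of_real ((cmod z)\<^sup>2 / 2) + ((w - z) * cnj \<xi> - of_real ((cmod \<xi>)\<^sup>2 / 2)) =
      (\<xi> * cnj z - z * cnj \<xi>) + (w * cnj \<xi> - of_real ((cmod \<xi>)\<^sup>2 / 2) + ((w - \<xi>) * cnj z - of_real ((cmod z)\<^sup>2 / 2)))"
    by (simp add: algebra_simps)
  have "exp (w * cnj z - of_real ((cmod z)\<^sup>2 / 2)) * exp ((w - z) * cnj \<xi> - of_real ((cmod \<xi>)\<^sup>2 / 2)) =
      exp (\<xi> * cnj z - z * cnj \<xi>) * (exp (w * cnj \<xi> - of_real ((cmod \<xi>)\<^sup>2 / 2)) * exp ((w - \<xi>) * cnj z - of_real ((cmod z)\<^sup>2 / 2)))"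
    unfolding exp_add[symmetric] eq ..
  moreover have "w - \<xi> - z = w - z - \<xi>" by simp
  ultimately show ?thesis
    unfolding weyl_def by (simp only: mult.assoc[symmetric])
qed

lemma weyl_inverse: "weyl z (weyl (- z) f) = f"
proof
  fix w
  have "w * cnj z - of_real ((cmod z)\<^sup>2 / 2) + ((w - z) * cnj (- z) - of_real ((cmod (- z))\<^sup>2 / 2)) =
      z * cnj z - of_real ((cmod z)\<^sup>2)"
    by (simp add: algebra_simps)
  also have "\<dots> = 0" by (simp only: complex_norm_square diff_self)
  finally have "exp (w * cnj z - of_real ((cmod z)\<^sup>2 / 2)) * exp ((w - z) * cnj (- z) - of_real ((cmod (- z))\<^sup>2 / 2)) = 1"
    unfolding exp_add[symmetric] by (simp only: exp_zero)
  moreover have "w - z - - z = w" by simp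
  ultimately show "weyl z (weyl (- z) f) w = f w"
    unfolding weyl_def by (simp only: mult.assoc[symmetric] mult_1_left)
qed

lemma ip_weyl_adjoint:
  assumes "f \<in> borel_measurable borel" "g \<in> L2"
  shows "ip (weyl z f) g = ip f (weyl (- z) g)"
  using ip_weyl[OF assms(1) L2_measurable[OF L2_weyl[OF assms(2)]], of z "- z"] by (simp add: weyl_inverse)

lemma weyl_true_fock:
  assumes f: "f \<in> true_fock (Suc m)"
  shows "weyl z f \<in> true_fock (Suc m)"
  unfolding true_fock_iff
proof safe
  show "weyl z f \<in> poly_fock (Suc m)" by (intro weyl_poly_fock true_fock_poly_fock f)
  fix g assume g: "g \<in> poly_fock m"
  have "ip (weyl z f) g = ip f (weyl (- z) g)"
    using poly_fockD(1)[OF true_fock_poly_fock[OF f]] poly_fockD(1)[OF g]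
    by (intro ip_weyl_adjoint L2_measurable)
  then show "ip (weyl z f) g = 0" using true_fock_orthogonal[OF f weyl_poly_fock[OF g]] by simp
qed

text \<open>The difference of two candidates lies in the space and is orthogonal to itself.\<close>

lemma orth_proj_eqI:
  assumes p: "p \<in> true_fock (Suc m)" and h: "h \<in> L2"
    and orth: "\<And>g. g \<in> true_fock (Suc m) \<Longrightarrow> ip (\<lambda>z. h z - p z) g = 0"
  shows "orth_proj (true_fock (Suc m)) h = p"
  unfolding orth_proj_def
proof (rule the_equality)
  show "p \<in> true_fock (Suc m) \<and> (\<forall>g\<in>true_fock (Suc m). ip (\<lambda>z. h z - p z) g = 0)"
    using p orth by blast
  fix p' assume "p' \<in> true_fock (Suc m) \<and> (\<forall>g\<in>true_fock (Suc m). ip (\<lambda>z. h z - p' z) g = 0)"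
  then have p': "p' \<in> true_fock (Suc m)" and o': "\<And>g. g \<in> true_fock (Suc m) \<Longrightarrow> ip (\<lambda>z. h z - p' z) g = 0"
    by auto
  define d where "d z = p z + (-1) * p' z" for z
  have d: "d \<in> true_fock (Suc m)" unfolding d_def[abs_def] by (intro true_fock_add true_fock_cmult p p')
  note L = poly_fockD(1)[OF true_fock_poly_fock]
  have "d = (\<lambda>z. (h z - p' z) - (h z - p z))" by (auto simp: d_def)
  then have "ip d d = ip (\<lambda>z. h z - p' z) d - ip (\<lambda>z. h z - p z) d"
    using ip_diff_left[OF L2_diff[OF h L[OF p']] L2_diff[OF h L[OF p]] L[OF d]] by simp
  then have "ip d d = 0" using orth[OF d] o'[OF d] by simp
  then have "d = (\<lambda>_. 0)"
    using L[OF d] poly_fockD(2)[OF true_fock_poly_fock[OF d]] by (intro ip_self_eq_0 smooth_continuous_on)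
  then show "p' = p" by (auto simp: d_def fun_eq_iff)
qed

lemma toeplitz_exp_symp_form:
  assumes g: "g \<in> true_fock (Suc m)"
  shows "toeplitz (\<lambda>z. exp (\<i> * of_real (symp_form z \<xi>) + of_real ((cmod \<xi>)\<^sup>2 / 2))) (Suc m) g =
    (\<lambda>w. of_real (laguerre m ((cmod \<xi>)\<^sup>2)) * weyl \<xi> g w)"
proof -
  note L = poly_fockD(1)[OF true_fock_poly_fock]
  let ?f = "\<lambda>z. exp (\<i> * of_real (symp_form z \<xi>) + of_real ((cmod \<xi>)\<^sup>2 / 2))"
  let ?E = "exp (complex_of_real ((cmod \<xi>)\<^sup>2 / 2))"
  \<comment> \<open>Evaluating the weight of \<open>dshift\<close> at \<open>w - \<xi>\<close>
    contributes \<open>exp (|\<xi>|^2)\<close>, which cancels the two constants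
    \<open>exp (- |\<xi>|^2 / 2)\<close>. The remaining \<open>?E\<close> is the factor appearing in
    \<open>ip_dshift_true_fock\<close>.\<close>
  have eq: "(\<lambda>z. ?f z * g z) = (\<lambda>w. ?E * weyl \<xi> (dshift \<xi> 1 g) w)"
  proof
    fix w
    have "\<i> * of_real (symp_form w \<xi>) = w * cnj \<xi> - cnj w * \<xi>"
      unfolding symp_form_def by (simp add: complex_eq_iff algebra_simps)
    moreover have "complex_of_real ((cmod \<xi>)\<^sup>2 / 2) + complex_of_real ((cmod \<xi>)\<^sup>2 / 2) = cnj \<xi> * \<xi>"
      unfolding of_real_add[symmetric] field_sum_of_halves by (simp only: complex_norm_square mult.commute)
    ultimately have "\<i> * of_real (symp_form w \<xi>) + of_real ((cmod \<xi>)\<^sup>2 / 2) =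
        of_real ((cmod \<xi>)\<^sup>2 / 2) + ((w * cnj \<xi> - of_real ((cmod \<xi>)\<^sup>2 / 2)) +
          (- (of_real 1 * \<xi> * cnj (w - \<xi>)) - of_real (1\<^sup>2 * (cmod \<xi>)\<^sup>2 / 2)))"
      by (simp add: algebra_simps)
    then show "?f w * g w = ?E * weyl \<xi> (dshift \<xi> 1 g) w"
      by (simp only: weyl_def dshift_def dfac_def exp_add mult.assoc of_real_1 mult_1_left diff_add_cancel)
  qed
  have D: "dshift \<xi> 1 g \<in> L2" by (rule L2_dshift[OF L[OF g]])
  have fgL: "(\<lambda>z. ?f z * g z) \<in> L2" unfolding eq by (intro L2_cmult L2_weyl D)
  \<comment> \<open>The Weyl operator is moved to \<open>h\<close>, which stays on its level, so
    that the matrix elements of \<open>dshift\<close> within one level apply; afterwards it is moved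
    back.\<close>
  have key: "ip (\<lambda>z. ?f z * g z) h = of_real (laguerre m ((cmod \<xi>)\<^sup>2)) * ip (weyl \<xi> g) h" if h: "h \<in> true_fock (Suc m)" for h
  proof -
    have "ip (\<lambda>z. ?f z * g z) h = ?E * ip (dshift \<xi> 1 g) (weyl (- \<xi>) h)"
      unfolding eq ip_cmult_left by (simp add: ip_weyl_adjoint[OF L2_measurable[OF D] L[OF h]])
    also have "\<dots> = of_real (laguerre m ((cmod \<xi>)\<^sup>2)) * ip g (weyl (- \<xi>) h)"
      by (rule ip_dshift_true_fock[OF g weyl_true_fock[OF h]])
    also have "ip g (weyl (- \<xi>) h) = ip (weyl \<xi> g) h"
      by (simp add: ip_weyl_adjoint[OF L2_measurable[OF L[OF g]] L[OF h]])
    finally show ?thesis .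
  qed
  show ?thesis
    unfolding toeplitz_def
  proof (rule orth_proj_eqI[OF true_fock_cmult[OF weyl_true_fock[OF g]] fgL])
    fix h assume h: "h \<in> true_fock (Suc m)"
    show "ip (\<lambda>z. ?f z * g z - of_real (laguerre m ((cmod \<xi>)\<^sup>2)) * weyl \<xi> g z) h = 0"
      by (subst ip_diff_left[OF fgL L2_cmult[OF L[OF weyl_true_fock[OF g]]] L[OF h]])
        (simp only: key[OF h] ip_cmult_left diff_self)
  qed
qed

section \<open>Membership criteria for the true polyanalytic spaces\<close>

lemma monomial_poly_fock: "(\<lambda>w. w ^ a * cnj w ^ b) \<in> poly_fock (Suc b)"
proof -
  have sm: "smooth (\<lambda>w. w ^ a * cnj w ^ b)" for b
    by (intro smooth_mult smooth_power smooth_ident smooth_cnj_ident)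
  have d: "dbar (\<lambda>w. w ^ a * cnj w ^ b) w = of_nat b * (w ^ a * cnj w ^ (b - 1))" for b w
  proof -
    have h: "((\<lambda>w::complex. w ^ n) has_field_derivative of_nat n * w ^ (n - 1)) (at w)" for n :: nat
      by (rule DERIV_cong[OF DERIV_power[OF DERIV_ident]]) simp
    have "dbar (\<lambda>w. cnj (w ^ b)) w = cnj (dz (\<lambda>w. w ^ b) w)"
      by (intro wirtinger_cnj smooth_differentiable smooth_power smooth_ident)
    then have "dbar (\<lambda>w. cnj w ^ b) w = of_nat b * cnj w ^ (b - 1)"
      by (simp add: wirtinger_holo(1)[OF h])
    moreover have "dbar (\<lambda>w. w ^ a * cnj w ^ b) w = w ^ a * dbar (\<lambda>w. cnj w ^ b) w + dbar (\<lambda>w. w ^ a) w * cnj w ^ b"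
      by (intro wirtinger_mult smooth_differentiable smooth_power smooth_ident smooth_cnj_ident)
    ultimately show ?thesis
      by (simp add: wirtinger_holo(2)[OF h])
  qed
  have "(dbar ^^ Suc b) (\<lambda>w. w ^ a * cnj w ^ b) = (\<lambda>_. 0)"
  proof (induction b)
    case 0
    then show ?case using d[of 0] by (auto simp: fun_eq_iff)
  next
    case (Suc b)
    have "dbar (\<lambda>w. w ^ a * cnj w ^ Suc b) = (\<lambda>w. of_nat (Suc b) * (w ^ a * cnj w ^ b))"
      using d[of "Suc b"] by (auto simp: fun_eq_iff)
    moreover have "(dbar ^^ Suc (Suc b)) F = (dbar ^^ Suc b) (dbar F)" for F
      by (simp only: funpow_Suc_right o_apply)
    ultimately have "(dbar ^^ Suc (Suc b)) (\<lambda>w. w ^ a * cnj w ^ Suc b) = (dbar ^^ Suc b) (\<lambda>w. of_nat (Suc b) * (w ^ a * cnj w ^ b))"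
      by (simp only:)
    then show ?case by (simp only: dbar_funpow_cmult[OF sm] Suc mult_zero_right)
  qed
  moreover have "(\<lambda>w. w ^ a * cnj w ^ b) \<in> L2"
  proof -
    have "(cmod (w ^ a * cnj w ^ b))\<^sup>2 = cmod w ^ (2 * (a + b))" for w
      unfolding norm_mult norm_power complex_mod_cnj power_add[symmetric] power_mult[symmetric]
      by (simp only: mult.commute)
    then show ?thesis
      using integrable_fock_cmod_power[of "a + b"] borel_measurable_continuous[OF smooth_continuous_on[OF sm]]
      by (simp only: L2_iff simp_thms)
  qed
  ultimately show ?thesis using sm by (auto simp: poly_fock_def)
qed

lemma poly_fock_sum: "(\<And>i. i \<in> I \<Longrightarrow> f i \<in> poly_fock n) \<Longrightarrow> (\<lambda>z. \<Sum>i\<in>I. f i z) \<in> poly_fock n"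
  by (induction I rule: infinite_finite_induct) (auto intro: zero_in_poly_fock poly_fock_add)

text \<open>Eigenfunctions to distinct eigenvalues are orthogonal. A general \<open>g\<close> of
  order \<open>Suc n\<close> is an eigenfunction to the eigenvalue \<open>n\<close> only up to a
  remainder \<open>r\<close> of order \<open>n\<close>, which the induction disposes of.\<close>

lemma true_fock_eigenfunction:
  assumes f: "f \<in> poly_fock (Suc m)" and eig: "adag (dbar f) = (\<lambda>z. of_nat m * f z)"
  shows "f \<in> true_fock (Suc m)"
proof -
  have "n \<le> m \<Longrightarrow> g \<in> poly_fock n \<Longrightarrow> ip f g = 0" for n g
  proof (induction n arbitrary: g)
    case 0
    then show ?case by (simp add: poly_fock_0 ip_zero)
  next
    case (Suc n)
    note g = Suc.prems(2)
    have df: "dbar f \<in> poly_fock m" and dg: "dbar g \<in> poly_fock n"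
      using poly_fock_dbar[OF f] poly_fock_dbar[OF g] by auto
    define r where "r z = adag (dbar g) z - of_nat n * g z" for z
    have ag: "adag (dbar g) \<in> poly_fock (Suc n)" by (rule poly_fock_adag[OF dg])
    have rS: "r \<in> poly_fock (Suc n)"
      unfolding r_def[abs_def] by (intro poly_fock_diff poly_fock_cmult ag g)
    have smg: "smooth (dbar g)" "smooth g" using poly_fockD(2) dg g by auto
    \<comment> \<open>Commuting \<open>n\<close> derivatives past \<open>adag\<close> leaves
      \<open>n\<close> times the \<open>n\<close>-th derivative of \<open>g\<close>, cancelled by
      the subtracted term; the other contribution contains \<open>Suc n\<close> derivatives of
      \<open>g\<close>.\<close>
    have "(dbar ^^ n) r = (\<lambda>_. 0)"
    proof -
      have "r = (\<lambda>z. adag (dbar g) z + (- of_nat n) * g z)" by (auto simp: r_def)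
      then have "(dbar ^^ n) r = (\<lambda>z. (dbar ^^ n) (adag (dbar g)) z + (- of_nat n) * (dbar ^^ n) g z)"
        by (simp only: dbar_funpow_add[OF smooth_adag[OF smg(1)] smooth_cmult[OF smg(2)]] dbar_funpow_cmult[OF smg(2)])
      moreover have "(dbar ^^ n) (dbar g) = (\<lambda>_. 0)" by (rule poly_fockD(3)[OF dg])
      moreover have "of_nat n * (dbar ^^ (n - 1)) (dbar g) z = of_nat n * (dbar ^^ n) g z" for z
        by (cases n) (simp_all add: funpow_swap1)
      ultimately have "(dbar ^^ n) r = (\<lambda>z. adag (\<lambda>_. 0) z + of_nat n * (dbar ^^ n) g z + (- of_nat n) * (dbar ^^ n) g z)"
        by (simp only: dbar_funpow_adag[OF smg(1)])
      then show ?thesis by (simp add: adag_def wirtinger_const)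
    qed
    then have "r \<in> poly_fock n" using poly_fockD[OF rS] by (auto simp: poly_fock_def)
    then have 0: "ip f r = 0" using Suc by simp
    have "of_nat m * ip f g = ip (adag (dbar f)) g" unfolding eig ip_cmult_left ..
    also have "\<dots> = cnj (ip (dbar g) (dbar f))"
      unfolding ip_adjoint_poly_fock[OF g df] by (rule ip_cnj)
    also have "\<dots> = ip (dbar f) (dbar g)" by (rule ip_cnj[symmetric])
    also have "\<dots> = ip f (adag (dbar g))" by (rule ip_adjoint_poly_fock[OF f dg])
    also have "adag (dbar g) = (\<lambda>z. r z + of_nat n * g z)" by (auto simp: r_def)
    also have "ip f \<dots> = ip f r + of_nat n * ip f g"
      using poly_fockD(1)[OF rS] poly_fockD(1)[OF g] poly_fockD(1)[OF f]
      by (subst ip_add_right) (auto intro: L2_cmult simp: ip_cmult_right)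
    finally have "(of_nat m - of_nat n) * ip f g = 0" using 0 by (simp add: algebra_simps)
    moreover have "(of_nat m - of_nat n :: complex) \<noteq> 0" using Suc.prems(1) by simp
    ultimately show ?case by simp
  qed
  then show ?thesis using f by (auto simp: true_fock_iff)
qed

section \<open>Reproducing kernels and Laguerre polynomials\<close>

lemma wirtinger_sum:
  assumes "\<And>i. i \<in> I \<Longrightarrow> smooth (f i)"
  shows "dbar (\<lambda>z. \<Sum>i\<in>I. f i z) z = (\<Sum>i\<in>I. dbar (f i) z)"
    and "dz (\<lambda>z. \<Sum>i\<in>I. f i z) z = (\<Sum>i\<in>I. dz (f i) z)"
  using assms
  by (induction I rule: infinite_finite_induct)
    (simp_all add: wirtinger_const wirtinger_add smooth_differentiable smooth_sum)

lemma adag_sum: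
  assumes "\<And>i. i \<in> I \<Longrightarrow> smooth (f i)"
  shows "adag (\<lambda>z. \<Sum>i\<in>I. f i z) z = (\<Sum>i\<in>I. adag (f i) z)"
  using assms by (simp add: adag_def wirtinger_sum sum_distrib_left sum_subtractf)

text \<open>In the variable \<open>x = w * cnj w\<close> this is the Laguerre operator
  \<open>- x * y'' - (1 - x) * y'\<close> applied to \<open>x ^ i\<close>.\<close>

lemma adag_dbar_radial:
  "adag (dbar (\<lambda>w. (w * cnj w) ^ i)) w = of_nat i * (w * cnj w) ^ i - (of_nat i)\<^sup>2 * (w * cnj w) ^ (i - 1)"
proof (cases i)
  case 0
  then show ?thesis by (simp add: dbar_zero wirtinger_const[abs_def] adag_def)
next
  case (Suc n)
  have sm: "smooth (\<lambda>w. w ^ a)" "smooth (\<lambda>w. cnj w ^ a)" for a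
    by (intro smooth_power smooth_ident smooth_cnj_ident)+
  have h: "((\<lambda>w::complex. w ^ a) has_field_derivative of_nat a * w ^ (a - 1)) (at w)" for w and a :: nat
    by (rule DERIV_cong[OF DERIV_power[OF DERIV_ident]]) simp
  have c: "dbar (\<lambda>w. cnj w ^ a) w = of_nat a * cnj w ^ (a - 1)" "dz (\<lambda>w. cnj w ^ a) w = 0" for a w
  proof -
    have "dbar (\<lambda>w. cnj (w ^ a)) w = cnj (dz (\<lambda>w. w ^ a) w)" "dz (\<lambda>w. cnj (w ^ a)) w = cnj (dbar (\<lambda>w. w ^ a) w)"
      by (intro wirtinger_cnj smooth_differentiable sm)+
    then show "dbar (\<lambda>w. cnj w ^ a) w = of_nat a * cnj w ^ (a - 1)" "dz (\<lambda>w. cnj w ^ a) w = 0"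
      by (simp_all add: wirtinger_holo[OF h])
  qed
  have m: "dbar (\<lambda>w. w ^ a * cnj w ^ b) w = of_nat b * (w ^ a * cnj w ^ (b - 1))"
      "dz (\<lambda>w. w ^ a * cnj w ^ b) w = of_nat a * (w ^ (a - 1) * cnj w ^ b)" for a b w
  proof -
    have "dbar (\<lambda>w. w ^ a * cnj w ^ b) w = w ^ a * dbar (\<lambda>w. cnj w ^ b) w + dbar (\<lambda>w. w ^ a) w * cnj w ^ b"
      "dz (\<lambda>w. w ^ a * cnj w ^ b) w = w ^ a * dz (\<lambda>w. cnj w ^ b) w + dz (\<lambda>w. w ^ a) w * cnj w ^ b"
      by (intro wirtinger_mult smooth_differentiable sm)+
    then show "dbar (\<lambda>w. w ^ a * cnj w ^ b) w = of_nat b * (w ^ a * cnj w ^ (b - 1))"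
      "dz (\<lambda>w. w ^ a * cnj w ^ b) w = of_nat a * (w ^ (a - 1) * cnj w ^ b)"
      by (simp_all add: wirtinger_holo[OF h] c)
  qed
  have "dbar (\<lambda>w. (w * cnj w) ^ i) = (\<lambda>w. of_nat i * (w ^ i * cnj w ^ (i - 1)))"
    by (auto simp: power_mult_distrib m)
  then have "adag (dbar (\<lambda>w. (w * cnj w) ^ i)) w = of_nat i * adag (\<lambda>w. w ^ i * cnj w ^ (i - 1)) w"
    by (simp only: adag_cmult[OF smooth_mult[OF sm]])
  also have "\<dots> = of_nat i * (w * cnj w) ^ i - (of_nat i)\<^sup>2 * (w * cnj w) ^ (i - 1)"
    unfolding adag_def m using Suc by (simp add: power_mult_distrib power2_eq_square algebra_simps)
  finally show ?thesis .
qed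

text \<open>The Laguerre differential equation, checked on coefficients, is the eigenvalue equation
  that characterizes the level.\<close>

lemma laguerre_true_fock: "(\<lambda>w. of_real (laguerre m ((cmod w)\<^sup>2))) \<in> true_fock (Suc m)"
proof -
  define c where "c i = complex_of_real ((-1) ^ i * real (m choose i) / fact i)" for i
  have eq: "(\<lambda>w. of_real (laguerre m ((cmod w)\<^sup>2))) = (\<lambda>w. \<Sum>i\<le>m. c i * (w * cnj w) ^ i)"
    unfolding laguerre_def complex_norm_square[symmetric] atLeast0AtMost of_real_sum
  proof (intro ext sum.cong refl)
    fix w :: complex and i assume "i \<in> {..m}"
    then have "m choose (m - i) = m choose i" by (simp add: binomial_symmetric[symmetric])
    then show "complex_of_real ((-1) ^ i * real (m choose (m - i)) * (((cmod w)\<^sup>2) ^ i / fact i)) = c i * of_real ((cmod w)\<^sup>2) ^ i"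
      by (simp add: c_def)
  qed
  have mem: "(\<lambda>w. (w * cnj w) ^ i) \<in> poly_fock (Suc m)" if "i \<le> m" for i
    using monomial_poly_fock[of i i] poly_fock_mono[of "Suc i" "Suc m"] that
    by (simp add: power_mult_distrib subset_iff)
  have sm: "smooth (\<lambda>w. (w * cnj w) ^ i)" for i
    by (intro smooth_power smooth_mult smooth_ident smooth_cnj_ident)
  have "adag (dbar (\<lambda>w. \<Sum>i\<le>m. c i * (w * cnj w) ^ i)) w = of_nat m * (\<Sum>i\<le>m. c i * (w * cnj w) ^ i)" for w
  proof -
    let ?x = "w * cnj w"
    have "dbar (\<lambda>w. \<Sum>i\<le>m. c i * (w * cnj w) ^ i) = (\<lambda>w. \<Sum>i\<le>m. c i * dbar (\<lambda>w. (w * cnj w) ^ i) w)"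
      by (auto simp: wirtinger_sum smooth_cmult sm wirtinger_cmult smooth_differentiable)
    then have "adag (dbar (\<lambda>w. \<Sum>i\<le>m. c i * (w * cnj w) ^ i)) w =
        (\<Sum>i\<le>m. c i * (of_nat i * ?x ^ i - (of_nat i)\<^sup>2 * ?x ^ (i - 1)))"
      by (simp add: adag_sum smooth_cmult smooth_dbar sm adag_cmult adag_dbar_radial)
    also have "\<dots> = (\<Sum>i\<le>m. c i * of_nat i * ?x ^ i) - (\<Sum>i\<le>m. c i * (of_nat i)\<^sup>2 * ?x ^ (i - 1))"
      by (simp add: right_diff_distrib sum_subtractf mult.assoc)
    \<comment> \<open>The index shift may keep the upper limit \<open>m\<close> because the
      coefficient after the last one vanishes.\<close>
    also have "(\<Sum>i\<le>m. c i * (of_nat i)\<^sup>2 * ?x ^ (i - 1)) = (\<Sum>i\<le>m. c (Suc i) * (of_nat (Suc i))\<^sup>2 * ?x ^ i)"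
    proof -
      have "c (Suc m) = 0" by (simp add: c_def)
      then have "(\<Sum>i\<le>m. c (Suc i) * (of_nat (Suc i))\<^sup>2 * ?x ^ i) = (\<Sum>i<m. c (Suc i) * (of_nat (Suc i))\<^sup>2 * ?x ^ i)"
        unfolding lessThan_Suc_atMost[symmetric] by simp
      then show ?thesis
        unfolding lessThan_Suc_atMost[symmetric] sum.lessThan_Suc_shift by simp
    qed
    also have "(\<Sum>i\<le>m. c i * of_nat i * ?x ^ i) - \<dots> = (\<Sum>i\<le>m. of_nat m * (c i * ?x ^ i))"
      unfolding sum_subtractf[symmetric]
    proof (intro sum.cong refl)
      fix i assume "i \<in> {..m}"
      then have i: "i \<le> m" by simp
      \<comment> \<open>The recurrence equivalent to the differential equation; it rests on the
        absorption identities for binomial coefficients.\<close>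
      have "c (Suc i) * (of_nat (Suc i))\<^sup>2 = - (of_nat m - of_nat i) * c i"
      proof -
        have "real (m choose Suc i) * real (Suc i) = real (m choose i) * (real m - real i)"
        proof -
          have "Suc i * (m choose Suc i) = (m choose i) * (m - i)"
            using binomial_absorb_comp[of m i] binomial_absorption[of i m] by (simp only: mult.commute)
          then have "real (Suc i * (m choose Suc i)) = real ((m choose i) * (m - i))" by (simp only:)
          then show ?thesis unfolding of_nat_mult of_nat_diff[OF i] by (simp only: mult.commute)
        qed
        moreover have "(-1) ^ Suc i * real (m choose Suc i) / fact (Suc i) * (real (Suc i))\<^sup>2 =
            - ((-1) ^ i * (real (m choose Suc i) * real (Suc i)) / fact i)"
          by (simp add: power2_eq_square del: of_nat_Suc)
        ultimately have "(-1) ^ Suc i * real (m choose Suc i) / fact (Suc i) * (real (Suc i))\<^sup>2 =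
            - ((-1) ^ i * (real (m choose i) * (real m - real i)) / fact i)"
          by (simp only:)
        also have "\<dots> = - (real m - real i) * ((-1) ^ i * real (m choose i) / fact i)"
          by (simp only: mult_minus_left times_divide_eq_right mult_ac)
        finally have "(-1) ^ Suc i * real (m choose Suc i) / fact (Suc i) * (real (Suc i))\<^sup>2 =
            - (real m - real i) * ((-1) ^ i * real (m choose i) / fact i)" .
        moreover have "c (Suc i) * (of_nat (Suc i))\<^sup>2 =
            complex_of_real ((-1) ^ Suc i * real (m choose Suc i) / fact (Suc i) * (real (Suc i))\<^sup>2)"
          by (simp only: c_def of_real_mult of_real_power of_real_of_nat_eq)
        moreover have "- (of_nat m - of_nat i) * c i =
            complex_of_real (- (real m - real i) * ((-1) ^ i * real (m choose i) / fact i))"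
          by (simp only: c_def of_real_mult of_real_minus of_real_diff of_real_of_nat_eq)
        ultimately show ?thesis by (simp only:)
      qed
      then show "c i * of_nat i * ?x ^ i - c (Suc i) * (of_nat (Suc i))\<^sup>2 * ?x ^ i = of_nat m * (c i * ?x ^ i)"
        by (simp only:) (simp add: algebra_simps)
    qed
    finally show ?thesis by (simp add: sum_distrib_left)
  qed
  then have eig: "adag (dbar (\<lambda>w. \<Sum>i\<le>m. c i * (w * cnj w) ^ i)) = (\<lambda>w. of_nat m * (\<Sum>i\<le>m. c i * (w * cnj w) ^ i))"
    by (rule ext)
  show ?thesis
    unfolding eq by (intro true_fock_eigenfunction[OF _ eig] poly_fock_sum poly_fock_cmult mem) simp
qed

section \<open>Roots of the Laguerre polynomials\<close>

lemma laguerre_0: "laguerre m 0 = 1"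
proof -
  have "laguerre m 0 = (\<Sum>j = 0..m. if j = 0 then 1 else 0)"
    unfolding laguerre_def by (intro sum.cong) auto
  then show ?thesis by simp
qed

text \<open>
  The integral of \<open>exp (-x) L\<^sub>m(x)\<close> over the half-line is an alternating sum of binomial coefficients,
  hence zero; \<open>G\<close> in the proof is the primitive of the integrand.
\<close>

lemma laguerre_root:
  assumes "m > 0"
  shows "\<exists>x\<ge>0. laguerre m x = 0"
proof (rule ccontr)
  assume nz: "\<not> (\<exists>x\<ge>0. laguerre m x = 0)"
  have cont: "continuous_on S (laguerre m)" for S
    unfolding laguerre_def[abs_def] by (intro continuous_intros) auto
  have l0: "laguerre m 0 = 1" by (rule laguerre_0)
  \<comment> \<open>Starting from the value one at zero, a polynomial without roots stays positive
    by the intermediate value theorem.\<close>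
  have pos: "laguerre m x > 0" if "x \<ge> 0" for x
  proof (rule ccontr)
    assume "\<not> laguerre m x > 0"
    then have "\<exists>y. 0 \<le> y \<and> y \<le> x \<and> laguerre m y = 0"
      using that l0 cont by (intro IVT2') auto
    then show False using nz by auto
  qed
  \<comment> \<open>Truncated exponential series: \<open>- exp (- x) * P j x\<close> is a primitive
    of \<open>exp (- x) * x ^ j / fact j\<close>.\<close>
  define P where "P j x = (\<Sum>i\<le>j. x ^ i / fact i)" for j and x :: real
  have dP: "((\<lambda>x. - exp (- x) * P j x) has_real_derivative exp (- x) * (x ^ j / fact j)) (at x)" for j x
  proof -
    have "(P j has_real_derivative (P j x - x ^ j / fact j)) (at x)"
    proof (induction j)
      case 0
      then show ?case by (simp add: P_def)
    next
      case (Suc j)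
      have "((\<lambda>x. x ^ Suc j / fact (Suc j)) has_real_derivative x ^ j / fact j) (at x)"
        by (rule DERIV_cong[OF DERIV_cdivide[OF DERIV_pow]]) (simp del: of_nat_Suc)
      from DERIV_add[OF Suc this] show ?case by (simp add: P_def)
    qed
    from DERIV_mult[OF DERIV_minus[OF DERIV_chain2[OF DERIV_exp DERIV_minus[OF DERIV_ident]]] this]
    show ?thesis by (rule DERIV_cong) (simp add: algebra_simps)
  qed
  define a where "a j = (-1) ^ j * real (m choose (m - j))" for j
  define G where "G x = (\<Sum>j\<le>m. a j * (- exp (- x) * P j x))" for x
  have dG: "(G has_real_derivative exp (- x) * laguerre m x) (at x)" for x
  proof -
    have "(G has_real_derivative (\<Sum>j\<le>m. a j * (exp (- x) * (x ^ j / fact j)))) (at x)"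
      unfolding G_def[abs_def] by (intro DERIV_sum DERIV_cmult dP)
    moreover have "(\<Sum>j\<le>m. a j * (exp (- x) * (x ^ j / fact j))) = exp (- x) * laguerre m x"
      unfolding laguerre_def atLeast0AtMost sum_distrib_left a_def by (intro sum.cong) auto
    ultimately show ?thesis by simp
  qed
  have "G 0 = 0"
  proof -
    have "P j 0 = 1" for j
      unfolding P_def by (induction j) simp_all
    then have "G 0 = - (\<Sum>j\<le>m. a j)" by (simp add: G_def sum_negf)
    also have "(\<Sum>j\<le>m. a j) = (\<Sum>j\<le>m. (-1) ^ j * real (m choose j))"
      unfolding a_def by (intro sum.cong) (auto simp: binomial_symmetric[symmetric])
    also have "\<dots> = 0" using choose_alternating_sum[OF assms, where 'a = real] by simp
    finally show ?thesis by simp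
  qed
  have mono: "G x < G y" if "0 \<le> x" "x < y" for x y
    using that pos dG by (intro DERIV_pos_imp_increasing[of x y G]) (auto intro!: exI[of _ "exp (- _) * laguerre m _"])
  \<comment> \<open>\<open>G\<close> starts at zero and increases strictly, so its limit zero at
    infinity gives the contradiction.\<close>
  have "(G \<longlongrightarrow> (\<Sum>j\<le>m. a j * 0)) at_top"
    unfolding G_def[abs_def]
  proof (intro tendsto_intros)
    fix j
    have "((\<lambda>x::real. - (\<Sum>i\<le>j. (x ^ i / exp x) * (1 / fact i))) \<longlongrightarrow> - (\<Sum>i\<le>j. 0 * (1 / fact i))) at_top"
      by (intro tendsto_intros tendsto_power_div_exp_0)
    moreover have "- exp (- x) * P j x = - (\<Sum>i\<le>j. (x ^ i / exp x) * (1 / fact i))" for x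
      by (simp add: P_def sum_distrib_left exp_minus divide_inverse mult_ac sum_negf)
    ultimately show "((\<lambda>x. - exp (- x) * P j x) \<longlongrightarrow> 0) at_top" by simp
  qed
  then have "(G \<longlongrightarrow> 0) at_top" by simp
  moreover have "\<forall>\<^sub>F x in at_top. G 1 \<le> G x"
    using eventually_ge_at_top[of 1] by eventually_elim (metis less_eq_real_def mono zero_le_one)
  ultimately have "G 1 \<le> 0"
    by (intro tendsto_lowerbound[of G 0 at_top]) auto
  then show False using mono[of 0 1] \<open>G 0 = 0\<close> by simp
qed

section \<open>Normalized kernels and the Berezin transform\<close>

lemma nkernel_0: "nkernel (Suc m) 0 = (\<lambda>w. of_real (laguerre m ((cmod w)\<^sup>2)))"
  by (rule ext) (simp add: nkernel_def)

lemma nkernel_weyl: "nkernel (Suc m) z = weyl z (nkernel (Suc m) 0)"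
  by (auto simp: nkernel_def weyl_def)

lemma weyl_nkernel_commute:
  "weyl \<xi> (nkernel (Suc m) z) w = exp (z * cnj \<xi> - \<xi> * cnj z) * weyl z (weyl \<xi> (nkernel (Suc m) 0)) w"
  unfolding nkernel_weyl[of m z] by (rule weyl_commute)

text \<open>Covariance reduces the claim to the kernel at zero: \<open>weyl z\<close> carries it to
  the kernel at \<open>z\<close> and commutes with \<open>weyl \<xi>\<close> up to a phase. The
  kernel at zero is real and lies on the level, so one diagonal matrix element decides.\<close>

lemma berezin_weyl_zero:
  assumes root: "laguerre m ((cmod \<xi>)\<^sup>2) = 0"
  shows "berezin (Suc m) (weyl \<xi>) z = 0"
proof -
  define k where "k = nkernel (Suc m) 0"
  have k: "k \<in> true_fock (Suc m)" unfolding k_def nkernel_0 by (rule laguerre_true_fock)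
  have kL: "k \<in> L2" by (rule poly_fockD(1)[OF true_fock_poly_fock[OF k]])
  have kreal: "cnj (k w) = k w" for w by (simp add: k_def nkernel_0)
  have km: "k \<in> borel_measurable borel" "weyl \<xi> k \<in> borel_measurable borel"
    using kL L2_weyl[OF kL] by (auto intro: L2_measurable)
  \<comment> \<open>Conjugation makes the holomorphic weight antiholomorphic; comparing exponents
    and translations shows that the parameter becomes \<open>- \<xi>\<close>.\<close>
  have "cnj (weyl \<xi> k w * cnj (k w)) = dshift (- \<xi>) 1 k w * cnj (k w)" for w
  proof -
    have "cnj (w * cnj \<xi> - of_real ((cmod \<xi>)\<^sup>2 / 2)) =
        - (of_real 1 * - \<xi> * cnj w) - of_real (1\<^sup>2 * (cmod (- \<xi>))\<^sup>2 / 2)" by simp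
    then have "cnj (exp (w * cnj \<xi> - of_real ((cmod \<xi>)\<^sup>2 / 2))) = dfac (- \<xi>) 1 w"
      unfolding dfac_def exp_cnj by (simp only:)
    then show ?thesis by (simp add: weyl_def dshift_def kreal)
  qed
  then have "cnj (ip (weyl \<xi> k) k) = ip (dshift (- \<xi>) 1 k) k"
    unfolding ip_def Bochner_Integration.integral_cnj[symmetric] by simp
  moreover have "exp (of_real ((cmod (- \<xi>))\<^sup>2 / 2)) * ip (dshift (- \<xi>) 1 k) k = 0"
    using ip_dshift_true_fock[OF k k, of "- \<xi>"] root by simp
  ultimately have 0: "ip (weyl \<xi> k) k = 0" by simp
  have e: "weyl \<xi> (nkernel (Suc m) z) = (\<lambda>w. exp (z * cnj \<xi> - \<xi> * cnj z) * weyl z (weyl \<xi> k) w)"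
    unfolding k_def by (rule ext) (rule weyl_nkernel_commute)
  have "berezin (Suc m) (weyl \<xi>) z = ip (\<lambda>w. exp (z * cnj \<xi> - \<xi> * cnj z) * weyl z (weyl \<xi> k) w) (weyl z k)"
    unfolding berezin_def e unfolding nkernel_weyl[of m z] k_def ..
  also have "\<dots> = 0" unfolding ip_cmult_left ip_weyl[OF km(2,1)] 0 by simp
  finally show ?thesis .
qed

section \<open>Boundedness of Weyl operators and continuity under conjugation\<close>

lemma L2norm_weyl: "f \<in> L2 \<Longrightarrow> L2norm (weyl z f) = L2norm f"
  by (simp add: L2norm_def norm_weyl)

lemma L2norm_cmult: "L2norm (\<lambda>z. c * f z) = cmod c * L2norm f"
  by (simp add: L2norm_def norm_mult power_mult_distrib real_sqrt_mult)

lemma weyl_bounded_op: "weyl \<xi> \<in> bounded_ops (Suc m)"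
proof -
  have "\<exists>C. \<forall>f\<in>true_fock (Suc m). L2norm (weyl \<xi> f) \<le> C * L2norm f"
    using L2norm_weyl[OF poly_fockD(1)[OF true_fock_poly_fock]] by (intro exI[of _ 1]) simp
  moreover have "weyl \<xi> (\<lambda>z. f z + g z) = (\<lambda>z. weyl \<xi> f z + weyl \<xi> g z)" for f g
    by (auto simp: weyl_def distrib_left)
  moreover have "weyl \<xi> (\<lambda>z. c * f z) = (\<lambda>z. c * weyl \<xi> f z)" for c f
    by (auto simp: weyl_def)
  ultimately show ?thesis by (simp add: bounded_ops_def weyl_true_fock)
qed

text \<open>Conjugation by \<open>weyl z\<close> multiplies \<open>weyl \<xi>\<close> by a phase, so
  the operator norm of the difference is at most the distance of that phase from one.\<close>

lemma weyl_C1_op: "weyl \<xi> \<in> C1_ops (Suc m)"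
proof -
  define c where "c z = exp (\<xi> * cnj z - z * cnj \<xi>) - 1" for z
  have comm: "weyl z (weyl \<xi> (weyl (- z) f)) w - weyl \<xi> f w = c z * weyl \<xi> f w" for z f w
  proof -
    have "weyl z (weyl \<xi> (weyl (- z) f)) w = exp (\<xi> * cnj z - z * cnj \<xi>) * weyl \<xi> f w"
      using weyl_commute[of z \<xi> "weyl (- z) f" w] by (simp only: weyl_inverse)
    then show ?thesis by (simp add: c_def left_diff_distrib)
  qed
  have norm: "L2norm (\<lambda>w. weyl z (weyl \<xi> (weyl (- z) f)) w - weyl \<xi> f w) = cmod (c z) * L2norm f"
    if "f \<in> true_fock (Suc m)" for z f
    by (simp only: comm L2norm_cmult L2norm_weyl[OF poly_fockD(1)[OF true_fock_poly_fock[OF that]]])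
  \<comment> \<open>The supremum is over real numbers: nonemptiness is needed to bound it above, and
    a member with nonnegative value to bound it below.\<close>
  have zero: "(\<lambda>_. 0) \<in> {f \<in> true_fock (Suc m). L2norm f \<le> 1}"
    by (simp add: zero_in_true_fock L2norm_def)
  have bound: "norm (op_norm (Suc m) (\<lambda>f w. weyl z (weyl \<xi> (weyl (- z) f)) w - weyl \<xi> f w)) \<le> cmod (c z)" for z
  proof -
    let ?N = "\<lambda>f. L2norm (\<lambda>w. weyl z (weyl \<xi> (weyl (- z) f)) w - weyl \<xi> f w)"
    have le: "?N f \<le> cmod (c z)" if "f \<in> {f \<in> true_fock (Suc m). L2norm f \<le> 1}" for f
      using that norm[of f z] mult_left_le[of "L2norm f" "cmod (c z)"] by auto
    have "(SUP f \<in> {f \<in> true_fock (Suc m). L2norm f \<le> 1}. ?N f) \<le> cmod (c z)"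
      using zero le by (intro cSUP_least) auto
    moreover have "0 \<le> (SUP f \<in> {f \<in> true_fock (Suc m). L2norm f \<le> 1}. ?N f)"
    proof (rule cSUP_upper2[OF _ zero])
      show "bdd_above (?N ` {f \<in> true_fock (Suc m). L2norm f \<le> 1})"
        using le by (intro bdd_aboveI2) auto
      show "0 \<le> ?N (\<lambda>_. 0)" by (simp add: L2norm_def)
    qed
    ultimately show ?thesis by (simp add: op_norm_def)
  qed
  have lim: "((\<lambda>z. cmod (c z)) \<longlongrightarrow> 0) (at 0)"
  proof -
    have "((\<lambda>z. cmod (c z)) \<longlongrightarrow> cmod (exp (\<xi> * cnj 0 - 0 * cnj \<xi>) - 1)) (at 0)"
      unfolding c_def by (intro tendsto_intros)
    then show ?thesis by simp
  qed
  have "((\<lambda>z. op_norm (Suc m) (\<lambda>f w. weyl z (weyl \<xi> (weyl (- z) f)) w - weyl \<xi> f w)) \<longlongrightarrow> 0) (at 0)"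
    by (rule Lim_null_comparison[OF always_eventually[OF allI[OF bound]] lim])
  then show ?thesis using weyl_bounded_op by (simp add: C1_ops_def)
qed

theorem mainTheorem3:
  fixes k :: nat
  assumes "k > 1"
  shows "(\<exists>f \<in> Linfty. \<not> (AE z in lborel. f z = 0) \<and>
            (\<forall>g \<in> true_fock k. toeplitz f k g = (\<lambda>_. 0))) \<and>
         (\<exists>A \<in> C1_ops k. (\<exists>g \<in> true_fock k. A g \<noteq> (\<lambda>_. 0)) \<and>
            (\<forall>z. berezin k A z = 0)) \<and>
         (\<forall>(\<xi>::complex) f. laguerre (k - 1) ((cmod \<xi>)\<^sup>2) = 0 \<longrightarrow>
            f = (\<lambda>z. exp (\<i> * of_real (symp_form z \<xi>) + of_real ((cmod \<xi>)\<^sup>2 / 2))) \<longrightarrow>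
            (\<forall>g \<in> true_fock k. toeplitz f k g = (\<lambda>_. 0)) \<and>
            (\<forall>g \<in> true_fock 1. toeplitz f 1 g = weyl \<xi> g))"
proof -
  obtain m where k: "k = Suc m" and m: "m > 0" using assms by (cases k) auto
  let ?f = "\<lambda>\<xi> z. exp (\<i> * of_real (symp_form z \<xi>) + of_real ((cmod \<xi>)\<^sup>2 / 2))"
  have T: "toeplitz (?f \<xi>) k g = (\<lambda>_. 0)" if "laguerre m ((cmod \<xi>)\<^sup>2) = 0" "g \<in> true_fock k" for \<xi> g
    using toeplitz_exp_symp_form[of g m \<xi>] that by (simp add: k)
  \<comment> \<open>On the first level the polynomial is constantly one, so the factor vanishing on
    level \<open>k\<close> becomes trivial.\<close>
  have T1: "toeplitz (?f \<xi>) 1 g = weyl \<xi> g" if "g \<in> true_fock 1" for \<xi> g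
    using toeplitz_exp_symp_form[of g 0 \<xi>] that by (simp add: laguerre_def)
  obtain x where x: "x \<ge> 0" "laguerre m x = 0" using laguerre_root[OF m] by blast
  \<comment> \<open>The polynomial is evaluated at the squared modulus, hence the square
    root.\<close>
  define \<xi> where "\<xi> = complex_of_real (sqrt x)"
  have root: "laguerre m ((cmod \<xi>)\<^sup>2) = 0" using x by (simp add: \<xi>_def)
  have "continuous_on UNIV (?f \<xi>)" unfolding symp_form_def by (intro continuous_intros)
  then have "?f \<xi> \<in> borel_measurable lborel" unfolding measurable_lborel2 by (rule borel_measurable_continuous)
  moreover have "AE z in lborel. cmod (?f \<xi> z) \<le> exp ((cmod \<xi>)\<^sup>2 / 2)" by (intro AE_I2) simp
  ultimately have f: "?f \<xi> \<in> Linfty" unfolding Linfty_def by blast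
  have nz: "\<not> (AE z in lborel. ?f \<xi> z = 0)"
    by (simp add: AE_iff_null null_sets_def)
  have "\<exists>f \<in> Linfty. \<not> (AE z in lborel. f z = 0) \<and> (\<forall>g \<in> true_fock k. toeplitz f k g = (\<lambda>_. 0))"
    by (intro bexI[OF _ f] conjI nz ballI T[OF root])
  moreover have "\<exists>A \<in> C1_ops k. (\<exists>g \<in> true_fock k. A g \<noteq> (\<lambda>_. 0)) \<and> (\<forall>z. berezin k A z = 0)"
  proof (intro bexI[of _ "weyl \<xi>"] conjI allI)
    show "weyl \<xi> \<in> C1_ops k" unfolding k by (rule weyl_C1_op)
    show "berezin k (weyl \<xi>) z = 0" for z unfolding k by (rule berezin_weyl_zero[OF root])
    \<comment> \<open>At the point \<open>\<xi>\<close> the translated kernel takes its central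
      value, one, times an exponential.\<close>
    have "nkernel k 0 \<in> true_fock k" unfolding k nkernel_0 by (rule laguerre_true_fock)
    moreover have "weyl \<xi> (nkernel k 0) \<xi> \<noteq> 0"
      by (simp add: weyl_def k nkernel_0 laguerre_0)
    ultimately show "\<exists>g \<in> true_fock k. weyl \<xi> g \<noteq> (\<lambda>_. 0)" by metis
  qed
  moreover have third: "(\<forall>g \<in> true_fock k. toeplitz f k g = (\<lambda>_. 0)) \<and> (\<forall>g \<in> true_fock 1. toeplitz f 1 g = weyl \<eta> g)"
    if "laguerre (k - 1) ((cmod \<eta>)\<^sup>2) = 0" "f = ?f \<eta>" for \<eta> f
    using that(1) unfolding that(2) k diff_Suc_1 by (intro conjI ballI T[unfolded k] T1)
  ultimately show ?thesis
    using third by (intro conjI[OF _ conjI] allI impI)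
qed

end
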